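(* The functor $\mathcal{B}:\mathbf{AF}\to\mathbf{BD}$ is a strong classification functor: for all objects $\mathcal A_1,\mathcal A_2$ of $\mathbf{AF}$, every isomorphism from $\mathcal B(\mathcal A_1)$ onto $\mathcal B(\mathcal A_2)$ in $\mathbf{BD}$ is of the form $\mathcal B(\varphi)$ for some isomorphism $\varphi:\mathcal A_1\to\mathcal A_2$ in $\mathbf{AF}$.
   Context: Multiplicity matrices. For a $k_1\times 1$ matrix $V_1$ and a $k_2\times 1$ matrix $V_2$ of strictly positive integers, a multiplicity matrix $E:V_1\to V_2$ is a $k_2\times k_1$ matrix of non-negative integers with $EV_1\le V_2$ entrywise; it is an embedding matrix if no column is zero. For a $*$-homomorphism $\varphi:\mathcal M_{n_1}\oplus\cdots\oplus\mathcal M_{n_k}\to\mathcal M_{m_1}\oplus\cdots\oplus\mathcal M_{m_l}$, $R_\varphi=(a_{ij})$ is the unique $l\times k$ matrix of non-negative integers such that for some unitary $v=(v_1,\dots,v_l)$ of the codomain, $v_i\varphi_i(u_1,\dots,u_k)v_i^*=\mathrm{diag}(u_1^{(a_{i1})},\dots,u_k^{(a_{ik})},0^{(s_i)})$ for all $i$, where $\varphi_i$ is the $i$-th component of $\varphi$ and $u^{(a)}$ denotes $a$ diagonal copies of $u$. Category $\mathbf{BD}$. A (non-zero) Bratteli diagram is a pair $(V,E)=((V_n)_{n\ge1},(E_n)_{n\ge1})$ with $V_n$ a $k_n\times1$ matrix of strictly positive integers ($k_n\ge1$) and $E_n:V_n\to V_{n+1}$ an embedding matrix; $E_{nm}=E_{m-1}\cdots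 E_n$ for $n<m$, $E_{nn}=I$. A premorphism $(V,E)\to(W,S)$ is a pair $((F_n),(f_n))$ with $f_1\le f_2\le\cdots$ positive integers, $\sup f_n=\infty$, $F_n:V_n\to W_{f_n}$ multiplicity matrices, and $F_{n+1}E_n=S_{f_nf_{n+1}}F_n$ for all $n$. Composition: $((G_n),(g_n))((F_n),(f_n))=((G_{f_n}F_n)_n,(g_{f_n})_n)$; identity: $((I)_n,(n)_n)$. Premorphisms $((F_n),(f_n)),((G_n),(g_n)):(V,E)\to(W,S)$ are equivalent if and only if for each $n$ there is $m\ge f_n,g_n$ with $S_{f_nm}F_n=S_{g_nm}G_n$. Morphisms of $\mathbf{BD}$ are equivalence classes of premorphisms. There is also a zero diagram $0$, with exactly one morphism to and from each diagram; a composite $B\to0\to C$ of non-zero diagrams is the class of the premorphism with all matrices zero. Category $\mathbf{AF}$. Objects are triples $\mathcal A=(A,(A_n)_{n\ge1},(\varphi_n)_{n\ge1})$ where $A$ is an AF algebra, $(A_n)$ is an increasing sequence of finite dimensional C$^*$-subalgebras with dense union in $A$, and $\varphi_n$ is a $*$-isomorphism of $A_n$ onto an algebra $A_n'=\mathcal M_{m_{n1}}\oplus\cdots\oplus\mathcal M_{m_{nk_n}}$ (with $k_n\ge1$, $m_{ni}\ge1$ when $A\ne0$). A morphism from $(A,(A_n),(\varphi_n))$ to $(B,(B_n),(\psi_n))$ is a $*$-homomorphism $A\to B$. The functor $\mathcal B$. On objects: $\mathcal B(\mathcal A)=((V_n),(E_n))$ with $V_n=(m_{n1},\dots,m_{nk_n})^T$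 and $E_n=R_{\varphi_n'}$, where $\varphi_n'=\varphi_{n+1}\varphi_n^{-1}:A_n'\to A_{n+1}'$. On a morphism $\varphi:A\to B$ from $(A,(A_n),(\varphi_n))$ to $(B,(B_n),(\psi_n))$: choose unitaries $u_n\in B^\sim$ ($B^\sim=B$ if $B$ is unital, otherwise the unitization of $B$) and positive integers $f_1\le f_2\le\cdots$ with $\sup f_n=\infty$, $\|u_n-1\|<\frac12$ and $u_n\varphi(A_n)u_n^*\subseteq B_{f_n}$ (such choices exist); put $g_n=(\mathrm{Ad}\,u_n)\circ\varphi|_{A_n}:A_n\to B_{f_n}$ and $F_n=R_{\psi_{f_n}g_n\varphi_n^{-1}}$; $\mathcal B(\varphi)$ is the equivalence class of $((F_n),(f_n))$, which is independent of the choices. The zero algebra is sent to the zero diagram and zero homomorphisms to zero morphisms. *)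

theory Defs
  imports
    "HOL-Analysis.Elementary_Normed_Spaces"
    "HOL-Analysis.Operator_Norm"
    "Jordan_Normal_Form.Schur_Decomposition"
begin

text \<open>
  All sequences indexed by the positive integers in the mathematics (filtrations, diagrams,
  premorphisms, and the values of the index functions of premorphisms) are indexed by \<open>nat\<close>
  starting at 0.
\<close>


section \<open>C*-algebras and *-homomorphisms\<close>

text \<open>A (not necessarily unital, possibly zero) C*-algebra is a type of the following class.\<close>

class cstar_algebra = real_normed_algebra + banach +
  fixes scaleC :: "complex \<Rightarrow> 'a \<Rightarrow> 'a"  (infixr \<open>*\<^sub>C\<close> 75)
    and star :: "'a \<Rightarrow> 'a"
  assumes scaleC_add_right: "c *\<^sub>C (x + y) = c *\<^sub>C x + c *\<^sub>C y"
    and scaleC_add_left: "(c + d) *\<^sub>C x = c *\<^sub>C x + d *\<^sub>C x"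
    and scaleC_scaleC: "c *\<^sub>C (d *\<^sub>C x) = (c * d) *\<^sub>C x"
    and scaleC_of_real: "complex_of_real r *\<^sub>C x = r *\<^sub>R x"
    and mult_scaleC_left: "(c *\<^sub>C x) * y = c *\<^sub>C (x * y)"
    and mult_scaleC_right: "x * (c *\<^sub>C y) = c *\<^sub>C (x * y)"
    and norm_scaleC: "norm (c *\<^sub>C x) = cmod c * norm x"
    and star_star: "star (star x) = x"
    and star_add: "star (x + y) = star x + star y"
    and star_scaleC: "star (c *\<^sub>C x) = cnj c *\<^sub>C star x"
    and star_mult: "star (x * y) = star y * star x"
    and norm_star_mult: "norm (star x * x) = (norm x)\<^sup>2"

text \<open>
  Raw *-algebra structures, so that one notion of *-homomorphism covers C*-algebras, their
  subalgebras, and direct sums of matrix algebras.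
\<close>

record 'a star_alg =
  sa_carrier :: "'a set"
  sa_add :: "'a \<Rightarrow> 'a \<Rightarrow> 'a"
  sa_scale :: "complex \<Rightarrow> 'a \<Rightarrow> 'a"
  sa_mult :: "'a \<Rightarrow> 'a \<Rightarrow> 'a"
  sa_star :: "'a \<Rightarrow> 'a"

definition star_hom :: "'a star_alg \<Rightarrow> 'b star_alg \<Rightarrow> ('a \<Rightarrow> 'b) \<Rightarrow> bool" where
  "star_hom X Y f \<longleftrightarrow>
     (\<forall>x\<in>sa_carrier X. f x \<in> sa_carrier Y) \<and>
     (\<forall>x\<in>sa_carrier X. \<forall>y\<in>sa_carrier X. f (sa_add X x y) = sa_add Y (f x) (f y)) \<and>
     (\<forall>c. \<forall>x\<in>sa_carrier X. f (sa_scale X c x) = sa_scale Y c (f x)) \<and>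
     (\<forall>x\<in>sa_carrier X. \<forall>y\<in>sa_carrier X. f (sa_mult X x y) = sa_mult Y (f x) (f y)) \<and>
     (\<forall>x\<in>sa_carrier X. f (sa_star X x) = sa_star Y (f x))"

definition star_iso :: "'a star_alg \<Rightarrow> 'b star_alg \<Rightarrow> ('a \<Rightarrow> 'b) \<Rightarrow> bool" where
  "star_iso X Y f \<longleftrightarrow> star_hom X Y f \<and> bij_betw f (sa_carrier X) (sa_carrier Y)"

definition sub_alg :: "'a::cstar_algebra set \<Rightarrow> 'a star_alg" where
  "sub_alg S = \<lparr>sa_carrier = S, sa_add = (+), sa_scale = scaleC, sa_mult = (*), sa_star = star\<rparr>"

text \<open>Norm-closedness is automatic for finite dimensional subspaces.\<close>

definition fd_cstar_subalgebra :: "'a::cstar_algebra set \<Rightarrow> bool" where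
  "fd_cstar_subalgebra S \<longleftrightarrow>
     (\<exists>F. finite F \<and> S = Modules.module.span scaleC F) \<and>
     (\<forall>x\<in>S. \<forall>y\<in>S. x * y \<in> S) \<and> (\<forall>x\<in>S. star x \<in> S)"


section \<open>Direct sums of full matrix algebras\<close>

text \<open>\<open>block_alg [m1, \<dots>, mk]\<close> is the direct sum of the algebras of \<open>mi \<times> mi\<close> complex matrices.\<close>

definition block_carrier :: "nat list \<Rightarrow> complex mat list set" where
  "block_carrier ms =
     {xs. length xs = length ms \<and> (\<forall>i<length ms. xs ! i \<in> carrier_mat (ms ! i) (ms ! i))}"

definition block_alg :: "nat list \<Rightarrow> complex mat list star_alg" where
  "block_alg ms = \<lparr>sa_carrier = block_carrier ms, sa_add = map2 (+),
     sa_scale = (\<lambda>c. map (\<lambda>x. c \<cdot>\<^sub>m x)), sa_mult = map2 (*), sa_star = map mat_adjoint\<rparr>"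

definition block_unitary :: "nat list \<Rightarrow> complex mat list \<Rightarrow> bool" where
  "block_unitary ms v \<longleftrightarrow> v \<in> block_carrier ms \<and>
     (\<forall>i<length ms. v ! i * mat_adjoint (v ! i) = 1\<^sub>m (ms ! i) \<and>
                    mat_adjoint (v ! i) * v ! i = 1\<^sub>m (ms ! i))"

text \<open>\<open>diag(u_1^{(a_{i1})}, \<dots>, u_k^{(a_{ik})}, 0^{(s)})\<close>\<close>

definition repeat_diag :: "nat mat \<Rightarrow> nat \<Rightarrow> nat \<Rightarrow> complex mat list \<Rightarrow> complex mat" where
  "repeat_diag a i s u =
     diag_block_mat
       (concat (map (\<lambda>j. replicate (a $$ (i, j)) (u ! j)) [0..<length u]) @ [0\<^sub>m s s])"

text \<open>The matrix \<open>R\<^sub>\<phi>\<close> of a *-homomorphism \<open>block_alg ms \<rightarrow> block_alg ns\<close>.\<close>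

definition mult_matrix_of ::
    "nat list \<Rightarrow> nat list \<Rightarrow> (complex mat list \<Rightarrow> complex mat list) \<Rightarrow> nat mat" where
  "mult_matrix_of ms ns \<phi> =
     (THE a. a \<in> carrier_mat (length ns) (length ms) \<and>
        (\<exists>v s. block_unitary ns v \<and>
           (\<forall>i<length ns. \<forall>u\<in>block_carrier ms.
              v ! i * (\<phi> u ! i) * mat_adjoint (v ! i) = repeat_diag a i (s i) u)))"


section \<open>The category BD\<close>

definition multiplicity_matrix :: "nat vec \<Rightarrow> nat vec \<Rightarrow> nat mat \<Rightarrow> bool" where
  "multiplicity_matrix V1 V2 E \<longleftrightarrow>
     E \<in> carrier_mat (dim_vec V2) (dim_vec V1) \<and> E *\<^sub>v V1 \<le> V2"

definition embedding_matrix :: "nat vec \<Rightarrow> nat vec \<Rightarrow> nat mat \<Rightarrow> bool" where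
  "embedding_matrix V1 V2 E \<longleftrightarrow>
     multiplicity_matrix V1 V2 E \<and> (\<forall>j<dim_col E. col E j \<noteq> 0\<^sub>v (dim_row E))"

datatype bratteli =
    Zero_BD
  | BD (bd_V: "nat \<Rightarrow> nat vec") (bd_E: "nat \<Rightarrow> nat mat")

definition bd_object :: "bratteli \<Rightarrow> bool" where
  "bd_object X \<longleftrightarrow> (case X of Zero_BD \<Rightarrow> True
     | BD V E \<Rightarrow> (\<forall>n. dim_vec (V n) \<ge> 1 \<and> (\<forall>i<dim_vec (V n). V n $ i > 0) \<and>
                      embedding_matrix (V n) (V (Suc n)) (E n)))"

primrec bd_path :: "bratteli \<Rightarrow> nat \<Rightarrow> nat \<Rightarrow> nat mat" where
  "bd_path X n 0 = 1\<^sub>m (dim_vec (bd_V X n))"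
| "bd_path X n (Suc k) = bd_E X (n + k) * bd_path X n k"

text \<open>\<open>bd_conn X n m\<close> is \<open>E_{nm} = E_{m-1} \<cdots> E_n\<close>; meaningful for \<open>n \<le> m\<close>.\<close>

definition bd_conn :: "bratteli \<Rightarrow> nat \<Rightarrow> nat \<Rightarrow> nat mat" where
  "bd_conn X n m = bd_path X n (m - n)"

type_synonym premor = "(nat \<Rightarrow> nat mat) \<times> (nat \<Rightarrow> nat)"

definition premorphism :: "bratteli \<Rightarrow> bratteli \<Rightarrow> premor \<Rightarrow> bool" where
  "premorphism X Y = (\<lambda>(F, f). mono f \<and> \<not> bdd_above (range f) \<and>
     (\<forall>n. multiplicity_matrix (bd_V X n) (bd_V Y (f n)) (F n)) \<and>
     (\<forall>n. F (Suc n) * bd_E X n = bd_conn Y (f n) (f (Suc n)) * F n))"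

definition premor_id :: "bratteli \<Rightarrow> premor" where
  "premor_id X = (\<lambda>n. 1\<^sub>m (dim_vec (bd_V X n)), \<lambda>n. n)"

definition premor_zero :: "bratteli \<Rightarrow> bratteli \<Rightarrow> premor" where
  "premor_zero X Y = (\<lambda>n. 0\<^sub>m (dim_vec (bd_V Y n)) (dim_vec (bd_V X n)), \<lambda>n. n)"

definition premor_comp :: "premor \<Rightarrow> premor \<Rightarrow> premor" where
  "premor_comp = (\<lambda>(G, g) (F, f). (\<lambda>n. G (f n) * F n, \<lambda>n. g (f n)))"

definition premor_equiv :: "bratteli \<Rightarrow> bratteli \<Rightarrow> (premor \<times> premor) set" where
  "premor_equiv X Y =
     {((F, f), (G, g)). premorphism X Y (F, f) \<and> premorphism X Y (G, g) \<and>
        (\<forall>n. \<exists>m. m \<ge> f n \<and> m \<ge> g n \<and> bd_conn Y (f n) m * F n = bd_conn Y (g n) m * G n)}"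

abbreviation premor_class :: "bratteli \<Rightarrow> bratteli \<Rightarrow> premor \<Rightarrow> premor set" where
  "premor_class X Y P \<equiv> premor_equiv X Y `` {P}"

text \<open>
  \<open>Zero_mor\<close> is the unique morphism whenever the domain or the codomain is the zero diagram.
  All other morphisms, including the zero morphisms between non-zero diagrams, are
  equivalence classes of premorphisms.
\<close>

datatype bd_mor = Zero_mor | Mor "premor set"

definition bd_hom :: "bratteli \<Rightarrow> bratteli \<Rightarrow> bd_mor set" where
  "bd_hom X Y =
     (if \<not> (bd_object X \<and> bd_object Y) then {}
      else if X = Zero_BD \<or> Y = Zero_BD then {Zero_mor}
      else Mor ` ({P. premorphism X Y P} // premor_equiv X Y))"

definition bd_id :: "bratteli \<Rightarrow> bd_mor" where
  "bd_id X = (if X = Zero_BD then Zero_mor else Mor (premor_class X X (premor_id X)))"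

text \<open>\<open>bd_comp X Y Z \<eta> \<theta>\<close> is the composite of \<open>\<theta> : X \<rightarrow> Y\<close> and \<open>\<eta> : Y \<rightarrow> Z\<close>.\<close>

definition bd_comp ::
    "bratteli \<Rightarrow> bratteli \<Rightarrow> bratteli \<Rightarrow> bd_mor \<Rightarrow> bd_mor \<Rightarrow> bd_mor" where
  "bd_comp X Y Z \<eta> \<theta> =
     (if X = Zero_BD \<or> Z = Zero_BD then Zero_mor
      else if Y = Zero_BD then Mor (premor_class X Z (premor_zero X Z))
      else (case (\<eta>, \<theta>) of
              (Mor d, Mor c) \<Rightarrow> Mor (\<Union>Q\<in>d. \<Union>P\<in>c. premor_class X Z (premor_comp Q P))
            | _ \<Rightarrow> Zero_mor))"

definition bd_iso :: "bratteli \<Rightarrow> bratteli \<Rightarrow> bd_mor \<Rightarrow> bool" where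
  "bd_iso X Y \<theta> \<longleftrightarrow> \<theta> \<in> bd_hom X Y \<and>
     (\<exists>\<eta>\<in>bd_hom Y X. bd_comp X Y X \<eta> \<theta> = bd_id X \<and> bd_comp Y X Y \<theta> \<eta> = bd_id Y)"


section \<open>The category AF\<close>

text \<open>
  The algebra of an object is the whole type \<open>'a\<close>. The maps \<open>af_coord \<A> n\<close> are
  relevant only on \<open>af_filt \<A> n\<close>.
\<close>

record 'a af_obj =
  af_filt :: "nat \<Rightarrow> 'a set"
  af_sizes :: "nat \<Rightarrow> nat list"
  af_coord :: "nat \<Rightarrow> 'a \<Rightarrow> complex mat list"

abbreviation zero_algebra :: "'a::cstar_algebra itself \<Rightarrow> bool" where
  "zero_algebra _ \<equiv> (UNIV :: 'a set) = {0}"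

definition af_object :: "'a::cstar_algebra af_obj \<Rightarrow> bool" where
  "af_object \<A> \<longleftrightarrow>
     (\<forall>n. fd_cstar_subalgebra (af_filt \<A> n)) \<and>
     incseq (af_filt \<A>) \<and>
     closure (\<Union>n. af_filt \<A> n) = UNIV \<and>
     (\<forall>n. star_iso (sub_alg (af_filt \<A> n)) (block_alg (af_sizes \<A> n)) (af_coord \<A> n)) \<and>
     (\<not> zero_algebra TYPE('a) \<longrightarrow>
        (\<forall>n. af_sizes \<A> n \<noteq> [] \<and> (\<forall>m\<in>set (af_sizes \<A> n). m \<ge> 1)))"

definition af_hom ::
    "'a::cstar_algebra af_obj \<Rightarrow> 'b::cstar_algebra af_obj \<Rightarrow> ('a \<Rightarrow> 'b) set" where
  "af_hom \<A> \<B> =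
     {\<phi>. af_object \<A> \<and> af_object \<B> \<and> star_hom (sub_alg UNIV) (sub_alg UNIV) \<phi>}"

definition af_iso ::
    "'a::cstar_algebra af_obj \<Rightarrow> 'b::cstar_algebra af_obj \<Rightarrow> ('a \<Rightarrow> 'b) \<Rightarrow> bool" where
  "af_iso \<A> \<B> \<phi> \<longleftrightarrow> \<phi> \<in> af_hom \<A> \<B> \<and> (\<exists>\<psi>\<in>af_hom \<B> \<A>. \<psi> \<circ> \<phi> = id \<and> \<phi> \<circ> \<psi> = id)"


section \<open>The algebra \<open>B\<^sup>\<sim>\<close>\<close>

text \<open>
  An element of \<open>B\<^sup>\<sim>\<close> is a pair \<open>(b, s)\<close> standing for \<open>b + s 1\<close>. If \<open>B\<close> is unital, only the
  pairs \<open>(b, 0)\<close> occur and they form a copy of \<open>B\<close>; otherwise all pairs occur, and the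
  norm is the norm of \<open>b + s 1\<close> as a left multiplier of \<open>B\<close>. The library's product norm on
  pairs is not used.
\<close>

definition has_unit :: "'b::cstar_algebra itself \<Rightarrow> bool" where
  "has_unit _ \<longleftrightarrow> (\<exists>e::'b. \<forall>x. e * x = x \<and> x * e = x)"

definition tilde_carrier :: "('b::cstar_algebra \<times> complex) set" where
  "tilde_carrier = (if has_unit TYPE('b) then UNIV \<times> {0} else UNIV)"

definition tilde_one :: "'b::cstar_algebra \<times> complex" where
  "tilde_one = (if has_unit TYPE('b) then (THE e. \<forall>x. e * x = x \<and> x * e = x, 0) else (0, 1))"

definition tilde_mult ::
    "'b::cstar_algebra \<times> complex \<Rightarrow> 'b \<times> complex \<Rightarrow> 'b \<times> complex" where
  "tilde_mult = (\<lambda>(a, s) (b, t). (a * b + s *\<^sub>C b + t *\<^sub>C a, s * t))"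

definition tilde_star :: "'b::cstar_algebra \<times> complex \<Rightarrow> 'b \<times> complex" where
  "tilde_star = (\<lambda>(a, s). (star a, cnj s))"

definition tilde_norm :: "'b::cstar_algebra \<times> complex \<Rightarrow> real" where
  "tilde_norm = (\<lambda>(a, s). if has_unit TYPE('b) then norm a else onorm (\<lambda>x. a * x + s *\<^sub>C x))"

definition tilde_unitary :: "'b::cstar_algebra \<times> complex \<Rightarrow> bool" where
  "tilde_unitary u \<longleftrightarrow> u \<in> tilde_carrier \<and>
     tilde_mult u (tilde_star u) = tilde_one \<and> tilde_mult (tilde_star u) u = tilde_one"

text \<open>\<open>u b u\<^sup>*\<close>, which lies in \<open>B\<close> because \<open>B\<close> is an ideal of \<open>B\<^sup>\<sim>\<close>.\<close>

definition tilde_Ad :: "'b::cstar_algebra \<times> complex \<Rightarrow> 'b \<Rightarrow> 'b" where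
  "tilde_Ad u b = fst (tilde_mult (tilde_mult u (b, 0)) (tilde_star u))"


section \<open>The functor from AF to BD\<close>

definition B_obj :: "'a::cstar_algebra af_obj \<Rightarrow> bratteli" where
  "B_obj \<A> =
     (if zero_algebra TYPE('a) then Zero_BD
      else BD (\<lambda>n. vec_of_list (af_sizes \<A> n))
              (\<lambda>n. mult_matrix_of (af_sizes \<A> n) (af_sizes \<A> (Suc n))
                     (af_coord \<A> (Suc n) \<circ> inv_into (af_filt \<A> n) (af_coord \<A> n))))"

definition B_admissible ::
    "'a::cstar_algebra af_obj \<Rightarrow> 'b::cstar_algebra af_obj \<Rightarrow> ('a \<Rightarrow> 'b) \<Rightarrow>
     (nat \<Rightarrow> 'b \<times> complex) \<times> (nat \<Rightarrow> nat) \<Rightarrow> bool" where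
  "B_admissible \<A> \<B> \<phi> = (\<lambda>(u, f).
     (\<forall>n. tilde_unitary (u n) \<and> tilde_norm (u n - tilde_one) < 1 / 2) \<and>
     mono f \<and> \<not> bdd_above (range f) \<and>
     (\<forall>n. (tilde_Ad (u n) \<circ> \<phi>) ` af_filt \<A> n \<subseteq> af_filt \<B> (f n)))"

definition B_premor ::
    "'a::cstar_algebra af_obj \<Rightarrow> 'b::cstar_algebra af_obj \<Rightarrow> ('a \<Rightarrow> 'b) \<Rightarrow>
     (nat \<Rightarrow> 'b \<times> complex) \<times> (nat \<Rightarrow> nat) \<Rightarrow> premor" where
  "B_premor \<A> \<B> \<phi> = (\<lambda>(u, f).
     (\<lambda>n. mult_matrix_of (af_sizes \<A> n) (af_sizes \<B> (f n))
            (af_coord \<B> (f n) \<circ> (tilde_Ad (u n) \<circ> \<phi>) \<circ> inv_into (af_filt \<A> n) (af_coord \<A> n)),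
      f))"

text \<open>
  The class does not depend on the chosen unitaries and indices. A zero homomorphism between
  non-zero algebras needs no separate clause: its matrices are zero, so its class is the zero
  morphism.
\<close>

definition B_mor ::
    "'a::cstar_algebra af_obj \<Rightarrow> 'b::cstar_algebra af_obj \<Rightarrow> ('a \<Rightarrow> 'b) \<Rightarrow> bd_mor" where
  "B_mor \<A> \<B> \<phi> =
     (if zero_algebra TYPE('a) \<or> zero_algebra TYPE('b) then Zero_mor
      else Mor (premor_class (B_obj \<A>) (B_obj \<B>)
                  (B_premor \<A> \<B> \<phi> (SOME uf. B_admissible \<A> \<B> \<phi> uf))))"

end

theory Submission
  imports Defs
begin

text \<open>
  The proof is an exact version of Elliott's intertwining argument. A *-homomorphism between
  finite dimensional algebras is determined up to an inner automorphism by its multiplicity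
  matrix, and the matrix can be read off from traces: \<open>tr\<^sub>i (\<alpha> x) = (\<Sum>j. a\<^sub>i\<^sub>j tr\<^sub>j x)\<close>. Hence two mutually
  inverse morphisms of diagrams lift to homomorphisms \<open>A\<^bsub>n(0)\<^esub> \<rightarrow> B\<^bsub>m(0)\<^esub> \<rightarrow> A\<^bsub>n(1)\<^esub> \<rightarrow> B\<^bsub>m(1)\<^esub> \<rightarrow> \<dots>\<close> which,
  after correcting each one by an inner automorphism, form strictly commuting triangles. Their
  union is an isometric isomorphism of dense subalgebras and extends to the isomorphism \<open>\<phi>\<close>.
  The class of \<open>\<B>(\<phi>)\<close> does not depend on the chosen unitaries, because the images of a projection
  under two unitaries within \<open>1/2\<close> of the identity have equal traces.
\<close>

section \<open>C*-algebra preliminaries\<close>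

text \<open>Equality of morphisms in BD only means equality of matrices after passing to a later
  level, so each step of the zigzag first moves to a level where \<open>G F\<close> literally equals
  a connecting matrix. There the uniqueness of homomorphisms is exact, and both triangles commute
  without any error to be summed. Traces do the bookkeeping: the description of a multiplicity
  matrix by a unitary and a block diagonal form is unwieldy under composition, while the trace
  formula is linear and turns composites into matrix products. An inner correction preserves traces,
  hence leaves the matrices untouched, and the recursion can continue with the same premorphisms.
  The constant \<open>1/2\<close> matters because two such unitaries differ by less than 1: then no
  nonzero \<open>x\<close> can lie in the range of one conjugated projection and in the kernel of
  the other. Zero objects need an argument of their own: an isomorphism between a zero and a nonzero
  diagram would identify the zero premorphism with the identity, although the inclusions of the
  filtration are injective.\<close>

interpretation cstar: Modules.module "scaleC :: complex \<Rightarrow> 'a \<Rightarrow> 'a::cstar_algebra"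
proof
  fix x :: 'a
  show "1 *\<^sub>C x = x" using scaleC_of_real[of 1 x] by simp
qed (auto simp: scaleC_add_right scaleC_add_left scaleC_scaleC)

lemmas scaleC_simps = mult_scaleC_left mult_scaleC_right scaleC_scaleC star_scaleC

lemma star_zero [simp]: "star (0::'a::cstar_algebra) = 0"
  using star_add[of "0::'a" 0] by simp

lemma star_minus: "star (- x :: 'a::cstar_algebra) = - star x"
  using star_add[of x "- x"] by (simp add: eq_neg_iff_add_eq_0 add.commute)

lemma star_diff: "star (x - y :: 'a::cstar_algebra) = star x - star y"
  using star_add[of x "- y"] by (simp add: star_minus)

lemma star_sum: "star (\<Sum>a\<in>A. f a) = (\<Sum>a\<in>A. star (f a :: 'a::cstar_algebra))"
  by (induction A rule: infinite_finite_induct) (simp_all add: star_add)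

lemma norm_star [simp]: "norm (star x) = norm (x::'a::cstar_algebra)"
proof -
  have le: "norm y \<le> norm (star y)" for y :: 'a
  proof (cases "y = 0")
    case False
    have "norm y * norm y \<le> norm (star y) * norm y"
      using norm_star_mult[of y] norm_mult_ineq[of "star y" y] by (simp add: power2_eq_square)
    then show ?thesis using False by simp
  qed simp
  show ?thesis using le[of x] le[of "star x"] by (simp add: star_star)
qed

text \<open>Serves to prove equalities between partial isometries: the square of a difference can be
  expanded with known products, and its vanishing forces the difference to be zero.\<close>

lemma star_mult_self_eq_0_iff: "star x * x = 0 \<longleftrightarrow> x = (0::'a::cstar_algebra)"
  using norm_star_mult[of x] by auto

lemma tendsto_star: "(f \<longlongrightarrow> l) F \<Longrightarrow> ((\<lambda>x. star (f x)) \<longlongrightarrow> star (l::'a::cstar_algebra)) F"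
  unfolding tendsto_iff by (simp add: dist_norm star_diff [symmetric])

lemma tendsto_scaleC: "(f \<longlongrightarrow> l) F \<Longrightarrow> ((\<lambda>x. c *\<^sub>C f x) \<longlongrightarrow> c *\<^sub>C (l::'a::cstar_algebra)) F"
proof -
  have "bounded_linear (\<lambda>x::'a. c *\<^sub>C x)"
  proof (rule bounded_linear_intro)
    fix r :: real and x y :: 'a
    show "c *\<^sub>C (x + y) = c *\<^sub>C x + c *\<^sub>C y" by (rule scaleC_add_right)
    show "c *\<^sub>C (r *\<^sub>R x) = r *\<^sub>R (c *\<^sub>C x)"
      by (simp add: scaleC_of_real[symmetric] scaleC_scaleC mult.commute)
    show "norm (c *\<^sub>C x) \<le> norm x * cmod c" by (simp add: norm_scaleC)
  qed
  then show "(f \<longlongrightarrow> l) F \<Longrightarrow> ((\<lambda>x. c *\<^sub>C f x) \<longlongrightarrow> c *\<^sub>C l) F"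
    by (rule bounded_linear.tendsto)
qed

lemma continuous_on_star [continuous_intros]:
  "continuous_on A f \<Longrightarrow> continuous_on A (\<lambda>x. star (f x :: 'a::cstar_algebra))"
  by (auto simp: continuous_on_def intro: tendsto_star)

lemma continuous_on_scaleC [continuous_intros]:
  "continuous_on A f \<Longrightarrow> continuous_on A (\<lambda>x. c *\<^sub>C (f x :: 'a::cstar_algebra))"
  by (auto simp: continuous_on_def intro: tendsto_scaleC)

definition projection :: "'a::cstar_algebra \<Rightarrow> bool" where
  "projection p \<longleftrightarrow> p * p = p \<and> star p = p"

lemma projection_diff:
  assumes "projection p" "projection q" "p * q = q"
  shows "projection (p - q)"
proof -
  have "q * p = q" using assms star_mult[of p q] by (simp add: projection_def)
  then show ?thesis using assms by (simp add: projection_def algebra_simps star_diff)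
qed

section \<open>Star homomorphisms\<close>

lemma star_hom_comp:
  "star_hom X Y f \<Longrightarrow> star_hom Y Z g \<Longrightarrow> star_hom X Z (g \<circ> f)"
  by (simp add: star_hom_def)

text \<open>A \<open>star_alg\<close> record carries no closure axioms; the closure assumptions
  allow \<open>f\<close> to be replaced by \<open>g\<close> at sums, multiples, products and
  adjoints too.\<close>

lemma star_hom_cong:
  assumes "star_hom X Y f" "\<And>x. x \<in> sa_carrier X \<Longrightarrow> f x = g x"
    "\<And>x y. \<lbrakk>x \<in> sa_carrier X; y \<in> sa_carrier X\<rbrakk> \<Longrightarrow> sa_add X x y \<in> sa_carrier X"
    "\<And>x c. x \<in> sa_carrier X \<Longrightarrow> sa_scale X c x \<in> sa_carrier X"
    "\<And>x y. \<lbrakk>x \<in> sa_carrier X; y \<in> sa_carrier X\<rbrakk> \<Longrightarrow> sa_mult X x y \<in> sa_carrier X"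
    "\<And>x. x \<in> sa_carrier X \<Longrightarrow> sa_star X x \<in> sa_carrier X"
  shows "star_hom X Y g"
  using assms by (fastforce simp: star_hom_def)

lemma star_hom_inv_into:
  assumes iso: "star_iso X Y f"
    and cl: "\<And>x y. \<lbrakk>x \<in> sa_carrier X; y \<in> sa_carrier X\<rbrakk> \<Longrightarrow> sa_add X x y \<in> sa_carrier X"
    "\<And>x c. x \<in> sa_carrier X \<Longrightarrow> sa_scale X c x \<in> sa_carrier X"
    "\<And>x y. \<lbrakk>x \<in> sa_carrier X; y \<in> sa_carrier X\<rbrakk> \<Longrightarrow> sa_mult X x y \<in> sa_carrier X"
    "\<And>x. x \<in> sa_carrier X \<Longrightarrow> sa_star X x \<in> sa_carrier X"
  shows "star_hom Y X (inv_into (sa_carrier X) f)"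
proof -
  let ?g = "inv_into (sa_carrier X) f"
  have f: "star_hom X Y f" and inj: "inj_on f (sa_carrier X)"
    and onto: "f ` sa_carrier X = sa_carrier Y"
    using iso by (auto simp: star_iso_def bij_betw_def)
  have g: "?g y \<in> sa_carrier X" "f (?g y) = y" if "y \<in> sa_carrier Y" for y
    using that onto by (auto simp: inv_into_into f_inv_into_f)
  have eq: "?g y = x" if "x \<in> sa_carrier X" "f x = y" for x y
    using that inj by auto
  show ?thesis
    unfolding star_hom_def using f g cl
    by (auto simp: star_hom_def intro!: eq)
qed

section \<open>Finite dimensional subalgebras in coordinates\<close>

lemma mat_adjoint_dim [simp]:
  "dim_row (mat_adjoint A) = dim_col A" "dim_col (mat_adjoint A) = dim_row A"
  by (simp_all add: mat_adjoint_def)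

lemma mat_adjoint_index [simp]:
  "i < dim_col A \<Longrightarrow> j < dim_row A \<Longrightarrow> mat_adjoint A $$ (i, j) = conjugate (A $$ (j, i))"
  by (simp add: mat_adjoint_def mat_of_rows_index)

lemma mat_adjoint_carrier [simp]: "A \<in> carrier_mat n m \<Longrightarrow> mat_adjoint A \<in> carrier_mat m n"
  by (intro carrier_matI) simp_all

text \<open>Computations take place in \<open>S\<close> itself, with matrix units pulled back along
  \<kappa>; lists of matrices appear only where the coordinates used by the definitions must be
  met.\<close>

locale block_coord =
  fixes S :: "'a::cstar_algebra set" and ms :: "nat list" and \<kappa> :: "'a \<Rightarrow> complex mat list"
  assumes subalg: "fd_cstar_subalgebra S"
    and iso: "star_iso (sub_alg S) (block_alg ms) \<kappa>"
begin

lemma S_zero [simp]: "0 \<in> S"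
  and S_add [simp]: "x \<in> S \<Longrightarrow> y \<in> S \<Longrightarrow> x + y \<in> S"
  and S_diff [simp]: "x \<in> S \<Longrightarrow> y \<in> S \<Longrightarrow> x - y \<in> S"
  and S_scale [simp]: "x \<in> S \<Longrightarrow> c *\<^sub>C x \<in> S"
  and S_mult [simp]: "x \<in> S \<Longrightarrow> y \<in> S \<Longrightarrow> x * y \<in> S"
  and S_star [simp]: "x \<in> S \<Longrightarrow> star x \<in> S"
  using subalg unfolding fd_cstar_subalgebra_def
  by (auto simp: cstar.span_zero cstar.span_add cstar.span_diff cstar.span_scale)

lemma S_sum [simp]: "(\<And>a. a \<in> A \<Longrightarrow> f a \<in> S) \<Longrightarrow> (\<Sum>a\<in>A. f a) \<in> S"
  by (induction A rule: infinite_finite_induct) simp_all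

lemma star_hom_\<kappa>: "star_hom (sub_alg S) (block_alg ms) \<kappa>"
  using iso by (simp add: star_iso_def)

lemma star_hom_inv: "star_hom (block_alg ms) (sub_alg S) (inv_into S \<kappa>)"
  using star_hom_inv_into[OF iso] by (simp add: sub_alg_def)

lemma \<kappa>_carrier: "x \<in> S \<Longrightarrow> \<kappa> x \<in> block_carrier ms"
  using star_hom_\<kappa> by (simp add: star_hom_def sub_alg_def block_alg_def)

lemma \<kappa>_inv [simp]: "u \<in> block_carrier ms \<Longrightarrow> \<kappa> (inv_into S \<kappa> u) = u"
  and inv_in_S [simp]: "u \<in> block_carrier ms \<Longrightarrow> inv_into S \<kappa> u \<in> S"
  and inv_\<kappa> [simp]: "x \<in> S \<Longrightarrow> inv_into S \<kappa> (\<kappa> x) = x"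
  using iso unfolding star_iso_def sub_alg_def block_alg_def bij_betw_def
  by (auto simp: f_inv_into_f inv_into_into)

section \<open>Entries, matrix units and block traces\<close>

abbreviation (input) idx :: "nat \<Rightarrow> nat \<Rightarrow> bool" where
  "idx j k \<equiv> j < length ms \<and> k < ms ! j"

definition ent :: "'a \<Rightarrow> nat \<Rightarrow> nat \<Rightarrow> nat \<Rightarrow> complex" where
  "ent x j k l = \<kappa> x ! j $$ (k, l)"

definition elt :: "(nat \<Rightarrow> nat \<Rightarrow> nat \<Rightarrow> complex) \<Rightarrow> 'a" where
  "elt c = inv_into S \<kappa> (map (\<lambda>j. mat (ms ! j) (ms ! j) (\<lambda>(k, l). c j k l)) [0..<length ms])"

definition e :: "nat \<Rightarrow> nat \<Rightarrow> nat \<Rightarrow> 'a" where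
  "e j k l = elt (\<lambda>j' k' l'. of_bool (j' = j \<and> k' = k \<and> l' = l))"

text \<open>The unit of \<open>S\<close>. It need not be a unit of the ambient algebra, and
  homomorphisms need not preserve it.\<close>

definition one :: 'a where
  "one = elt (\<lambda>j k l. of_bool (k = l))"

definition tr :: "nat \<Rightarrow> 'a \<Rightarrow> complex" where
  "tr j x = (\<Sum>k<ms ! j. ent x j k k)"

definition tri :: "(nat \<times> nat \<times> nat) set" where
  "tri = (SIGMA j:{..<length ms}. {..<ms ! j} \<times> {..<ms ! j})"

lemma finite_tri [simp]: "finite tri"
  by (simp add: tri_def)

lemma \<kappa>_length [simp]: "x \<in> S \<Longrightarrow> length (\<kappa> x) = length ms"
  and \<kappa>_nth [simp]: "x \<in> S \<Longrightarrow> j < length ms \<Longrightarrow> \<kappa> x ! j \<in> carrier_mat (ms ! j) (ms ! j)"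
  using \<kappa>_carrier[of x] by (auto simp: block_carrier_def)

lemma \<kappa>_dim [simp]: "x \<in> S \<Longrightarrow> j < length ms \<Longrightarrow> dim_row (\<kappa> x ! j) = ms ! j"
  "x \<in> S \<Longrightarrow> j < length ms \<Longrightarrow> dim_col (\<kappa> x ! j) = ms ! j"
  using \<kappa>_nth[of x j] by (metis carrier_matD)+

lemma \<kappa>_ops:
  "x \<in> S \<Longrightarrow> y \<in> S \<Longrightarrow> \<kappa> (x + y) = map2 (+) (\<kappa> x) (\<kappa> y)"
  "x \<in> S \<Longrightarrow> y \<in> S \<Longrightarrow> \<kappa> (x * y) = map2 (*) (\<kappa> x) (\<kappa> y)"
  "x \<in> S \<Longrightarrow> \<kappa> (c *\<^sub>C x) = map (\<lambda>x. c \<cdot>\<^sub>m x) (\<kappa> x)"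
  "x \<in> S \<Longrightarrow> \<kappa> (star x) = map mat_adjoint (\<kappa> x)"
  using star_hom_\<kappa> by (auto simp: star_hom_def sub_alg_def block_alg_def)

lemma elt_carrier:
  "map (\<lambda>j. mat (ms ! j) (ms ! j) (\<lambda>(k, l). c j k l)) [0..<length ms] \<in> block_carrier ms"
  by (simp add: block_carrier_def)

lemma elt_S [simp]: "elt c \<in> S"
  unfolding elt_def by (rule inv_in_S[OF elt_carrier])

lemma ent_elt [simp]: "idx j k \<Longrightarrow> idx j l \<Longrightarrow> ent (elt c) j k l = c j k l"
  unfolding ent_def elt_def by (simp add: \<kappa>_inv[OF elt_carrier])

lemma e_S [simp]: "e j k l \<in> S" and one_S [simp]: "one \<in> S"
  by (simp_all add: e_def one_def)

lemma ent_eqI: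
  assumes "x \<in> S" "y \<in> S" "\<And>j k l. idx j k \<Longrightarrow> idx j l \<Longrightarrow> ent x j k l = ent y j k l"
  shows "x = y"
proof -
  have "\<kappa> x = \<kappa> y"
  proof (rule nth_equalityI)
    fix j assume "j < length (\<kappa> x)"
    then have j: "j < length ms" using assms(1) by simp
    show "\<kappa> x ! j = \<kappa> y ! j"
      by (rule eq_matI) (use assms(1,2) assms(3)[of j] j in \<open>simp_all add: ent_def\<close>)
  qed (use assms(1,2) in simp)
  then show ?thesis using inv_\<kappa> assms(1,2) by metis
qed

lemma ent_add: "\<lbrakk>x \<in> S; y \<in> S; idx j k; idx j l\<rbrakk> \<Longrightarrow> ent (x + y) j k l = ent x j k l + ent y j k l"
  by (simp add: ent_def \<kappa>_ops)

lemma ent_scale: "\<lbrakk>x \<in> S; idx j k; idx j l\<rbrakk> \<Longrightarrow> ent (c *\<^sub>C x) j k l = c * ent x j k l"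
  by (simp add: ent_def \<kappa>_ops)

lemma ent_star: "\<lbrakk>x \<in> S; idx j k; idx j l\<rbrakk> \<Longrightarrow> ent (star x) j k l = cnj (ent x j l k)"
  by (simp add: ent_def \<kappa>_ops)

lemma ent_mult:
  "\<lbrakk>x \<in> S; y \<in> S; idx j k; idx j l\<rbrakk> \<Longrightarrow> ent (x * y) j k l = (\<Sum>p<ms ! j. ent x j k p * ent y j p l)"
  by (simp add: ent_def \<kappa>_ops scalar_prod_def atLeast0LessThan)

lemma ent_zero [simp]: "idx j k \<Longrightarrow> idx j l \<Longrightarrow> ent 0 j k l = 0"
  using ent_scale[of 0 j k l 0] by simp

lemma ent_diff: "\<lbrakk>x \<in> S; y \<in> S; idx j k; idx j l\<rbrakk> \<Longrightarrow> ent (x - y) j k l = ent x j k l - ent y j k l"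
  using ent_add[of "x - y" y j k l] by simp

lemma ent_sum:
  "\<lbrakk>\<And>a. a \<in> A \<Longrightarrow> f a \<in> S; idx j k; idx j l\<rbrakk> \<Longrightarrow> ent (\<Sum>a\<in>A. f a) j k l = (\<Sum>a\<in>A. ent (f a) j k l)"
  by (induction A rule: infinite_finite_induct) (auto simp: ent_add)

lemma ent_e [simp]:
  "idx j k \<Longrightarrow> idx j l \<Longrightarrow> ent (e j' k' l') j k l = of_bool (j = j' \<and> k = k' \<and> l = l')"
  by (simp add: e_def)

lemma ent_one [simp]: "idx j k \<Longrightarrow> idx j l \<Longrightarrow> ent one j k l = of_bool (k = l)"
  by (simp add: one_def)

lemma expand:
  assumes "x \<in> S"
  shows "x = (\<Sum>(j, k, l)\<in>tri. ent x j k l *\<^sub>C e j k l)"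
proof (rule ent_eqI)
  fix j k l assume jk: "idx j k" "idx j l"
  have "ent (\<Sum>(j, k, l)\<in>tri. ent x j k l *\<^sub>C e j k l) j k l
    = (\<Sum>t\<in>tri. ent (case t of (j', k', l') \<Rightarrow> ent x j' k' l' *\<^sub>C e j' k' l') j k l)"
    using jk by (intro ent_sum) auto
  also have "\<dots> = (\<Sum>t\<in>tri. if t = (j, k, l) then ent x j k l else 0)"
    using jk by (intro sum.cong) (auto simp: ent_scale)
  also have "\<dots> = ent x j k l"
    using jk by (subst sum.delta) (auto simp: tri_def)
  finally show "ent x j k l = ent (\<Sum>(j, k, l)\<in>tri. ent x j k l *\<^sub>C e j k l) j k l" ..
qed (use assms in \<open>auto intro!: S_sum\<close>)

lemma e_mult:
  assumes "idx j k" "idx j l" "idx j' k'" "idx j' l'"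
  shows "e j k l * e j' k' l' = (if j = j' \<and> l = k' then e j k l' else 0)"
proof (rule ent_eqI)
  fix J K L assume J: "idx J K" "idx J L"
  have "ent (e j k l * e j' k' l') J K L
     = (\<Sum>p<ms ! J. if p = l then of_bool (J = j \<and> K = k \<and> J = j' \<and> l = k' \<and> L = l') else 0)"
    using J assms by (subst ent_mult) (auto intro!: sum.cong)
  also have "\<dots> = of_bool (J = j \<and> K = k \<and> J = j' \<and> l = k' \<and> L = l')"
    using J assms by (auto simp: sum.delta)
  finally show "ent (e j k l * e j' k' l') J K L = ent (if j = j' \<and> l = k' then e j k l' else 0) J K L"
    using J by auto
qed auto

lemma star_e: "idx j k \<Longrightarrow> idx j l \<Longrightarrow> star (e j k l) = e j l k"
  by (rule ent_eqI) (auto simp: ent_star)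

text \<open>Reads off an entry of \<open>x\<close> inside the algebra. It yields the bound of
  entries by the norm and the scalar factors in the constructions with rank one projections.\<close>

lemma compress:
  assumes "x \<in> S" "idx j a" "idx j b" "idx j c" "idx j d"
  shows "e j a b * x * e j c d = ent x j b c *\<^sub>C e j a d"
proof (rule ent_eqI)
  fix J K L assume J: "idx J K" "idx J L"
  have "ent (e j a b * x) J K p = of_bool (J = j \<and> K = a) * ent x J b p" if "p < ms ! J" for p
  proof -
    have "ent (e j a b * x) J K p
      = (\<Sum>q<ms ! J. if q = b then of_bool (J = j \<and> K = a) * ent x J b p else 0)"
      using J assms that by (subst ent_mult) (auto intro!: sum.cong)
    also have "\<dots> = of_bool (J = j \<and> K = a) * ent x J b p"
      using J assms by (auto simp: sum.delta)
    finally show ?thesis .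
  qed
  then have "ent (e j a b * x * e j c d) J K L
     = (\<Sum>p<ms ! J. of_bool (J = j \<and> K = a) * ent x J b p * of_bool (J = j \<and> p = c \<and> L = d))"
    using J assms by (simp add: ent_mult)
  also have "\<dots> = (\<Sum>p<ms ! J. if p = c then of_bool (J = j \<and> K = a \<and> L = d) * ent x j b c else 0)"
    by (intro sum.cong) auto
  also have "\<dots> = of_bool (J = j \<and> K = a \<and> L = d) * ent x j b c"
    using J assms by (auto simp: sum.delta)
  finally show "ent (e j a b * x * e j c d) J K L = ent (ent x j b c *\<^sub>C e j a d) J K L"
    using J by (simp add: ent_scale mult.commute)
qed (use assms in auto)

lemma one_mult [simp]:
  assumes "x \<in> S"
  shows "one * x = x"
proof (rule ent_eqI)
  fix j k l assume jk: "idx j k" "idx j l"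
  have "ent (one * x) j k l = (\<Sum>p<ms ! j. if p = k then ent x j k l else 0)"
    using assms jk by (subst ent_mult) (auto intro!: sum.cong)
  then show "ent (one * x) j k l = ent x j k l" using jk by simp
qed (use assms in auto)

lemma mult_one [simp]:
  assumes "x \<in> S"
  shows "x * one = x"
proof (rule ent_eqI)
  fix j k l assume jk: "idx j k" "idx j l"
  have "ent (x * one) j k l = (\<Sum>p<ms ! j. if p = l then ent x j k l else 0)"
    using assms jk by (subst ent_mult) (auto intro!: sum.cong)
  then show "ent (x * one) j k l = ent x j k l" using jk by simp
qed (use assms in auto)

lemma star_one [simp]: "star one = one"
  by (rule ent_eqI) (auto simp: ent_star)

lemma projection_one: "projection one"
  by (simp add: projection_def)

definition diag :: "(nat \<times> nat) set" where
  "diag = (SIGMA j:{..<length ms}. {..<ms ! j})"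

lemma finite_diag [simp]: "finite diag"
  by (simp add: diag_def)

lemma one_expand: "one = (\<Sum>(j, k)\<in>diag. e j k k)"
proof (rule ent_eqI)
  fix j k l assume jk: "idx j k" "idx j l"
  have "ent (\<Sum>(j, k)\<in>diag. e j k k) j k l = (\<Sum>t\<in>diag. ent (case t of (j, k) \<Rightarrow> e j k k) j k l)"
    using jk by (intro ent_sum) auto
  also have "\<dots> = (\<Sum>t\<in>diag. if t = (j, k) then of_bool (k = l) else 0)"
    using jk by (intro sum.cong) auto
  also have "\<dots> = of_bool (k = l)"
    using jk by (subst sum.delta) (auto simp: diag_def)
  finally show "ent one j k l = ent (\<Sum>(j, k)\<in>diag. e j k k) j k l"
    using jk by simp
qed (auto intro!: S_sum)

lemma tr_add: "\<lbrakk>x \<in> S; y \<in> S; j < length ms\<rbrakk> \<Longrightarrow> tr j (x + y) = tr j x + tr j y"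
  by (simp add: tr_def ent_add sum.distrib)

lemma tr_diff: "\<lbrakk>x \<in> S; y \<in> S; j < length ms\<rbrakk> \<Longrightarrow> tr j (x - y) = tr j x - tr j y"
  by (simp add: tr_def ent_diff sum_subtractf)

lemma tr_scale: "\<lbrakk>x \<in> S; j < length ms\<rbrakk> \<Longrightarrow> tr j (c *\<^sub>C x) = c * tr j x"
  by (simp add: tr_def ent_scale sum_distrib_left)

lemma tr_zero [simp]: "j < length ms \<Longrightarrow> tr j 0 = 0"
  by (simp add: tr_def)

lemma tr_sum: "\<lbrakk>\<And>a. a \<in> A \<Longrightarrow> f a \<in> S; j < length ms\<rbrakk> \<Longrightarrow> tr j (\<Sum>a\<in>A. f a) = (\<Sum>a\<in>A. tr j (f a))"
  by (induction A rule: infinite_finite_induct) (auto simp: tr_add)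

lemma tr_mult_comm:
  assumes "x \<in> S" "y \<in> S" "j < length ms"
  shows "tr j (x * y) = tr j (y * x)"
proof -
  have "tr j (x * y) = (\<Sum>k<ms ! j. \<Sum>p<ms ! j. ent x j k p * ent y j p k)"
    using assms by (simp add: tr_def ent_mult)
  also have "\<dots> = (\<Sum>p<ms ! j. \<Sum>k<ms ! j. ent y j p k * ent x j k p)"
    by (subst sum.swap) (simp add: mult.commute)
  also have "\<dots> = tr j (y * x)"
    using assms by (simp add: tr_def ent_mult)
  finally show ?thesis .
qed

lemma tr_e:
  assumes "idx j k" "idx j l" "i < length ms"
  shows "tr i (e j k l) = of_bool (i = j \<and> k = l)"
proof -
  have "tr i (e j k l) = (\<Sum>p<ms ! i. if p = k then of_bool (i = j \<and> k = l) else 0)"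
    using assms unfolding tr_def by (intro sum.cong) auto
  then show ?thesis using assms by auto
qed

lemma tr_one: "j < length ms \<Longrightarrow> tr j one = of_nat (ms ! j)"
  by (simp add: tr_def)

lemma tr_unitary_conj:
  assumes "u \<in> S" "star u * u = one" "x \<in> S" "j < length ms"
  shows "tr j (u * x * star u) = tr j x"
  using assms tr_mult_comm[of "u * x" "star u" j] by (simp flip: mult.assoc)

end

section \<open>Homomorphisms out of a finite dimensional subalgebra\<close>

text \<open>The codomain is the whole algebra, so that the locale covers both maps into a finite
  dimensional \<open>T\<close> and restrictions of homomorphisms of the ambient algebras.\<close>

locale block_hom = block_coord S ms \<kappa>
  for S :: "'a::cstar_algebra set" and ms \<kappa> +
  fixes \<alpha> :: "'a \<Rightarrow> 'b::cstar_algebra"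
  assumes hom: "star_hom (sub_alg S) (sub_alg UNIV) \<alpha>"
begin

lemma hom_add: "x \<in> S \<Longrightarrow> y \<in> S \<Longrightarrow> \<alpha> (x + y) = \<alpha> x + \<alpha> y"
  and hom_mult: "x \<in> S \<Longrightarrow> y \<in> S \<Longrightarrow> \<alpha> (x * y) = \<alpha> x * \<alpha> y"
  and hom_scale: "x \<in> S \<Longrightarrow> \<alpha> (c *\<^sub>C x) = c *\<^sub>C \<alpha> x"
  and hom_star: "x \<in> S \<Longrightarrow> \<alpha> (star x) = star (\<alpha> x)"
  using hom by (auto simp: star_hom_def sub_alg_def)

lemma hom_zero [simp]: "\<alpha> 0 = 0"
  using hom_scale[of 0 0] by simp

lemma hom_sum: "(\<And>a. a \<in> A \<Longrightarrow> f a \<in> S) \<Longrightarrow> \<alpha> (\<Sum>a\<in>A. f a) = (\<Sum>a\<in>A. \<alpha> (f a))"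
  by (induction A rule: infinite_finite_induct) (auto simp: hom_add)

lemma projection_hom: "p \<in> S \<Longrightarrow> projection p \<Longrightarrow> projection (\<alpha> p)"
  by (metis hom_mult hom_star projection_def)

lemma hom_expand:
  assumes "x \<in> S"
  shows "\<alpha> x = (\<Sum>(j, k, l)\<in>tri. ent x j k l *\<^sub>C \<alpha> (e j k l))"
proof -
  have "\<alpha> x = \<alpha> (\<Sum>(j, k, l)\<in>tri. ent x j k l *\<^sub>C e j k l)"
    using expand[OF assms] by simp
  also have "\<dots> = (\<Sum>t\<in>tri. \<alpha> (case t of (j, k, l) \<Rightarrow> ent x j k l *\<^sub>C e j k l))"
    by (rule hom_sum) auto
  also have "\<dots> = (\<Sum>(j, k, l)\<in>tri. ent x j k l *\<^sub>C \<alpha> (e j k l))"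
    by (intro sum.cong) (auto simp: hom_scale)
  finally show ?thesis .
qed

end

section \<open>Norm bounds for matrix units, entries and homomorphisms\<close>

context block_coord
begin

text \<open>For a projection the C*-identity says that the norm equals its own square, so a nonzero
  projection has norm 1.\<close>

lemma norm_e_diag: "idx j k \<Longrightarrow> norm (e j k k) = 1"
proof -
  assume jk: "idx j k"
  have "(norm (e j k k))\<^sup>2 = norm (e j k k)"
    using norm_star_mult[of "e j k k"] jk by (simp add: star_e e_mult)
  moreover have "e j k k \<noteq> 0"
    using ent_e[of j k k j k k] jk by (auto simp del: ent_e)
  ultimately show ?thesis by (simp add: power2_eq_square)
qed

lemma norm_e: "idx j k \<Longrightarrow> idx j l \<Longrightarrow> norm (e j k l) = 1"
  using norm_star_mult[of "e j k l"] norm_e_diag[of j l]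
  by (simp add: star_e e_mult power2_eq_1_iff) (smt (verit) norm_ge_zero)

lemma cmod_ent_le:
  assumes "x \<in> S" "idx j k" "idx j l"
  shows "cmod (ent x j k l) \<le> norm x"
proof -
  have "cmod (ent x j k l) = norm (e j k k * x * e j l l)"
    using assms by (simp add: compress norm_scaleC norm_e)
  also have "\<dots> \<le> norm (e j k k) * norm x * norm (e j l l)"
    by (meson mult_right_mono norm_ge_zero norm_mult_ineq order_trans)
  also have "\<dots> = norm x" using assms by (simp add: norm_e)
  finally show ?thesis .
qed

end

context block_hom
begin

lemma hom_bounded: "\<exists>K>0. \<forall>x\<in>S. norm (\<alpha> x) \<le> K * norm x"
proof -
  \<comment> \<open>The summand 1 keeps the bound positive even if all matrix units are sent to
    0.\<close>
  define K where "K = 1 + (\<Sum>(j, k, l)\<in>tri. norm (\<alpha> (e j k l)))"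
  have "K \<ge> 1"
    unfolding K_def by (auto intro!: sum_nonneg)
  moreover have "norm (\<alpha> x) \<le> K * norm x" if "x \<in> S" for x
  proof -
    have "norm (\<alpha> x) \<le> (\<Sum>(j, k, l)\<in>tri. norm (ent x j k l *\<^sub>C \<alpha> (e j k l)))"
      unfolding hom_expand[OF that] by (rule order_trans[OF norm_sum]) (simp add: case_prod_unfold)
    also have "\<dots> \<le> (\<Sum>(j, k, l)\<in>tri. norm x * norm (\<alpha> (e j k l)))"
      using that by (intro sum_mono) (auto simp: norm_scaleC tri_def intro!: mult_right_mono cmod_ent_le)
    also have "\<dots> = (K - 1) * norm x"
      by (simp add: K_def sum_distrib_left case_prod_unfold mult.commute)
    also have "\<dots> \<le> K * norm x" by (simp add: mult_right_mono)
    finally show ?thesis .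
  qed
  ultimately show ?thesis by (intro exI[of _ K]) auto
qed

end

lemma norm_square_selfadjoint: "star h = h \<Longrightarrow> norm (h * h) = (norm (h::'a::cstar_algebra))\<^sup>2"
  using norm_star_mult[of h] by simp

context block_hom
begin

text \<open>For selfadjoint \<open>h\<close> squaring squares the norm, so a linear bound \<open>K\<close> improves to
  \<open>K\<^sup>1\<^sup>/\<^sup>2\<close>, \<open>K\<^sup>1\<^sup>/\<^sup>4\<close>, \<open>\<dots>\<close>, hence to \<open>1\<close>.\<close>

lemma hom_contractive:
  assumes "x \<in> S"
  shows "norm (\<alpha> x) \<le> norm x"
proof -
  obtain K where K: "K > 0" "\<And>x. x \<in> S \<Longrightarrow> norm (\<alpha> x) \<le> K * norm x"
    using hom_bounded by blast
  have pow: "(norm (\<alpha> h)) ^ (2 ^ n) \<le> K * norm h ^ (2 ^ n)" if "h \<in> S" "star h = h" for h n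
    using that
  proof (induction n arbitrary: h)
    case 0
    then show ?case using K by simp
  next
    case (Suc n)
    have "star (\<alpha> h) = \<alpha> h" using hom_star[of h] Suc.prems by simp
    then have "norm (\<alpha> (h * h)) = (norm (\<alpha> h))\<^sup>2"
      using Suc.prems by (simp add: hom_mult norm_square_selfadjoint)
    moreover have "norm (h * h) = (norm h)\<^sup>2"
      using Suc.prems by (simp add: norm_square_selfadjoint)
    ultimately show ?case
      using Suc.IH[of "h * h"] Suc.prems by (simp add: star_mult power_mult mult.commute)
  qed
  have sa: "norm (\<alpha> h) \<le> norm h" if h: "h \<in> S" "star h = h" for h
  proof (rule ccontr)
    assume "\<not> norm (\<alpha> h) \<le> norm h"
    then have lt: "norm h < norm (\<alpha> h)" by simp
    have "h \<noteq> 0" using lt by auto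
    define q where "q = norm (\<alpha> h) / norm h"
    have q: "q > 1" using lt \<open>h \<noteq> 0\<close> by (simp add: q_def)
    have le: "q ^ (2 ^ n) \<le> K" for n
      using pow[OF h, of n] \<open>h \<noteq> 0\<close> by (simp add: q_def power_divide divide_le_eq)
    obtain n where "K < q ^ n" using real_arch_pow[OF q] by blast
    moreover have "q ^ n \<le> q ^ (2 ^ n)" using q by (intro power_increasing) auto
    ultimately show False using le[of n] by simp
  qed
  have "(norm (\<alpha> x))\<^sup>2 = norm (\<alpha> (star x * x))"
    using assms by (simp add: hom_mult hom_star norm_star_mult)
  also have "\<dots> \<le> norm (star x * x)"
    using assms by (intro sa) (auto simp: star_mult star_star)
  also have "\<dots> = (norm x)\<^sup>2" by (rule norm_star_mult)
  finally show ?thesis by (simp add: power2_le_iff_abs_le)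
qed

end

section \<open>Projections\<close>

context block_coord
begin

text \<open>Since \<open>p = star p * p\<close>, a diagonal entry is the squared length of its
  column. Hence diagonal entries and traces are nonnegative, and a vanishing trace kills every
  column.\<close>

lemma ent_projection_diag:
  assumes "p \<in> S" "projection p" "idx j k"
  shows "ent p j k k = of_real (\<Sum>l<ms ! j. (cmod (ent p j l k))\<^sup>2)"
proof -
  have "ent p j k k = ent (star p * p) j k k"
    using assms by (simp add: projection_def)
  also have "\<dots> = (\<Sum>l<ms ! j. cnj (ent p j l k) * ent p j l k)"
    using assms by (simp add: ent_mult ent_star)
  also have "\<dots> = of_real (\<Sum>l<ms ! j. (cmod (ent p j l k))\<^sup>2)"
    by (simp only: of_real_sum complex_norm_square mult.commute)
  finally show ?thesis .
qed

lemma Re_tr_projection_nonneg: "p \<in> S \<Longrightarrow> projection p \<Longrightarrow> j < length ms \<Longrightarrow> Re (tr j p) \<ge> 0"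
  unfolding tr_def by (simp add: ent_projection_diag sum_nonneg)

text \<open>Supplies the pivot for \<open>rank_one\<close>: a nonzero trace needs a nonzero diagonal
  entry, which is then real and positive.\<close>

lemma projection_nonzero_ent:
  assumes p: "p \<in> S" "projection p" and j: "j < length ms" and tr: "tr j p \<noteq> 0"
  obtains k where "k < ms ! j" "Re (ent p j k k) > 0" "ent p j k k = of_real (Re (ent p j k k))"
proof -
  have "\<exists>k<ms ! j. ent p j k k \<noteq> 0"
    by (rule ccontr) (use tr in \<open>simp add: tr_def\<close>)
  then obtain k where k: "k < ms ! j" "ent p j k k \<noteq> 0" by blast
  define r where "r = (\<Sum>l<ms ! j. (cmod (ent p j l k))\<^sup>2)"
  have r: "ent p j k k = of_real r" "r \<ge> 0"
    using ent_projection_diag[OF p, of j k] j k by (auto simp: r_def sum_nonneg)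
  moreover have "r \<noteq> 0" using r(1) k(2) by auto
  ultimately have "r > 0" by simp
  then show ?thesis by (intro that[of k]) (use k(1) r(1) in simp_all)
qed

lemma projection_tr_zero:
  assumes p: "p \<in> S" "projection p" and tr: "\<And>j. j < length ms \<Longrightarrow> Re (tr j p) = 0"
  shows "p = 0"
proof (rule ent_eqI)
  fix j k l assume jk: "idx j k" "idx j l"
  define D where "D = (\<lambda>l. \<Sum>q<ms ! j. (cmod (ent p j q l))\<^sup>2)"
  have "(\<Sum>l<ms ! j. D l) = Re (tr j p)"
    using p jk by (simp add: tr_def D_def ent_projection_diag)
  then have "D l = 0"
    using tr[of j] jk sum_nonneg_eq_0_iff[of "{..<ms ! j}" D] by (auto simp: D_def sum_nonneg)
  then show "ent p j k l = ent 0 j k l"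
    using jk sum_nonneg_eq_0_iff[of "{..<ms ! j}" "\<lambda>q. (cmod (ent p j q l))\<^sup>2"] by (auto simp: D_def)
qed (use p in auto)

text \<open>The rank one subprojection of \<open>p\<close> spanned by a nonzero column.\<close>

definition rank_one :: "'a \<Rightarrow> nat \<Rightarrow> nat \<Rightarrow> 'a" where
  "rank_one p j k = (1 / ent p j k k) *\<^sub>C (p * e j k k * p)"

text \<open>With \<open>E = e j k k\<close> and \<open>c\<close> the pivot entry, compression gives
  \<open>E p E = c E\<close>. So \<open>p E p\<close> squares to \<open>c\<close> times itself, and
  division by \<open>c\<close> makes it a projection; moving factors around under the trace turns
  \<open>p E p\<close> into \<open>E p E\<close>.\<close>

lemma rank_one:
  assumes p: "p \<in> S" "projection p" and jk: "idx j k"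
    and r: "Re (ent p j k k) > 0" "ent p j k k = of_real (Re (ent p j k k))"
  shows "rank_one p j k \<in> S" "projection (rank_one p j k)" "p * rank_one p j k = rank_one p j k"
    "\<And>i. i < length ms \<Longrightarrow> tr i (rank_one p j k) = of_bool (i = j)"
proof -
  let ?E = "e j k k" and ?l = "ent p j k k"
  have EE: "?E * ?E = ?E" "star ?E = ?E" using jk by (simp_all add: e_mult star_e)
  have EpE: "?E * p * ?E = ?l *\<^sub>C ?E" using p jk by (intro compress) auto
  have pp: "p * p = p" "star p = p" using p by (auto simp: projection_def)
  have l: "?l \<noteq> 0" "cnj ?l = ?l" using r by (auto, metis complex_cnj_complex_of_real)
  show S: "rank_one p j k \<in> S" using p by (simp add: rank_one_def)
  have "p * ?E * p * (p * ?E * p) = p * (?E * (p * p) * ?E) * p" by (simp add: mult.assoc)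
  then have "p * ?E * p * (p * ?E * p) = ?l *\<^sub>C (p * ?E * p)"
    by (simp add: pp EpE mult_scaleC_left mult_scaleC_right)
  then have "rank_one p j k * rank_one p j k = rank_one p j k"
    using l by (simp add: rank_one_def scaleC_simps)
  moreover have "star (rank_one p j k) = rank_one p j k"
    using l by (simp add: rank_one_def scaleC_simps star_mult pp EE mult.assoc)
  ultimately show "projection (rank_one p j k)" by (simp add: projection_def)
  show "p * rank_one p j k = rank_one p j k"
    by (simp add: rank_one_def scaleC_simps pp flip: mult.assoc)
  fix i assume i: "i < length ms"
  have "tr i (p * ?E * p) = tr i (p * (p * ?E))"
    using p i by (intro tr_mult_comm) auto
  also have "\<dots> = tr i ((p * ?E) * ?E)" by (simp add: mult.assoc EE flip: mult.assoc[of p p] add: pp)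
  also have "\<dots> = tr i (?E * (p * ?E))"
    using p i by (intro tr_mult_comm) auto
  also have "\<dots> = ?l * of_bool (i = j)"
    using i jk EpE by (simp add: mult.assoc tr_scale tr_e)
  finally show "tr i (rank_one p j k) = of_bool (i = j)"
    using l p i by (simp add: rank_one_def tr_scale)
qed

text \<open>The matrix unit \<open>e j l k\<close> links the two pivot columns. Cut down by
  \<open>q\<close> on the left and \<open>p\<close> on the right, it becomes a multiple of a partial
  isometry.\<close>

lemma rank_one_equiv:
  assumes p: "p \<in> S" "projection p" and jk: "idx j k"
    and r: "Re (ent p j k k) > 0" "ent p j k k = of_real (Re (ent p j k k))"
    and q: "q \<in> S" "projection q" and jl: "idx j l"
    and t: "Re (ent q j l l) > 0" "ent q j l l = of_real (Re (ent q j l l))"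
  obtains s where "s \<in> S" "star s * s = rank_one p j k" "s * star s = rank_one q j l"
    "s * p = s" "q * s = s"
proof
  \<comment> \<open>For \<open>t = q * e j l k * p\<close> one gets
    \<open>star t * t = ent q j l l\<close> times \<open>p * e j k k * p\<close>, so the square of
    \<open>c\<close> must be the inverse of the product of the two pivots.\<close>
  define c where "c = complex_of_real (1 / sqrt (Re (ent p j k k) * Re (ent q j l l)))"
  have c: "cnj c = c" "c * c * (ent p j k k * ent q j l l) = 1"
    using r(1) t(1) r(2) t(2)
    by (simp_all add: c_def, metis (no_types, opaque_lifting) mult_pos_pos nonzero_eq_divide_eq
         less_imp_le mult_eq_0_iff of_real_1 of_real_divide of_real_mult real_sqrt_mult_self order_less_irrefl abs_of_pos)
  have c2: "c * c * ent q j l l = 1 / ent p j k k" "c * c * ent p j k k = 1 / ent q j l l"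
  proof -
    have "ent p j k k \<noteq> 0" "ent q j l l \<noteq> 0" using c(2) by auto
    then show "c * c * ent q j l l = 1 / ent p j k k" "c * c * ent p j k k = 1 / ent q j l l"
      using c(2) by (simp_all add: nonzero_eq_divide_eq mult_ac)
  qed
  let ?s = "c *\<^sub>C (q * e j l k * p)"
  have pp: "p * p = p" "star p = p" and qq: "q * q = q" "star q = q"
    using p q by (auto simp: projection_def)
  have pa: "p * (p * x) = p * x" and qa: "q * (q * x) = q * x" for x
    by (simp_all add: pp qq flip: mult.assoc)
  show "?s \<in> S" using p q by simp
  have "star (q * e j l k * p) * (q * e j l k * p) = p * (e j k l * (q * q) * e j l k) * p"
    using jk jl by (simp add: star_mult pp qq pa qa star_e mult.assoc)
  also have "\<dots> = ent q j l l *\<^sub>C (p * e j k k * p)"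
    using jk jl q by (simp add: qq compress scaleC_simps)
  finally show "star ?s * ?s = rank_one p j k"
    using c c2 by (simp add: scaleC_simps rank_one_def mult.assoc[where 'a=complex])
  have "(q * e j l k * p) * star (q * e j l k * p) = q * (e j l k * (p * p) * e j k l) * q"
    using jk jl by (simp add: star_mult pp qq pa qa star_e mult.assoc)
  also have "\<dots> = ent p j k k *\<^sub>C (q * e j l l * q)"
    using jk jl p by (simp add: pp compress scaleC_simps)
  finally show "?s * star ?s = rank_one q j l"
    using c c2 by (simp add: scaleC_simps rank_one_def mult.assoc[where 'a=complex])
  show "?s * p = ?s" by (simp add: scaleC_simps mult.assoc pp)
  show "q * ?s = ?s" by (simp add: scaleC_simps qq flip: mult.assoc)
qed

text \<open>Splitting off a rank one projection lowers the trace by exactly 1, and the trace of what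
  remains cannot be negative. The induction runs over a natural upper bound of the trace, whose
  integrality is still open.\<close>

lemma tr_projection_nat:
  assumes "p \<in> S" "projection p" "j < length ms"
  shows "\<exists>n::nat. tr j p = of_nat n"
proof -
  have "\<exists>n::nat. tr j p = of_nat n" if "p \<in> S" "projection p" "j < length ms" "Re (tr j p) \<le> real m" for m p
    using that
  proof (induction m arbitrary: p)
    case 0
    show ?case
    proof (cases "tr j p = 0")
      case True
      then show ?thesis by (intro exI[of _ 0]) simp
    next
      case False
      obtain k where "k < ms ! j" "Re (ent p j k k) > 0"
        using projection_nonzero_ent[OF 0(1-3) False] by blast
      moreover have "Re (ent p j l l) \<ge> 0" if "l < ms ! j" for l
        using that 0 by (simp add: ent_projection_diag sum_nonneg)
      ultimately have "Re (tr j p) > 0"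
        unfolding tr_def Re_sum by (intro sum_pos2[of _ k]) auto
      then show ?thesis using 0 by simp
    qed
  next
    case (Suc m)
    show ?case
    proof (cases "tr j p = 0")
      case True
      then show ?thesis by (intro exI[of _ 0]) simp
    next
      case False
      obtain k where k: "k < ms ! j" "Re (ent p j k k) > 0" "ent p j k k = of_real (Re (ent p j k k))"
        using projection_nonzero_ent[OF Suc.prems(1-3) False] by blast
      note r = rank_one[OF Suc.prems(1,2), of j k]
      let ?p = "p - rank_one p j k"
      have "?p \<in> S" "projection ?p" "tr j ?p = tr j p - 1"
        using r k Suc.prems by (auto intro!: projection_diff simp: tr_diff)
      then obtain n where "tr j ?p = of_nat n"
        using Suc.IH[of ?p] Suc.prems by auto
      then show ?thesis using \<open>tr j ?p = tr j p - 1\<close>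
        by (intro exI[of _ "Suc n"]) (simp add: algebra_simps)
    qed
  qed
  moreover obtain m where "Re (tr j p) \<le> real m" using real_arch_simple by blast
  ultimately show ?thesis using assms by blast
qed

text \<open>Murray--von Neumann equivalence, splitting off one rank at a time.\<close>

lemma projections_equivalent:
  assumes "p \<in> S" "projection p" "q \<in> S" "projection q" "\<And>j. j < length ms \<Longrightarrow> tr j p = tr j q"
  obtains s where "s \<in> S" "star s * s = p" "s * star s = q" "s * p = s" "q * s = s"
proof -
  have "\<exists>s\<in>S. star s * s = p \<and> s * star s = q \<and> s * p = s \<and> q * s = s"
    if "p \<in> S" "projection p" "q \<in> S" "projection q" "\<And>j. j < length ms \<Longrightarrow> tr j p = tr j q"
      "(\<Sum>j<length ms. Re (tr j p)) \<le> real m" for m p q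
    using that
  proof (induction m arbitrary: p q)
    case 0
    have nn: "\<And>j. j < length ms \<Longrightarrow> Re (tr j p) \<ge> 0" using 0 by (simp add: Re_tr_projection_nonneg)
    then have "(\<Sum>j<length ms. Re (tr j p)) = 0"
      using 0(6) sum_nonneg[of "{..<length ms}" "\<lambda>j. Re (tr j p)"] by force
    then have z: "\<And>j. j < length ms \<Longrightarrow> Re (tr j p) = 0"
      using nn by (subst (asm) sum_nonneg_eq_0_iff) auto
    then have "p = 0" "q = 0" using 0(1-5) by (auto intro!: projection_tr_zero)
    then show ?case by (intro bexI[of _ 0]) auto
  next
    case (Suc m)
    note pq = Suc.prems
    show ?case
    proof (cases "\<forall>j<length ms. tr j p = 0")
      case True
      then have "p = 0" "q = 0" using pq(1-5) by (auto intro!: projection_tr_zero)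
      then show ?thesis by (intro bexI[of _ 0]) auto
    next
      case False
      then obtain j where j: "j < length ms" "tr j p \<noteq> 0" by blast
      then have j': "tr j q \<noteq> 0" using pq(5) by simp
      obtain k where k: "k < ms ! j" "Re (ent p j k k) > 0" "ent p j k k = of_real (Re (ent p j k k))"
        using projection_nonzero_ent[OF pq(1,2) j] by blast
      obtain l where l: "l < ms ! j" "Re (ent q j l l) > 0" "ent q j l l = of_real (Re (ent q j l l))"
        using projection_nonzero_ent[OF pq(3,4) j(1) j'] by blast
      define p1 q1 where "p1 = rank_one p j k" and "q1 = rank_one q j l"
      note r = rank_one[OF pq(1,2), of j k, folded p1_def] rank_one[OF pq(3,4), of j l, folded q1_def]
      have r: "p1 \<in> S" "projection p1" "p * p1 = p1" "\<And>i. i < length ms \<Longrightarrow> tr i p1 = of_bool (i = j)"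
        "q1 \<in> S" "projection q1" "q * q1 = q1" "\<And>i. i < length ms \<Longrightarrow> tr i q1 = of_bool (i = j)"
        using r j k l by auto
      obtain t where t: "t \<in> S" "star t * t = p1" "t * star t = q1" "t * p = t" "q * t = t"
        using rank_one_equiv[OF pq(1,2) _ k(2,3) pq(3,4) _ l(2,3)] j k l unfolding p1_def q1_def by blast
      have "(\<Sum>i<length ms. Re (tr i (p - p1))) = (\<Sum>i<length ms. Re (tr i p) - of_bool (i = j))"
        using pq r by (intro sum.cong) (auto simp: tr_diff)
      also have "\<dots> = (\<Sum>i<length ms. Re (tr i p)) - 1"
        using j by (simp add: sum_subtractf)
      finally have "(\<Sum>i<length ms. Re (tr i (p - p1))) \<le> real m" using pq(6) by simp
      then obtain s where s: "s \<in> S" "star s * s = p - p1" "s * star s = q - q1"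
          "s * (p - p1) = s" "(q - q1) * s = s"
        using Suc.IH[of "p - p1" "q - q1"] pq r by (auto simp: tr_diff projection_diff)
      have sp: "star p1 = p1" "star q1 = q1" "p1 * p1 = p1" "q1 * q1 = q1"
        using r by (auto simp: projection_def)
      \<comment> \<open>So far only \<open>q * t = t\<close> is known. That \<open>t\<close> has
        range below \<open>q1 = t * star t\<close> follows by expanding the square of
        \<open>q1 * t - t\<close>.\<close>
      have tt: "q1 * t = t"
      proof -
        have tqt: "star t * (q1 * t) = p1"
        proof -
          have "star t * (q1 * t) = (star t * t) * (star t * t)"
            unfolding t(3)[symmetric] by (simp only: mult.assoc)
          then show ?thesis by (simp add: t(2) sp)
        qed
        have "q1 * (q1 * t) = q1 * t" by (simp add: sp flip: mult.assoc)
        then have "star (q1 * t - t) * (q1 * t - t) = 0"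
          using tqt sp t(2) by (simp add: star_diff star_mult left_diff_distrib right_diff_distrib mult.assoc)
        then show ?thesis by (simp add: star_mult_self_eq_0_iff)
      qed
      have ts: "t * p1 = t" using tt t by (metis mult.assoc)
      \<comment> \<open>The ranges of \<open>s\<close> and \<open>t\<close> lie below the orthogonal
        projections \<open>q - q1\<close> and \<open>q1\<close>, and their initial projections are
        \<open>p - p1\<close> and \<open>p1\<close>. The cross terms in the products of
        \<open>s + t\<close> with its adjoint therefore vanish.\<close>
      have "(q - q1) * t = 0" using t tt by (simp add: algebra_simps)
      then have st: "star s * t = 0"
        using s(5) pq(4) sp by (metis mult.assoc mult_zero_right projection_def star_diff star_mult)
      have ts0: "star t * s = 0"
        using arg_cong[OF st, of star] by (simp add: star_mult star_star)
      have "(p - p1) * star t = 0"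
      proof -
        have "t * (p - p1) = 0" using t ts by (simp add: algebra_simps)
        from arg_cong[OF this, of star] show ?thesis
          using pq(2) sp by (simp add: star_mult star_diff projection_def)
      qed
      then have st': "s * star t = 0" using s(4) by (metis mult.assoc mult_zero_right)
      have ts': "t * star s = 0"
        using arg_cong[OF st', of star] by (simp add: star_mult star_star)
      have sp': "s * p = s"
      proof -
        have "s * p1 = s * (p - p1) * p1" using s by simp
        also have "\<dots> = s * (p * p1 - p1 * p1)" by (simp add: algebra_simps)
        finally have "s * p1 = 0" using r sp by simp
        then show ?thesis using s(4) by (simp add: algebra_simps)
      qed
      have qs: "q * s = s"
      proof -
        have "q1 * q = q1" using r sp pq(4) by (metis projection_def star_mult)
        have "q1 * s = q1 * (q - q1) * s" using s by (simp add: mult.assoc)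
        also have "\<dots> = 0" using \<open>q1 * q = q1\<close> sp by (simp add: algebra_simps)
        finally show ?thesis using s(5) by (simp add: algebra_simps)
      qed
      show ?thesis
      proof (intro bexI conjI)
        show "s + t \<in> S" using s t by simp
        show "star (s + t) * (s + t) = p" using s t st ts0 by (simp add: star_add algebra_simps)
        show "(s + t) * star (s + t) = q" using s t st' ts' by (simp add: star_add algebra_simps)
        show "(s + t) * p = s + t" using sp' t by (simp add: algebra_simps)
        show "q * (s + t) = s + t" using qs t by (simp add: algebra_simps)
      qed
    qed
  qed
  moreover obtain m where "(\<Sum>j<length ms. Re (tr j p)) \<le> real m" using real_arch_simple by blast
  ultimately show ?thesis using assms that by blast
qed

end

section \<open>Homomorphisms between finite dimensional algebras\<close>

text \<open>Positive block sizes guarantee that each block of \<open>S\<close> contains the minimal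
  projection \<open>e j 0 0\<close>, on which multiplicities are measured.\<close>

locale block_pair = A: block_coord S ms \<kappa> + B: block_coord T ns \<kappa>'
  for S :: "'a::cstar_algebra set" and ms \<kappa> and T :: "'b::cstar_algebra set" and ns \<kappa>' +
  assumes ms_pos: "\<And>j. j < length ms \<Longrightarrow> ms ! j \<ge> 1"
begin

abbreviation (input) homs :: "('a \<Rightarrow> 'b) \<Rightarrow> bool" where
  "homs \<alpha> \<equiv> star_hom (sub_alg S) (sub_alg T) \<alpha>"

lemma homs_block_hom: "homs \<alpha> \<Longrightarrow> block_hom S ms \<kappa> \<alpha>"
  by unfold_locales (auto simp: star_hom_def sub_alg_def)

lemma homs_T [simp]: "homs \<alpha> \<Longrightarrow> x \<in> S \<Longrightarrow> \<alpha> x \<in> T"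
  by (auto simp: star_hom_def sub_alg_def)

text \<open>The number of copies of block \<open>j\<close> inside block \<open>i\<close>, seen as
  the rank of the image of a minimal projection. It stays complex until traces of projections are
  applied to show that it is a natural number.\<close>

definition unit_tr :: "('a \<Rightarrow> 'b) \<Rightarrow> nat \<Rightarrow> nat \<Rightarrow> complex" where
  "unit_tr \<alpha> i j = B.tr i (\<alpha> (A.e j 0 0))"

lemma idx_0: "j < length ms \<Longrightarrow> j < length ms \<and> 0 < ms ! j"
  using ms_pos[of j] by simp

text \<open>Factor the matrix unit through index 0 and exchange the factors under the trace: the
  product of \<open>e j 0 l\<close> and \<open>e j k 0\<close> is \<open>e j 0 0\<close> if
  \<open>k = l\<close> and 0 otherwise.\<close>

lemma tr_hom_e:
  assumes \<alpha>: "homs \<alpha>" and "A.idx j k" "A.idx j l" "i < length ns"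
  shows "B.tr i (\<alpha> (A.e j k l)) = of_bool (k = l) * unit_tr \<alpha> i j"
proof -
  interpret h: block_hom S ms \<kappa> \<alpha> by (rule homs_block_hom[OF \<alpha>])
  have "B.tr i (\<alpha> (A.e j k l)) = B.tr i (\<alpha> (A.e j k 0) * \<alpha> (A.e j 0 l))"
    using assms idx_0[of j] by (simp flip: h.hom_mult add: A.e_mult)
  also have "\<dots> = B.tr i (\<alpha> (A.e j 0 l) * \<alpha> (A.e j k 0))"
    using assms by (intro B.tr_mult_comm) auto
  also have "\<dots> = of_bool (k = l) * unit_tr \<alpha> i j"
    using assms idx_0[of j] by (auto simp flip: h.hom_mult simp: A.e_mult unit_tr_def)
  finally show ?thesis .
qed

lemma tr_hom:
  assumes \<alpha>: "homs \<alpha>" and "x \<in> S" "i < length ns"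
  shows "B.tr i (\<alpha> x) = (\<Sum>j<length ms. unit_tr \<alpha> i j * A.tr j x)"
proof -
  interpret h: block_hom S ms \<kappa> \<alpha> by (rule homs_block_hom[OF \<alpha>])
  have "B.tr i (\<alpha> x) = (\<Sum>t\<in>A.tri. B.tr i (case t of (j, k, l) \<Rightarrow> A.ent x j k l *\<^sub>C \<alpha> (A.e j k l)))"
    unfolding h.hom_expand[OF assms(2)] using assms by (intro B.tr_sum) auto
  also have "\<dots> = (\<Sum>(j, k, l)\<in>A.tri. A.ent x j k l * (of_bool (k = l) * unit_tr \<alpha> i j))"
    using assms by (intro sum.cong) (auto simp: B.tr_scale tr_hom_e A.tri_def)
  also have "\<dots> = (\<Sum>j<length ms. \<Sum>k<ms ! j. \<Sum>l<ms ! j. A.ent x j k l * (of_bool (k = l) * unit_tr \<alpha> i j))"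
    unfolding A.tri_def by (simp add: sum.Sigma sum.cartesian_product case_prod_unfold)
  also have "\<dots> = (\<Sum>j<length ms. \<Sum>k<ms ! j. A.ent x j k k * unit_tr \<alpha> i j)"
  proof (intro sum.cong refl)
    fix j k assume "k \<in> {..<ms ! j}"
    moreover have "(\<Sum>l<ms ! j. A.ent x j k l * (of_bool (k = l) * unit_tr \<alpha> i j))
      = (\<Sum>l<ms ! j. if k = l then A.ent x j k k * unit_tr \<alpha> i j else 0)"
      by (intro sum.cong) auto
    ultimately show "(\<Sum>l<ms ! j. A.ent x j k l * (of_bool (k = l) * unit_tr \<alpha> i j)) = A.ent x j k k * unit_tr \<alpha> i j"
      by simp
  qed
  also have "\<dots> = (\<Sum>j<length ms. unit_tr \<alpha> i j * A.tr j x)"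
    by (simp add: A.tr_def sum_distrib_left mult.commute)
  finally show ?thesis .
qed

lemma unit_tr_nat:
  assumes \<alpha>: "homs \<alpha>" and "i < length ns" "j < length ms"
  obtains n :: nat where "unit_tr \<alpha> i j = of_nat n"
proof -
  interpret h: block_hom S ms \<kappa> \<alpha> by (rule homs_block_hom[OF \<alpha>])
  have "projection (A.e j 0 0)"
    using idx_0[OF assms(3)] by (simp add: projection_def A.e_mult A.star_e)
  then have "projection (\<alpha> (A.e j 0 0))" by (simp add: h.projection_hom)
  then show ?thesis
    using that B.tr_projection_nat[of "\<alpha> (A.e j 0 0)" i] assms unfolding unit_tr_def by auto
qed

text \<open>The sum \<open>V\<close> below of the \<open>\<beta> (e j k 0) * s j * \<alpha> (e j 0 k)\<close>, where \<open>s j\<close> is a partial isometry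
  from \<open>\<alpha> (e j 0 0)\<close> to \<open>\<beta> (e j 0 0)\<close>, intertwines \<open>\<alpha>\<close> and \<open>\<beta>\<close>; it is completed to a unitary on
  the complements of the images of the unit.\<close>

lemma homs_unitarily_equivalent:
  assumes \<alpha>: "homs \<alpha>" and \<beta>: "homs \<beta>"
    and tr_eq: "\<And>i j. i < length ns \<Longrightarrow> j < length ms \<Longrightarrow> unit_tr \<alpha> i j = unit_tr \<beta> i j"
  obtains u where "u \<in> T" "star u * u = B.one" "u * star u = B.one"
    "\<And>x. x \<in> S \<Longrightarrow> u * \<alpha> x * star u = \<beta> x"
proof -
  interpret a: block_hom S ms \<kappa> \<alpha> by (rule homs_block_hom[OF \<alpha>])
  interpret b: block_hom S ms \<kappa> \<beta> by (rule homs_block_hom[OF \<beta>])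
  have "\<exists>s. s \<in> T \<and> star s * s = \<alpha> (A.e j 0 0) \<and> s * star s = \<beta> (A.e j 0 0)
     \<and> s * \<alpha> (A.e j 0 0) = s \<and> \<beta> (A.e j 0 0) * s = s" if j: "j < length ms" for j
  proof -
    have e: "projection (A.e j 0 0)"
      using idx_0[OF j] by (simp add: projection_def A.e_mult A.star_e)
    show ?thesis
      using B.projections_equivalent[of "\<alpha> (A.e j 0 0)" "\<beta> (A.e j 0 0)"]
        a.projection_hom[OF _ e] b.projection_hom[OF _ e] tr_eq[OF _ j] \<alpha> \<beta>
      by (metis A.e_S homs_T unit_tr_def)
  qed
  then obtain s where s: "\<And>j. j < length ms \<Longrightarrow> s j \<in> T"
      "\<And>j. j < length ms \<Longrightarrow> star (s j) * s j = \<alpha> (A.e j 0 0)"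
      "\<And>j. j < length ms \<Longrightarrow> s j * star (s j) = \<beta> (A.e j 0 0)"
      "\<And>j. j < length ms \<Longrightarrow> s j * \<alpha> (A.e j 0 0) = s j"
      "\<And>j. j < length ms \<Longrightarrow> \<beta> (A.e j 0 0) * s j = s j"
    by metis
  define t where "t = (\<lambda>(j, k). \<beta> (A.e j k 0) * s j * \<alpha> (A.e j 0 k))"
  define V where "V = (\<Sum>a\<in>A.diag. t a)"
  have diagD: "fst a < length ms" "A.idx (fst a) (snd a)" "A.idx (fst a) 0" if "a \<in> A.diag" for a
    using that idx_0[of "fst a"] by (auto simp: A.diag_def)
  have tT: "t a \<in> T" if "a \<in> A.diag" for a
    using that s(1) \<alpha> \<beta> by (auto simp: t_def A.diag_def)
  have ae: "\<alpha> (A.e j k l) * \<alpha> (A.e j' k' l') = (if j = j' \<and> l = k' then \<alpha> (A.e j k l') else 0)"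
    and be: "\<beta> (A.e j k l) * \<beta> (A.e j' k' l') = (if j = j' \<and> l = k' then \<beta> (A.e j k l') else 0)"
    if "A.idx j k" "A.idx j l" "A.idx j' k'" "A.idx j' l'" for j k l j' k' l'
    using A.e_mult[OF that] by (simp_all flip: a.hom_mult b.hom_mult)
  have as: "star (\<alpha> (A.e j k l)) = \<alpha> (A.e j l k)" and bs: "star (\<beta> (A.e j k l)) = \<beta> (A.e j l k)"
    if "A.idx j k" "A.idx j l" for j k l
    using A.star_e[OF that] by (simp_all flip: a.hom_star b.hom_star)
  \<comment> \<open>The summands of \<open>V\<close> are partial isometries with pairwise orthogonal
    initial and final projections, so only diagonal terms survive in the two squares of
    \<open>V\<close>.\<close>
  have tt: "star (t x) * t y = (if x = y then \<alpha> (A.e (fst x) (snd x) (snd x)) else 0)"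
    "t x * star (t y) = (if x = y then \<beta> (A.e (fst x) (snd x) (snd x)) else 0)"
    if xy: "x \<in> A.diag" "y \<in> A.diag" for x y
  proof -
    obtain j k j' k' where [simp]: "x = (j, k)" "y = (j', k')" by (cases x, cases y)
    have jk: "A.idx j k" "A.idx j 0" "A.idx j' k'" "A.idx j' 0" using diagD[OF xy(1)] diagD[OF xy(2)] by auto
    have "star (t x) * t y = \<alpha> (A.e j k 0) * star (s j) * (\<beta> (A.e j 0 k) * \<beta> (A.e j' k' 0)) * s j' * \<alpha> (A.e j' 0 k')"
      using jk by (simp add: t_def star_mult as bs mult.assoc)
    also have "\<dots> = (if x = y then \<alpha> (A.e j k 0) * (star (s j) * (\<beta> (A.e j 0 0) * s j)) * \<alpha> (A.e j 0 k) else 0)"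
      using jk by (auto simp: be mult.assoc)
    also have "\<dots> = (if x = y then \<alpha> (A.e j k k) else 0)"
      using jk s by (simp add: ae)
    finally show "star (t x) * t y = (if x = y then \<alpha> (A.e (fst x) (snd x) (snd x)) else 0)" by simp
    have "t x * star (t y) = \<beta> (A.e j k 0) * s j * (\<alpha> (A.e j 0 k) * \<alpha> (A.e j' k' 0)) * star (s j') * \<beta> (A.e j' 0 k')"
      using jk by (simp add: t_def star_mult as bs mult.assoc)
    also have "\<dots> = (if x = y then \<beta> (A.e j k 0) * (s j * \<alpha> (A.e j 0 0) * star (s j)) * \<beta> (A.e j 0 k) else 0)"
      using jk by (auto simp: ae mult.assoc)
    also have "\<dots> = (if x = y then \<beta> (A.e j k k) else 0)"
      using jk s by (simp add: be)
    finally show "t x * star (t y) = (if x = y then \<beta> (A.e (fst x) (snd x) (snd x)) else 0)" by simp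
  qed
  have VT: "V \<in> T" using tT by (simp add: V_def)
  have one_hom: "\<alpha> A.one = (\<Sum>x\<in>A.diag. \<alpha> (A.e (fst x) (snd x) (snd x)))"
    "\<beta> A.one = (\<Sum>x\<in>A.diag. \<beta> (A.e (fst x) (snd x) (snd x)))"
    unfolding A.one_expand by (simp_all add: a.hom_sum b.hom_sum case_prod_unfold)
  have VV: "star V * V = \<alpha> A.one"
  proof -
    have "star V * V = (\<Sum>x\<in>A.diag. \<Sum>y\<in>A.diag. star (t x) * t y)"
      by (simp add: V_def star_sum sum_product)
    also have "\<dots> = (\<Sum>x\<in>A.diag. \<Sum>y\<in>A.diag. if x = y then \<alpha> (A.e (fst x) (snd x) (snd x)) else 0)"
      by (intro sum.cong refl) (simp add: tt)
    also have "\<dots> = \<alpha> A.one" by (simp add: one_hom)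
    finally show ?thesis .
  qed
  have VV': "V * star V = \<beta> A.one"
  proof -
    have "V * star V = (\<Sum>x\<in>A.diag. \<Sum>y\<in>A.diag. t x * star (t y))"
      by (simp add: V_def star_sum sum_product)
    also have "\<dots> = (\<Sum>x\<in>A.diag. \<Sum>y\<in>A.diag. if x = y then \<beta> (A.e (fst x) (snd x) (snd x)) else 0)"
      by (intro sum.cong refl) (simp add: tt)
    also have "\<dots> = \<beta> A.one" by (simp add: one_hom)
    finally show ?thesis .
  qed
  \<comment> \<open>On each side a single summand survives, \<open>t (j, k)\<close> on the left and
    \<open>t (j, l)\<close> on the right, and both leave the same middle term.\<close>
  have V_e: "V * \<alpha> (A.e j k l) = \<beta> (A.e j k l) * V" if jkl: "A.idx j k" "A.idx j l" for j k l
  proof -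
    have j0: "A.idx j 0" using idx_0[of j] jkl by simp
    have "V * \<alpha> (A.e j k l) = (\<Sum>x\<in>A.diag. t x * \<alpha> (A.e j k l))"
      by (simp add: V_def sum_distrib_right)
    also have "\<dots> = (\<Sum>x\<in>A.diag. if x = (j, k) then \<beta> (A.e j k 0) * s j * \<alpha> (A.e j 0 l) else 0)"
      using jkl diagD j0 by (intro sum.cong refl) (auto simp: t_def mult.assoc ae split: if_splits)
    also have "\<dots> = \<beta> (A.e j k 0) * s j * \<alpha> (A.e j 0 l)"
      using jkl by (simp add: A.diag_def)
    also have "\<dots> = (\<Sum>x\<in>A.diag. if x = (j, l) then \<beta> (A.e j k 0) * s j * \<alpha> (A.e j 0 l) else 0)"
      using jkl by (simp add: A.diag_def)
    also have "\<dots> = (\<Sum>x\<in>A.diag. \<beta> (A.e j k l) * t x)"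
      using jkl diagD j0 by (intro sum.cong refl) (auto simp: t_def be simp flip: mult.assoc split: if_splits)
    also have "\<dots> = \<beta> (A.e j k l) * V"
      by (simp add: V_def sum_distrib_left)
    finally show ?thesis .
  qed
  have V_hom: "V * \<alpha> x = \<beta> x * V" if x: "x \<in> S" for x
  proof -
    have "V * \<alpha> x = (\<Sum>(j, k, l)\<in>A.tri. A.ent x j k l *\<^sub>C (V * \<alpha> (A.e j k l)))"
      unfolding a.hom_expand[OF x] by (simp add: sum_distrib_left case_prod_unfold scaleC_simps)
    also have "\<dots> = (\<Sum>(j, k, l)\<in>A.tri. A.ent x j k l *\<^sub>C (\<beta> (A.e j k l) * V))"
      by (intro sum.cong refl) (auto simp: A.tri_def V_e)
    also have "\<dots> = \<beta> x * V"
      unfolding b.hom_expand[OF x] by (simp add: sum_distrib_right case_prod_unfold scaleC_simps)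
    finally show ?thesis .
  qed
  let ?p = "B.one - \<alpha> A.one" and ?q = "B.one - \<beta> A.one"
  have pr: "projection (\<alpha> A.one)" "projection (\<beta> A.one)"
    using a.projection_hom b.projection_hom A.projection_one by auto
  have pq: "projection ?p" "projection ?q" "?p \<in> T" "?q \<in> T"
    using pr \<alpha> \<beta> B.projection_one by (auto intro!: projection_diff)
  \<comment> \<open>By the trace formula \<alpha> and \<beta> send the unit to projections of equal
    traces, so the complements have equal traces too and are equivalent.\<close>
  have "B.tr i ?p = B.tr i ?q" if "i < length ns" for i
    using that \<alpha> \<beta> tr_eq by (simp add: B.tr_diff tr_hom)
  then obtain w where w: "w \<in> T" "star w * w = ?p" "w * star w = ?q" "w * ?p = w" "?q * w = w"
    using B.projections_equivalent[of ?p ?q] pq by metis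
  have p\<alpha>: "?p * \<alpha> x = 0" "\<alpha> x * ?p = 0" and q\<beta>: "?q * \<beta> x = 0" "\<beta> x * ?q = 0" if "x \<in> S" for x
    using that \<alpha> \<beta> by (simp_all add: left_diff_distrib right_diff_distrib flip: a.hom_mult b.hom_mult)
  have w\<alpha>: "w * \<alpha> x = 0" and w\<beta>: "\<beta> x * w = 0" if "x \<in> S" for x
    using p\<alpha>[OF that] q\<beta>[OF that] w(4,5) by (metis mult.assoc mult_zero_right mult_zero_left)+
  \<comment> \<open>\<open>V\<close> is supported between the images of the unit; again the square
    of a difference is expanded. This makes \<open>V\<close> orthogonal to \<open>w\<close>, which
    lives on the complements.\<close>
  have V1: "V = V * \<alpha> A.one" "V = \<beta> A.one * V"
  proof -
    have "(V - V * \<alpha> A.one) = 0"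
    proof -
      have "star (V - V * \<alpha> A.one) * (V - V * \<alpha> A.one) =
         star V * V - star V * V * \<alpha> A.one - \<alpha> A.one * (star V * V) + \<alpha> A.one * (star V * V) * \<alpha> A.one"
        using pr by (simp add: star_diff star_mult projection_def algebra_simps)
      also have "\<dots> = 0" using pr unfolding VV by (simp add: projection_def)
      finally show ?thesis by (simp add: star_mult_self_eq_0_iff)
    qed
    then show "V = V * \<alpha> A.one" by simp
    then show "V = \<beta> A.one * V" using V_hom[of A.one] by simp
  qed
  have Vw: "star V * w = 0" "star w * V = 0" "V * star w = 0" "w * star V = 0"
  proof -
    have "star V = star V * \<beta> A.one"
      using arg_cong[OF V1(2), of star] pr by (simp add: star_mult projection_def)
    then show 1: "star V * w = 0" using w\<beta>[of A.one] by (metis A.one_S mult.assoc mult_zero_right)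
    show "star w * V = 0" using arg_cong[OF 1, of star] by (simp add: star_mult star_star)
    have "star V = \<alpha> A.one * star V"
      using arg_cong[OF V1(1), of star] pr by (simp add: star_mult projection_def)
    then show 2: "w * star V = 0" using w\<alpha>[of A.one] by (metis A.one_S mult.assoc mult_zero_left)
    show "V * star w = 0" using arg_cong[OF 2, of star] by (simp add: star_mult star_star)
  qed
  let ?u = "V + w"
  have uu: "?u * star ?u = B.one"
    using w VV' Vw by (simp add: star_add algebra_simps)
  show ?thesis
  proof (rule that)
    show "?u \<in> T" using VT w by simp
    show "star ?u * ?u = B.one" using w VV Vw by (simp add: star_add algebra_simps)
    show "?u * star ?u = B.one" by (rule uu)
    fix x assume x: "x \<in> S"
    have "?u * \<alpha> x = \<beta> x * ?u"
      using V_hom[OF x] w\<alpha>[OF x] w\<beta>[OF x] by (simp add: algebra_simps)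
    then have "?u * \<alpha> x * star ?u = \<beta> x * B.one" by (simp add: uu mult.assoc)
    then show "?u * \<alpha> x * star ?u = \<beta> x" using x \<beta> by simp
  qed
qed

end

section \<open>Multiplicity matrices of homomorphisms\<close>

definition mat_tr :: "complex mat \<Rightarrow> complex" where
  "mat_tr A = (\<Sum>k<dim_row A. A $$ (k, k))"

text \<open>A single block as a \<open>star_alg\<close>: maps into a direct sum can be checked one
  component at a time, and block diagonal maps can be built up by iterated
  \<open>four_block_mat\<close>.\<close>

definition mat_alg :: "nat \<Rightarrow> complex mat star_alg" where
  "mat_alg n = \<lparr>sa_carrier = carrier_mat n n, sa_add = (+), sa_scale = (\<lambda>c x. c \<cdot>\<^sub>m x),
     sa_mult = (*), sa_star = mat_adjoint\<rparr>"

lemma block_carrier_closed: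
  assumes "u \<in> block_carrier ms"
  shows "v \<in> block_carrier ms \<Longrightarrow> map2 (+) u v \<in> block_carrier ms"
    "v \<in> block_carrier ms \<Longrightarrow> map2 (*) u v \<in> block_carrier ms"
    "map (\<lambda>x. c \<cdot>\<^sub>m x) u \<in> block_carrier ms" "map mat_adjoint u \<in> block_carrier ms"
  using assms by (auto simp: block_carrier_def intro!: mult_carrier_mat)

lemma star_hom_block_alg:
  assumes "\<And>i. i < length ns \<Longrightarrow> star_hom X (mat_alg (ns ! i)) (\<lambda>x. \<phi> x ! i)"
    and "\<And>x. x \<in> sa_carrier X \<Longrightarrow> length (\<phi> x) = length ns"
    "\<And>x y. \<lbrakk>x \<in> sa_carrier X; y \<in> sa_carrier X\<rbrakk> \<Longrightarrow> sa_add X x y \<in> sa_carrier X"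
    "\<And>x c. x \<in> sa_carrier X \<Longrightarrow> sa_scale X c x \<in> sa_carrier X"
    "\<And>x y. \<lbrakk>x \<in> sa_carrier X; y \<in> sa_carrier X\<rbrakk> \<Longrightarrow> sa_mult X x y \<in> sa_carrier X"
    "\<And>x. x \<in> sa_carrier X \<Longrightarrow> sa_star X x \<in> sa_carrier X"
  shows "star_hom X (block_alg ns) \<phi>"
  using assms unfolding star_hom_def block_alg_def mat_alg_def
  by (auto simp: block_carrier_def intro!: nth_equalityI)

lemma star_hom_nth: "j < length ms \<Longrightarrow> star_hom (block_alg ms) (mat_alg (ms ! j)) (\<lambda>u. u ! j)"
  by (auto simp: star_hom_def block_alg_def mat_alg_def block_carrier_def)

lemma star_hom_zero_mat: "star_hom X (mat_alg s) (\<lambda>_. 0\<^sub>m s s)"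
proof -
  have "mat_adjoint (0\<^sub>m s s) = (0\<^sub>m s s :: complex mat)" by (rule eq_matI) auto
  then show ?thesis by (simp add: star_hom_def mat_alg_def)
qed

lemma star_hom_four_block:
  assumes g: "star_hom X (mat_alg n) g" and h: "star_hom X (mat_alg m) h"
  shows "star_hom X (mat_alg (n + m)) (\<lambda>u. four_block_mat (g u) (0\<^sub>m n m) (0\<^sub>m m n) (h u))"
proof -
  have c: "g u \<in> carrier_mat n n" "h u \<in> carrier_mat m m" if "u \<in> sa_carrier X" for u
    using g h that by (auto simp: star_hom_def mat_alg_def)
  have adj: "mat_adjoint (four_block_mat A (0\<^sub>m n m) (0\<^sub>m m n) B) =
      four_block_mat (mat_adjoint A) (0\<^sub>m n m) (0\<^sub>m m n) (mat_adjoint B)"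
    if "A \<in> carrier_mat n n" "B \<in> carrier_mat m m" for A B :: "complex mat"
    using that by (intro eq_matI) auto
  show ?thesis
    unfolding star_hom_def mat_alg_def
  proof (intro conjI ballI allI, goal_cases)
    case (1 u)
    then show ?case using c by simp
  next
    case (2 u v)
    have "four_block_mat (g u) (0\<^sub>m n m) (0\<^sub>m m n) (h u) + four_block_mat (g v) (0\<^sub>m n m) (0\<^sub>m m n) (h v)
      = four_block_mat (g u + g v) (0\<^sub>m n m + 0\<^sub>m n m) (0\<^sub>m m n + 0\<^sub>m m n) (h u + h v)"
      using c[OF 2(1)] c[OF 2(2)] by (intro add_four_block_mat[of _ n n _ m _ m]) auto
    then show ?case using 2 g h by (simp add: star_hom_def mat_alg_def)
  next
    case (3 z u)
    have "z \<cdot>\<^sub>m four_block_mat (g u) (0\<^sub>m n m) (0\<^sub>m m n) (h u)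
      = four_block_mat (z \<cdot>\<^sub>m g u) (z \<cdot>\<^sub>m 0\<^sub>m n m) (z \<cdot>\<^sub>m 0\<^sub>m m n) (z \<cdot>\<^sub>m h u)"
      using c[OF 3] by (intro smult_four_block_mat[of _ n n _ m _ m]) auto
    then show ?case using 3 g h by (simp add: star_hom_def mat_alg_def)
  next
    case (4 u v)
    have "four_block_mat (g u) (0\<^sub>m n m) (0\<^sub>m m n) (h u) * four_block_mat (g v) (0\<^sub>m n m) (0\<^sub>m m n) (h v)
      = four_block_mat (g u * g v + 0\<^sub>m n m * 0\<^sub>m m n) (g u * 0\<^sub>m n m + 0\<^sub>m n m * h v)
          (0\<^sub>m m n * g v + h u * 0\<^sub>m m n) (0\<^sub>m m n * 0\<^sub>m n m + h u * h v)"
      using 4 c by (intro mult_four_block_mat[of _ n n _ m _ m _ _ n _ m]) auto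
    also have "\<dots> = four_block_mat (g u * g v) (0\<^sub>m n m) (0\<^sub>m m n) (h u * h v)"
      using c[OF 4(1)] c[OF 4(2)] by (intro cong_four_block_mat) auto
    finally show ?case using 4 g h by (simp add: star_hom_def mat_alg_def)
  next
    case (5 u)
    then show ?case using adj c g h by (simp add: star_hom_def mat_alg_def)
  qed
qed

lemma mat_tr_four_block:
  assumes "A \<in> carrier_mat n n" "B \<in> carrier_mat m m"
  shows "mat_tr (four_block_mat A (0\<^sub>m n m) (0\<^sub>m m n) B) = mat_tr A + mat_tr B"
proof -
  have "mat_tr (four_block_mat A (0\<^sub>m n m) (0\<^sub>m m n) B)
    = (\<Sum>k<n + m. if k < n then A $$ (k, k) else B $$ (k - n, k - n))"
    using assms unfolding mat_tr_def by (intro sum.cong) auto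
  also have "\<dots> = (\<Sum>k<n. if k < n then A $$ (k, k) else B $$ (k - n, k - n))
      + (\<Sum>k = n..<n + m. if k < n then A $$ (k, k) else B $$ (k - n, k - n))"
    by (simp only: lessThan_atLeast0 sum.atLeastLessThan_concat le_add1 zero_le)
  also have "\<dots> = (\<Sum>k<n. A $$ (k, k)) + (\<Sum>k = n..<n + m. B $$ (k - n, k - n))"
    by (intro arg_cong2[where f = "(+)"] sum.cong) auto
  also have "(\<Sum>k = n..<n + m. B $$ (k - n, k - n)) = (\<Sum>k<m. B $$ (k, k))"
    using sum.shift_bounds_nat_ivl[of "\<lambda>k. B $$ (k - n, k - n)" 0 n m]
    by (simp add: atLeast0LessThan add.commute)
  finally show ?thesis using assms by (simp add: mat_tr_def)
qed

text \<open>Each map is paired with its matrix size, which the map alone does not reveal. Both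
  claims share one induction because the trace formula needs the dimensions that the homomorphism
  part provides.\<close>

lemma star_hom_diag_block:
  assumes "\<And>g n. (g, n) \<in> set P \<Longrightarrow> star_hom (block_alg ms) (mat_alg n) g"
  shows "star_hom (block_alg ms) (mat_alg (sum_list (map snd P))) (\<lambda>u. diag_block_mat (map (\<lambda>x. fst x u) P))
    \<and> (\<forall>u\<in>block_carrier ms. mat_tr (diag_block_mat (map (\<lambda>x. fst x u) P)) = (\<Sum>x\<leftarrow>P. mat_tr (fst x u)))"
  using assms
proof (induction P)
  case Nil
  then show ?case
    using star_hom_zero_mat[of "block_alg ms" 0] by (simp add: mat_tr_def)
next
  case (Cons x P)
  obtain g n where [simp]: "x = (g, n)" by (cases x)
  let ?m = "sum_list (map snd P)" and ?h = "\<lambda>u. diag_block_mat (map (\<lambda>x. fst x u) P)"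
  have g: "star_hom (block_alg ms) (mat_alg n) g" using Cons.prems by auto
  have h: "star_hom (block_alg ms) (mat_alg ?m) ?h"
    and tr: "\<And>u. u \<in> block_carrier ms \<Longrightarrow> mat_tr (?h u) = (\<Sum>x\<leftarrow>P. mat_tr (fst x u))"
    using Cons by auto
  have c: "g u \<in> carrier_mat n n" "?h u \<in> carrier_mat ?m ?m" if "u \<in> block_carrier ms" for u
    using g h that unfolding star_hom_def mat_alg_def block_alg_def by auto
  have eq: "four_block_mat (g u) (0\<^sub>m n ?m) (0\<^sub>m ?m n) (?h u) = diag_block_mat (map (\<lambda>x. fst x u) (x # P))"
    if "u \<in> block_carrier ms" for u
    using c[OF that] by (auto simp: Let_def)
  show ?case
  proof (intro conjI ballI)
    have "star_hom (block_alg ms) (mat_alg (n + ?m)) (\<lambda>u. diag_block_mat (map (\<lambda>x. fst x u) (x # P)))"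
      by (rule star_hom_cong[OF star_hom_four_block[OF g h]])
        (use eq in \<open>auto simp: block_alg_def block_carrier_closed\<close>)
    then show "star_hom (block_alg ms) (mat_alg (sum_list (map snd (x # P))))
        (\<lambda>u. diag_block_mat (map (\<lambda>x. fst x u) (x # P)))" by simp
    fix u assume u: "u \<in> block_carrier ms"
    show "mat_tr (diag_block_mat (map (\<lambda>x. fst x u) (x # P))) = (\<Sum>x\<leftarrow>x # P. mat_tr (fst x u))"
      unfolding eq[OF u, symmetric] mat_tr_four_block[OF c[OF u]] using tr[OF u] by simp
  qed
qed

lemma sum_list_concat: "sum_list (concat xss) = (\<Sum>xs\<leftarrow>xss. sum_list (xs :: 'a::monoid_add list))"
  by (induction xss) simp_all

lemma repeat_diag_hom:
  shows "star_hom (block_alg ms) (mat_alg ((\<Sum>j<length ms. a $$ (i, j) * ms ! j) + s)) (repeat_diag a i s)"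
    and "u \<in> block_carrier ms \<Longrightarrow>
      mat_tr (repeat_diag a i s u) = (\<Sum>j<length ms. of_nat (a $$ (i, j)) * mat_tr (u ! j))"
proof -
  \<comment> \<open>The summands of \<open>repeat_diag\<close> as maps: coordinate \<open>j\<close>
    repeated according to row \<open>i\<close> of \<open>a\<close>, followed by the zero
    padding.\<close>
  define P :: "((complex mat list \<Rightarrow> complex mat) \<times> nat) list" where
    "P = concat (map (\<lambda>j. replicate (a $$ (i, j)) (\<lambda>u. u ! j, ms ! j)) [0..<length ms]) @ [(\<lambda>_. 0\<^sub>m s s, s)]"
  have P: "star_hom (block_alg ms) (mat_alg n) g" if "(g, n) \<in> set P" for g n
    using that by (auto simp: P_def star_hom_zero_mat star_hom_nth)
  have eq: "diag_block_mat (map (\<lambda>x. fst x u) P) = repeat_diag a i s u" if "u \<in> block_carrier ms" for u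
    using that by (simp add: P_def repeat_diag_def map_concat block_carrier_def o_def)
  have sz: "sum_list (map snd P) = (\<Sum>j<length ms. a $$ (i, j) * ms ! j) + s"
    by (simp add: P_def map_concat o_def sum_list_concat sum_list_replicate
        interv_sum_list_conv_sum_set_nat atLeast0LessThan)
  have tr: "(\<Sum>x\<leftarrow>P. mat_tr (fst x u)) = (\<Sum>j<length ms. of_nat (a $$ (i, j)) * mat_tr (u ! j))" for u
    by (simp add: P_def map_concat o_def sum_list_concat sum_list_replicate mat_tr_def
        interv_sum_list_conv_sum_set_nat atLeast0LessThan)
  note hom = star_hom_diag_block[of P ms, OF P]
  show "star_hom (block_alg ms) (mat_alg ((\<Sum>j<length ms. a $$ (i, j) * ms ! j) + s)) (repeat_diag a i s)"
    unfolding sz[symmetric]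
    by (rule star_hom_cong[OF conjunct1[OF hom]]) (use eq in \<open>auto simp: block_alg_def block_carrier_closed\<close>)
  show "mat_tr (repeat_diag a i s u) = (\<Sum>j<length ms. of_nat (a $$ (i, j)) * mat_tr (u ! j))"
    if "u \<in> block_carrier ms"
    unfolding eq[OF that, symmetric] tr[symmetric] using hom that by blast
qed

section \<open>Multiplicity matrices determined by traces\<close>

context block_coord
begin

lemma tr_eq_mat_tr: "x \<in> S \<Longrightarrow> j < length ms \<Longrightarrow> tr j x = mat_tr (\<kappa> x ! j)"
  by (simp add: tr_def mat_tr_def ent_def)

lemma \<kappa>_one: "j < length ms \<Longrightarrow> \<kappa> one ! j = 1\<^sub>m (ms ! j)"
  by (rule eq_matI) (use ent_one in \<open>auto simp: ent_def\<close>)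

lemma \<kappa>_eqI: "x \<in> S \<Longrightarrow> y \<in> S \<Longrightarrow> (\<And>j. j < length ms \<Longrightarrow> \<kappa> x ! j = \<kappa> y ! j) \<Longrightarrow> x = y"
  by (rule ent_eqI) (auto simp: ent_def)

lemma \<kappa>_nth_ops:
  assumes "j < length ms" "x \<in> S"
  shows "y \<in> S \<Longrightarrow> \<kappa> (x * y) ! j = \<kappa> x ! j * \<kappa> y ! j" "\<kappa> (star x) ! j = mat_adjoint (\<kappa> x ! j)"
  using assms by (simp_all add: \<kappa>_ops)

lemma block_unitary_\<kappa>:
  assumes "u \<in> S"
  shows "block_unitary ms (\<kappa> u) \<longleftrightarrow> u * star u = one \<and> star u * u = one"
proof
  assume "block_unitary ms (\<kappa> u)"
  then show "u * star u = one \<and> star u * u = one"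
    using assms by (auto simp: block_unitary_def \<kappa>_nth_ops \<kappa>_one intro!: \<kappa>_eqI)
next
  assume "u * star u = one \<and> star u * u = one"
  then have "\<kappa> u ! j * mat_adjoint (\<kappa> u ! j) = 1\<^sub>m (ms ! j)"
    "mat_adjoint (\<kappa> u ! j) * \<kappa> u ! j = 1\<^sub>m (ms ! j)" if "j < length ms" for j
    using that assms by (simp_all flip: \<kappa>_nth_ops \<kappa>_one)
  then show "block_unitary ms (\<kappa> u)"
    unfolding block_unitary_def using assms by (simp add: \<kappa>_carrier)
qed

end

lemma mult_vec_of_list:
  assumes "a \<in> carrier_mat n (length ms)" "i < n"
  shows "(a *\<^sub>v vec_of_list ms) $ i = (\<Sum>j<length ms. a $$ (i, j) * ms ! j)"
  using assms by (auto simp: scalar_prod_def atLeast0LessThan vec_of_list_index intro!: sum.cong)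

context block_pair
begin

text \<open>Existence half of the finite dimensional classification. The padding \<open>s i\<close>
  is a subtraction of natural numbers that loses nothing, because a multiplicity matrix satisfies
  the size inequality in every row.\<close>

lemma diag_hom:
  assumes a: "multiplicity_matrix (vec_of_list ms) (vec_of_list ns) a"
  defines "s \<equiv> (\<lambda>i. ns ! i - (\<Sum>j<length ms. a $$ (i, j) * ms ! j))"
  obtains \<beta> where "homs \<beta>"
    "\<And>x i. x \<in> S \<Longrightarrow> i < length ns \<Longrightarrow> \<kappa>' (\<beta> x) ! i = repeat_diag a i (s i) (\<kappa> x)"
    "\<And>i j. i < length ns \<Longrightarrow> j < length ms \<Longrightarrow> unit_tr \<beta> i j = of_nat (a $$ (i, j))"
proof
  define \<rho> where "\<rho> = (\<lambda>u. map (\<lambda>i. repeat_diag a i (s i) u) [0..<length ns])"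
  let ?\<beta> = "inv_into T \<kappa>' \<circ> \<rho> \<circ> \<kappa>"
  have ac: "a \<in> carrier_mat (length ns) (length ms)"
    using a by (simp add: multiplicity_matrix_def)
  have le: "(\<Sum>j<length ms. a $$ (i, j) * ms ! j) \<le> ns ! i" if "i < length ns" for i
    using a mult_vec_of_list[OF ac that] that ac unfolding multiplicity_matrix_def less_eq_vec_def
    by (auto simp: vec_of_list_index)
  have "star_hom (block_alg ms) (mat_alg (ns ! i)) (repeat_diag a i (s i))" if "i < length ns" for i
    using repeat_diag_hom(1)[of ms a i "s i"] le[OF that] by (simp add: s_def)
  then have \<rho>: "star_hom (block_alg ms) (block_alg ns) \<rho>"
    by (intro star_hom_block_alg) (auto simp: \<rho>_def block_alg_def block_carrier_closed)
  show hom: "homs ?\<beta>"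
    using star_hom_comp[OF A.star_hom_\<kappa> star_hom_comp[OF \<rho> B.star_hom_inv]] by (simp add: o_assoc)
  have \<rho>c: "\<rho> u \<in> block_carrier ns" if "u \<in> block_carrier ms" for u
    using \<rho> that by (simp add: star_hom_def block_alg_def)
  show rd: "\<kappa>' (?\<beta> x) ! i = repeat_diag a i (s i) (\<kappa> x)" if "x \<in> S" "i < length ns" for x i
    using that \<rho>c[OF A.\<kappa>_carrier[OF that(1)]] by (simp add: \<rho>_def)
  fix i j assume ij: "i < length ns" "j < length ms"
  have "unit_tr ?\<beta> i j = mat_tr (repeat_diag a i (s i) (\<kappa> (A.e j 0 0)))"
    unfolding unit_tr_def using ij rd[of "A.e j 0 0" i] homs_T[OF hom, of "A.e j 0 0"]
    by (simp add: B.tr_eq_mat_tr)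
  also have "\<dots> = (\<Sum>j'<length ms. of_nat (a $$ (i, j')) * A.tr j' (A.e j 0 0))"
    by (simp add: repeat_diag_hom A.\<kappa>_carrier A.tr_eq_mat_tr)
  also have "\<dots> = (\<Sum>j'<length ms. if j' = j then of_nat (a $$ (i, j)) else 0)"
    using ij idx_0 by (intro sum.cong) (auto simp: A.tr_e)
  also have "\<dots> = of_nat (a $$ (i, j))" using ij by simp
  finally show "unit_tr ?\<beta> i j = of_nat (a $$ (i, j))" .
qed

definition mult :: "('a \<Rightarrow> 'b) \<Rightarrow> nat mat" where
  "mult \<alpha> = mult_matrix_of ms ns (\<kappa>' \<circ> \<alpha> \<circ> inv_into S \<kappa>)"

text \<open>The complement of the image of the unit is a projection, so its trace in block
  \<open>i\<close> is a natural number. That number is the slack in the size inequality.\<close>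

lemma unit_tr_multiplicity_matrix:
  assumes \<alpha>: "homs \<alpha>" and a: "a \<in> carrier_mat (length ns) (length ms)"
    "\<And>i j. i < length ns \<Longrightarrow> j < length ms \<Longrightarrow> unit_tr \<alpha> i j = of_nat (a $$ (i, j))"
  shows "multiplicity_matrix (vec_of_list ms) (vec_of_list ns) a"
  unfolding multiplicity_matrix_def less_eq_vec_def
proof (intro conjI allI impI)
  show "a \<in> carrier_mat (dim_vec (vec_of_list ns)) (dim_vec (vec_of_list ms))"
    and "dim_vec (a *\<^sub>v vec_of_list ms) = dim_vec (vec_of_list ns)"
    using a by auto
  fix i assume "i < dim_vec (vec_of_list ns)"
  then have i: "i < length ns" by simp
  interpret h: block_hom S ms \<kappa> \<alpha> by (rule homs_block_hom[OF \<alpha>])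
  have "projection (B.one - \<alpha> A.one)"
    using h.projection_hom A.projection_one B.projection_one \<alpha> by (intro projection_diff) auto
  then obtain n :: nat where "B.tr i (B.one - \<alpha> A.one) = of_nat n"
    using B.tr_projection_nat[of "B.one - \<alpha> A.one" i] i \<alpha> by auto
  moreover have "B.tr i (B.one - \<alpha> A.one) = of_nat (ns ! i) - (\<Sum>j<length ms. of_nat (a $$ (i, j) * ms ! j))"
    using i \<alpha> a(2) by (simp add: B.tr_diff B.tr_one tr_hom A.tr_one)
  ultimately have "(of_nat (ns ! i) :: complex) = of_nat (n + (\<Sum>j<length ms. a $$ (i, j) * ms ! j))"
    by (simp add: algebra_simps)
  then have "ns ! i = n + (\<Sum>j<length ms. a $$ (i, j) * ms ! j)"
    by (simp only: of_nat_eq_iff)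
  then show "(a *\<^sub>v vec_of_list ms) $ i \<le> vec_of_list ns $ i"
    using mult_vec_of_list[OF a(1) i] by (simp add: vec_of_list_index)
qed

text \<open>Resolves the \<open>THE\<close> in \<open>mult_matrix_of\<close>. A witness exists
  because \<alpha> is unitarily equivalent to the diagonal homomorphism with matrix
  \<open>a\<close>; it is unique because conjugation by any other admissible unitary keeps the
  traces, and these are the entries.\<close>

lemma mult_eqI:
  assumes \<alpha>: "homs \<alpha>" and a: "a \<in> carrier_mat (length ns) (length ms)"
    "\<And>i j. i < length ns \<Longrightarrow> j < length ms \<Longrightarrow> unit_tr \<alpha> i j = of_nat (a $$ (i, j))"
  shows "mult \<alpha> = a"
  unfolding mult_def mult_matrix_of_def
proof (rule the_equality)
  have am: "multiplicity_matrix (vec_of_list ms) (vec_of_list ns) a"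
    using unit_tr_multiplicity_matrix[OF assms] by blast
  let ?s = "\<lambda>i. ns ! i - (\<Sum>j<length ms. a $$ (i, j) * ms ! j)"
  obtain \<beta> where \<beta>: "homs \<beta>"
    "\<And>x i. x \<in> S \<Longrightarrow> i < length ns \<Longrightarrow> \<kappa>' (\<beta> x) ! i = repeat_diag a i (?s i) (\<kappa> x)"
    "\<And>i j. i < length ns \<Longrightarrow> j < length ms \<Longrightarrow> unit_tr \<beta> i j = of_nat (a $$ (i, j))"
    using diag_hom[OF am] by blast
  obtain u where u: "u \<in> T" "star u * u = B.one" "u * star u = B.one"
    "\<And>x. x \<in> S \<Longrightarrow> u * \<alpha> x * star u = \<beta> x"
    using homs_unitarily_equivalent[OF \<alpha> \<beta>(1)] a(2) \<beta>(3) by metis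
  have "\<kappa>' u ! i * (\<kappa>' \<circ> \<alpha> \<circ> inv_into S \<kappa>) U ! i * mat_adjoint (\<kappa>' u ! i) = repeat_diag a i (?s i) U"
    if "i < length ns" "U \<in> block_carrier ms" for i U
  proof -
    let ?x = "inv_into S \<kappa> U"
    have x: "?x \<in> S" "\<kappa> ?x = U" using that by simp_all
    have "\<kappa>' (\<beta> ?x) ! i = \<kappa>' (u * \<alpha> ?x * star u) ! i" using u(4)[OF x(1)] by simp
    also have "\<dots> = \<kappa>' u ! i * \<kappa>' (\<alpha> ?x) ! i * mat_adjoint (\<kappa>' u ! i)"
      using that u(1) x \<alpha> by (simp add: B.\<kappa>_nth_ops)
    finally show ?thesis using \<beta>(2)[OF x(1) that(1)] x by simp
  qed
  moreover have "block_unitary ns (\<kappa>' u)" using u by (simp add: B.block_unitary_\<kappa>)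
  ultimately show "a \<in> carrier_mat (length ns) (length ms) \<and>
    (\<exists>v s. block_unitary ns v \<and> (\<forall>i<length ns. \<forall>u\<in>block_carrier ms.
      v ! i * (\<kappa>' \<circ> \<alpha> \<circ> inv_into S \<kappa>) u ! i * mat_adjoint (v ! i) = repeat_diag a i (s i) u))"
    using a(1) by (intro conjI exI[of _ "\<kappa>' u"] exI[of _ ?s]) auto
next
  fix b assume "b \<in> carrier_mat (length ns) (length ms) \<and>
    (\<exists>v s. block_unitary ns v \<and> (\<forall>i<length ns. \<forall>u\<in>block_carrier ms.
      v ! i * (\<kappa>' \<circ> \<alpha> \<circ> inv_into S \<kappa>) u ! i * mat_adjoint (v ! i) = repeat_diag b i (s i) u))"
  then obtain v s where b: "b \<in> carrier_mat (length ns) (length ms)" and v: "block_unitary ns v"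
    and vs: "\<And>i u. i < length ns \<Longrightarrow> u \<in> block_carrier ms \<Longrightarrow>
      v ! i * (\<kappa>' \<circ> \<alpha> \<circ> inv_into S \<kappa>) u ! i * mat_adjoint (v ! i) = repeat_diag b i (s i) u"
    by blast
  \<comment> \<open>The unitary tuple is pulled back to \<open>T\<close>, where invariance of the
    trace under conjugation is available.\<close>
  define w where "w = inv_into T \<kappa>' v"
  have vc: "v \<in> block_carrier ns" using v by (simp add: block_unitary_def)
  then have w: "w \<in> T" "\<kappa>' w = v" by (simp_all add: w_def)
  then have ww: "star w * w = B.one" using v B.block_unitary_\<kappa>[of w] by simp
  show "b = a"
  proof (rule eq_matI)
    fix i j assume "i < dim_row a" "j < dim_col a"
    then have ij: "i < length ns" "j < length ms" using a by auto
    let ?x = "A.e j 0 0"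
    have "of_nat (a $$ (i, j)) = B.tr i (\<alpha> ?x)" using a(2)[OF ij] by (simp add: unit_tr_def)
    also have "\<dots> = B.tr i (w * \<alpha> ?x * star w)"
      using B.tr_unitary_conj[OF w(1) ww] \<alpha> ij by simp
    also have "\<dots> = mat_tr (v ! i * \<kappa>' (\<alpha> ?x) ! i * mat_adjoint (v ! i))"
      using w \<alpha> ij by (simp add: B.tr_eq_mat_tr B.\<kappa>_nth_ops)
    also have "\<dots> = mat_tr (repeat_diag b i (s i) (\<kappa> ?x))"
      using vs[OF ij(1), of "\<kappa> ?x"] by (simp add: A.\<kappa>_carrier)
    also have "\<dots> = (\<Sum>j'<length ms. of_nat (b $$ (i, j')) * A.tr j' (A.e j 0 0))"
      by (simp add: repeat_diag_hom A.\<kappa>_carrier A.tr_eq_mat_tr)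
    also have "\<dots> = (\<Sum>j'<length ms. if j' = j then of_nat (b $$ (i, j)) else 0)"
      using ij idx_0 by (intro sum.cong) (auto simp: A.tr_e)
    also have "\<dots> = of_nat (b $$ (i, j))" using ij by simp
    finally show "b $$ (i, j) = a $$ (i, j)" by (simp only: of_nat_eq_iff)
  qed (use a b in auto)
qed

lemma mult_props:
  assumes \<alpha>: "homs \<alpha>"
  shows "mult \<alpha> \<in> carrier_mat (length ns) (length ms)"
    "\<And>i j. i < length ns \<Longrightarrow> j < length ms \<Longrightarrow> unit_tr \<alpha> i j = of_nat (mult \<alpha> $$ (i, j))"
    "multiplicity_matrix (vec_of_list ms) (vec_of_list ns) (mult \<alpha>)"
proof -
  have "\<exists>n. unit_tr \<alpha> i j = of_nat n" if "i < length ns" "j < length ms" for i j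
    by (rule unit_tr_nat[OF \<alpha> that]) blast
  then obtain n where n: "\<And>i j. i < length ns \<Longrightarrow> j < length ms \<Longrightarrow> unit_tr \<alpha> i j = of_nat (n i j)"
    by metis
  define a where "a = mat (length ns) (length ms) (\<lambda>(i, j). n i j)"
  have a: "a \<in> carrier_mat (length ns) (length ms)"
    "\<And>i j. i < length ns \<Longrightarrow> j < length ms \<Longrightarrow> unit_tr \<alpha> i j = of_nat (a $$ (i, j))"
    using n by (auto simp: a_def)
  have "mult \<alpha> = a" using mult_eqI[OF \<alpha> a] by blast
  then show "mult \<alpha> \<in> carrier_mat (length ns) (length ms)"
    "\<And>i j. i < length ns \<Longrightarrow> j < length ms \<Longrightarrow> unit_tr \<alpha> i j = of_nat (mult \<alpha> $$ (i, j))"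
    "multiplicity_matrix (vec_of_list ms) (vec_of_list ns) (mult \<alpha>)"
    using a unit_tr_multiplicity_matrix[OF \<alpha> a] by auto
qed

lemma tr_mult:
  assumes "homs \<alpha>" "x \<in> S" "i < length ns"
  shows "B.tr i (\<alpha> x) = (\<Sum>j<length ms. of_nat (mult \<alpha> $$ (i, j)) * A.tr j x)"
  using tr_hom[OF assms] mult_props(2)[OF assms(1,3)] by simp

text \<open>Allows the matrix of a map to be found from a trace computation on all of
  \<open>S\<close>, as is natural for composites and corrected maps.\<close>

lemma mult_eqI':
  assumes \<alpha>: "homs \<alpha>" and a: "a \<in> carrier_mat (length ns) (length ms)"
    "\<And>x i. x \<in> S \<Longrightarrow> i < length ns \<Longrightarrow> B.tr i (\<alpha> x) = (\<Sum>j<length ms. of_nat (a $$ (i, j)) * A.tr j x)"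
  shows "mult \<alpha> = a"
proof (rule mult_eqI[OF \<alpha> a(1)])
  fix i j assume ij: "i < length ns" "j < length ms"
  have "unit_tr \<alpha> i j = (\<Sum>j'<length ms. of_nat (a $$ (i, j')) * A.tr j' (A.e j 0 0))"
    using a(2)[of "A.e j 0 0" i] ij by (simp add: unit_tr_def)
  also have "\<dots> = (\<Sum>j'<length ms. if j' = j then of_nat (a $$ (i, j)) else 0)"
    using ij idx_0 by (intro sum.cong) (auto simp: A.tr_e)
  also have "\<dots> = of_nat (a $$ (i, j))" using ij by simp
  finally show "unit_tr \<alpha> i j = of_nat (a $$ (i, j))" .
qed

lemma ex_homs:
  assumes "multiplicity_matrix (vec_of_list ms) (vec_of_list ns) a"
  obtains \<beta> where "homs \<beta>" "mult \<beta> = a"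
  using diag_hom[OF assms] mult_eqI assms by (metis dim_vec_of_list multiplicity_matrix_def)

text \<open>Uniqueness half of the classification, with the unitary hidden: the intertwining only
  needs an endomorphism that preserves traces and carries \<alpha> to \<beta>.\<close>

lemma homs_conjugate:
  assumes \<alpha>: "homs \<alpha>" and \<beta>: "homs \<beta>" and "mult \<alpha> = mult \<beta>"
  obtains \<gamma> where "star_hom (sub_alg T) (sub_alg T) \<gamma>"
    "\<And>y i. y \<in> T \<Longrightarrow> i < length ns \<Longrightarrow> B.tr i (\<gamma> y) = B.tr i y"
    "\<And>x. x \<in> S \<Longrightarrow> \<gamma> (\<alpha> x) = \<beta> x"
proof -
  obtain u where u: "u \<in> T" "star u * u = B.one" "u * star u = B.one"
    "\<And>x. x \<in> S \<Longrightarrow> u * \<alpha> x * star u = \<beta> x"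
    using homs_unitarily_equivalent[OF \<alpha> \<beta>] mult_props(2)[OF \<alpha>] mult_props(2)[OF \<beta>] assms(3) by metis
  have "u * (x * y) * star u = (u * x * star u) * (u * y * star u)" if "x \<in> T" "y \<in> T" for x y
  proof -
    have "(u * x * star u) * (u * y * star u) = u * x * (star u * u) * y * star u" by (simp add: mult.assoc)
    then show ?thesis using that u by (simp add: mult.assoc)
  qed
  then have "star_hom (sub_alg T) (sub_alg T) (\<lambda>y. u * y * star u)"
    using u(1) unfolding star_hom_def sub_alg_def
    by (auto simp: distrib_left distrib_right scaleC_simps star_mult star_star mult.assoc)
  then show ?thesis
    using that u B.tr_unitary_conj by blast
qed

end

section \<open>Projections close to each other have equal traces\<close>

lemma mat_tr_mult_comm:
  assumes "A \<in> carrier_mat n n" "B \<in> carrier_mat n n"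
  shows "mat_tr (A * B) = mat_tr (B * A)"
proof -
  have "mat_tr (A * B) = (\<Sum>k<n. \<Sum>p<n. A $$ (k, p) * B $$ (p, k))"
    using assms by (simp add: mat_tr_def scalar_prod_def atLeast0LessThan)
  also have "\<dots> = (\<Sum>p<n. \<Sum>k<n. B $$ (p, k) * A $$ (k, p))"
    by (subst sum.swap) (simp add: mult.commute)
  also have "\<dots> = mat_tr (B * A)"
    using assms by (simp add: mat_tr_def scalar_prod_def atLeast0LessThan)
  finally show ?thesis .
qed

context block_coord
begin

text \<open>Turns a cancellation property in the algebra into invertibility of one block, by
  converting a kernel vector into an element annihilated by \<open>t\<close>.\<close>

lemma det_\<kappa>_nonzero:
  assumes t: "t \<in> S" "j < length ms" and inj: "\<And>x. x \<in> S \<Longrightarrow> t * x = 0 \<Longrightarrow> x = 0"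
  shows "det (\<kappa> t ! j) \<noteq> 0"
proof
  assume "det (\<kappa> t ! j) = 0"
  then obtain v where v: "v \<in> carrier_vec (ms ! j)" "v \<noteq> 0\<^sub>v (ms ! j)"
    and tv: "\<kappa> t ! j *\<^sub>v v = 0\<^sub>v (ms ! j)"
    using det_0_iff_vec_prod_zero[OF \<kappa>_nth[OF t]] by auto
  \<comment> \<open>Every column of block \<open>j\<close> is the kernel vector \<open>v\<close>,
    and the other blocks are 0.\<close>
  define x where "x = elt (\<lambda>j' k l. if j' = j then v $ k else 0)"
  have "t * x = 0"
  proof (rule ent_eqI)
    fix j' k l assume jk: "idx j' k" "idx j' l"
    show "ent (t * x) j' k l = ent 0 j' k l"
    proof (cases "j' = j")
      case True
      have "ent (t * x) j' k l = (\<kappa> t ! j *\<^sub>v v) $ k"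
        using jk t v True by (simp add: ent_mult x_def scalar_prod_def atLeast0LessThan ent_def[of t])
      then show ?thesis using tv jk True by simp
    next
      case False
      then show ?thesis using jk t by (simp add: ent_mult x_def)
    qed
  qed (use t in \<open>auto simp: x_def\<close>)
  then have "x = 0" using inj[of x] by (simp add: x_def)
  have "v = 0\<^sub>v (ms ! j)"
  proof (rule eq_vecI)
    fix k assume "k < dim_vec (0\<^sub>v (ms ! j))"
    then have k: "k < ms ! j" by simp
    then have "ent x j k k = v $ k" using t by (simp add: x_def)
    then show "v $ k = 0\<^sub>v (ms ! j) $ k" using \<open>x = 0\<close> k t by simp
  qed (use v in auto)
  then show False using v by simp
qed

text \<open>The element \<open>q p + (1 - q) (1 - p)\<close> intertwines \<open>p\<close> and \<open>q\<close>, and is invertible when no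
  nonzero \<open>x\<close> lies in the range of one projection and in the kernel of the other.\<close>

lemma tr_eq_if_no_kernel:
  assumes p: "p \<in> S" "projection p" and q: "q \<in> S" "projection q"
    and 1: "\<And>x. x \<in> S \<Longrightarrow> p * x = x \<Longrightarrow> q * x = 0 \<Longrightarrow> x = 0"
    and 2: "\<And>x. x \<in> S \<Longrightarrow> q * x = x \<Longrightarrow> p * x = 0 \<Longrightarrow> x = 0"
    and j: "j < length ms"
  shows "tr j p = tr j q"
proof -
  define t where "t = q * p + (one - q) * (one - p)"
  have pp: "p * p = p" "q * q = q" using p q by (auto simp: projection_def)
  have t: "t \<in> S" using p q by (simp add: t_def)
  have qq: "q * (q * x) = q * x" "p * (p * x) = p * x" for x
    using pp by (simp_all flip: mult.assoc)
  have tp: "t * p = q * p" "q * t = q * p"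
    using p q pp qq by (simp_all add: t_def algebra_simps)
  have "det (\<kappa> t ! j) \<noteq> 0"
  proof (rule det_\<kappa>_nonzero[OF t j])
    fix x assume x: "x \<in> S" "t * x = 0"
    \<comment> \<open>Multiplying \<open>t * x = 0\<close> by \<open>q\<close> isolates the first
      summand of \<open>t\<close>. Then \<open>p * x\<close> is in the range of \<open>p\<close> and
      killed by \<open>q\<close>, hence 0.\<close>
    have a: "q * (p * x) = 0"
      using arg_cong[OF x(2), of "\<lambda>z. q * z"] by (simp add: tp flip: mult.assoc)
    then have px: "p * x = 0" using 1[of "p * x"] x p qq by simp
    \<comment> \<open>Once \<open>p * x = 0\<close>, only \<open>x - q * x\<close> remains, so
      \<open>x\<close> lies in the range of \<open>q\<close> and in the kernel of
      \<open>p\<close>.\<close>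
    have "t * x = q * p * x + (x - q * x - (p * x - q * p * x))"
      using x p q by (simp add: t_def algebra_simps flip: mult.assoc[of one])
    then have "q * x = x" using x a px by (simp add: mult.assoc)
    then show "x = 0" using 2[of x] x px by simp
  qed
  then have "\<kappa> t ! j \<in> Units (ring_mat TYPE(complex) (ms ! j) ())"
    by (rule det_non_zero_imp_unit[OF \<kappa>_nth[OF t j]])
  then obtain B where B: "B \<in> carrier_mat (ms ! j) (ms ! j)" "B * \<kappa> t ! j = 1\<^sub>m (ms ! j)"
    "\<kappa> t ! j * B = 1\<^sub>m (ms ! j)"
    unfolding Units_def by (auto simp: ring_mat_def)
  let ?t = "\<kappa> t ! j" and ?p = "\<kappa> p ! j" and ?q = "\<kappa> q ! j" and ?n = "ms ! j"
  have c: "?t \<in> carrier_mat ?n ?n" "?p \<in> carrier_mat ?n ?n" "?q \<in> carrier_mat ?n ?n"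
    using t p q j by auto
  have tpq: "?t * ?p = ?q * ?t" using t p q j tp by (simp flip: \<kappa>_nth_ops)
  \<comment> \<open>In block \<open>j\<close> the projections are similar through the invertible
    \<open>?t\<close>, and \<open>B\<close> is its inverse.\<close>
  have "mat_tr ?p = mat_tr (B * ?t * ?p)" using B c by simp
  also have "\<dots> = mat_tr (B * (?q * ?t))" using assoc_mult_mat[OF B(1) c(1,2)] tpq by simp
  also have "\<dots> = mat_tr (?q * ?t * B)" using B c by (intro mat_tr_mult_comm) (auto intro: mult_carrier_mat)
  also have "\<dots> = mat_tr ?q" using assoc_mult_mat[OF c(3,1) B(1)] B c by simp
  finally show ?thesis using p q j by (simp add: tr_eq_mat_tr)
qed

end

section \<open>Unitaries of the unitization\<close>

lemma tilde_mult_assoc: "tilde_mult (tilde_mult u v) w = tilde_mult u (tilde_mult v w)"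
  by (cases u; cases v; cases w)
    (simp add: tilde_mult_def algebra_simps scaleC_simps scaleC_add_right)

lemma tilde_star_mult: "tilde_star (tilde_mult u v) = tilde_mult (tilde_star v) (tilde_star u)"
  by (cases u; cases v)
    (simp add: tilde_mult_def tilde_star_def star_add star_mult star_scaleC algebra_simps)

lemma tilde_star_embed: "tilde_star (x, 0) = (star x, 0)"
  by (simp add: tilde_star_def)

lemma tilde_star_star: "tilde_star (tilde_star u) = u"
  by (cases u) (simp add: tilde_star_def star_star)

lemma tilde_mult_ideal: "tilde_mult u (x, 0) = (fst (tilde_mult u (x, 0)), 0)"
  "tilde_mult (x, 0) u = (fst (tilde_mult (x, 0) u), 0)"
  by (cases u; simp add: tilde_mult_def)+

lemma tilde_mult_embed: "tilde_mult (x, 0) (y, 0) = (x * y, 0)"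
  by (simp add: tilde_mult_def)

lemma tilde_one_cases:
  obtains (unital) d :: "'b::cstar_algebra" where "has_unit TYPE('b)" "tilde_one = (d, 0)"
      "\<And>x. d * x = x" "\<And>x. x * d = x"
  | (nonunital) "\<not> has_unit TYPE('b)" "(tilde_one :: 'b \<times> complex) = (0, 1)"
proof (cases "has_unit TYPE('b)")
  case True
  then obtain d :: 'b where d: "\<And>x. d * x = x" "\<And>x. x * d = x" by (auto simp: has_unit_def)
  then have "(THE e::'b. \<forall>x. e * x = x \<and> x * e = x) = d"
    by (intro the_equality) (auto, metis)
  then show ?thesis using unital[OF True _ d] True by (simp add: tilde_one_def)
next
  case False
  then show ?thesis using nonunital by (simp add: tilde_one_def)
qed

text \<open>Restricted to embedded elements: in the unital case \<open>tilde_one\<close> is a pair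
  \<open>(d, 0)\<close>, which does not fix pairs with a nonzero second component.\<close>

lemma tilde_one_mult:
  fixes x :: "'b::cstar_algebra"
  shows "tilde_mult tilde_one (x, 0) = (x, 0)" "tilde_mult (x, 0) tilde_one = (x, 0)"
proof -
  have "tilde_mult tilde_one (x, 0) = (x, 0) \<and> tilde_mult (x, 0) tilde_one = (x, 0)"
  proof (cases rule: tilde_one_cases[where 'b = 'b])
    case (unital d)
    show ?thesis by (simp add: unital tilde_mult_def)
  next
    case nonunital
    show ?thesis by (simp add: nonunital tilde_mult_def)
  qed
  then show "tilde_mult tilde_one (x, 0) = (x, 0)" "tilde_mult (x, 0) tilde_one = (x, 0)" by auto
qed

text \<open>Left multiplication as an operator on the algebra itself. Estimates for this operator
  treat the unital and the nonunital case alike.\<close>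

definition tilde_act :: "'b::cstar_algebra \<times> complex \<Rightarrow> 'b \<Rightarrow> 'b" where
  "tilde_act u x = fst (tilde_mult u (x, 0))"

lemma tilde_act: "tilde_mult u (x, 0) = (tilde_act u x, 0)"
  using tilde_mult_ideal(1)[of u x] by (simp add: tilde_act_def)

lemma tilde_act_eq: "tilde_act (a, s) x = a * x + s *\<^sub>C x"
  by (simp add: tilde_act_def tilde_mult_def)

lemma tilde_act_mult: "tilde_act (tilde_mult u v) x = tilde_act u (tilde_act v x)"
proof -
  have "(tilde_act (tilde_mult u v) x, 0 :: complex) = (tilde_act u (tilde_act v x), 0)"
    by (simp only: tilde_mult_assoc flip: tilde_act)
  then show ?thesis by simp
qed

lemma tilde_act_embed [simp]: "tilde_act (x, 0) y = x * y"
  by (simp add: tilde_act_eq)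

lemma tilde_act_one [simp]: "tilde_act tilde_one x = x"
  by (simp add: tilde_act_def tilde_one_mult)

lemma tilde_act_diff: "tilde_act u (x - y) = tilde_act u x - tilde_act u y"
  by (cases u) (simp add: tilde_act_eq algebra_simps cstar.scale_right_diff_distrib)

lemma tilde_Ad: "tilde_mult (tilde_mult u (x, 0)) (tilde_star u) = (tilde_Ad u x, 0)"
  by (simp add: tilde_Ad_def tilde_act) (metis tilde_mult_ideal(2))

text \<open>By the C*-identity the squared norm of \<open>v x\<close> is the norm of
  \<open>star x\<close> times \<open>star v v\<close> times \<open>x\<close>, in which the middle
  factor is the unit.\<close>

lemma norm_tilde_act:
  assumes "tilde_mult (tilde_star v) v = tilde_one"
  shows "norm (tilde_act v x) = norm x"
proof -
  have "(star (tilde_act v x) * tilde_act v x, 0)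
    = tilde_mult (tilde_star (tilde_mult v (x, 0))) (tilde_mult v (x, 0))"
    by (simp add: tilde_act tilde_star_def tilde_mult_embed)
  also have "\<dots> = tilde_mult (tilde_star (x, 0)) (tilde_mult (tilde_mult (tilde_star v) v) (x, 0))"
    by (simp add: tilde_star_mult tilde_mult_assoc)
  also have "\<dots> = (star x * x, 0)"
    by (simp add: assms tilde_one_mult tilde_star_embed tilde_mult_embed)
  finally have "norm (star (tilde_act v x) * tilde_act v x) = norm (star x * x)" by simp
  then show ?thesis by (simp add: norm_star_mult)
qed

lemma norm_tilde_act_diff:
  fixes u :: "'b::cstar_algebra \<times> complex"
  assumes "u \<in> tilde_carrier"
  shows "norm (tilde_act u x - x) \<le> tilde_norm (u - tilde_one) * norm x"
proof (cases rule: tilde_one_cases[where 'b = 'b])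
  case (unital d)
  obtain a where u: "u = (a, 0)" using assms unital by (cases u) (auto simp: tilde_carrier_def)
  have "tilde_act u x - x = (a - d) * x" using unital by (simp add: u tilde_act_eq algebra_simps)
  then show ?thesis by (simp add: unital(1,2) u tilde_norm_def norm_mult_ineq)
next
  case nonunital
  obtain a s where u: "u = (a, s)" by (cases u)
  \<comment> \<open>In the nonunital case \<open>tilde_norm\<close> is an \<open>onorm\<close>,
    which bounds values only after the operator is known to be bounded.\<close>
  have "bounded_linear (\<lambda>x. a * x + (s - 1) *\<^sub>C x)"
  proof (rule bounded_linear_intro)
    fix x y :: 'b and r :: real
    show "a * (x + y) + (s - 1) *\<^sub>C (x + y) = a * x + (s - 1) *\<^sub>C x + (a * y + (s - 1) *\<^sub>C y)"
      by (simp add: algebra_simps scaleC_add_right)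
    show "a * (r *\<^sub>R x) + (s - 1) *\<^sub>C r *\<^sub>R x = r *\<^sub>R (a * x + (s - 1) *\<^sub>C x)"
      by (simp add: scaleR_add_right scaleC_of_real[symmetric] scaleC_scaleC mult_scaleC_right
          scaleC_add_right mult.commute)
    show "norm (a * x + (s - 1) *\<^sub>C x) \<le> norm x * (norm a + cmod (s - 1))"
      using norm_triangle_ineq[of "a * x" "(s - 1) *\<^sub>C x"] norm_mult_ineq[of a x]
      by (simp only: norm_scaleC distrib_left mult.commute[of "norm x"])
  qed
  then have "norm (a * x + (s - 1) *\<^sub>C x) \<le> onorm (\<lambda>x. a * x + (s - 1) *\<^sub>C x) * norm x"
    by (rule onorm)
  moreover have "tilde_act u x - x = a * x + (s - 1) *\<^sub>C x"
    by (simp add: u tilde_act_eq cstar.scale_left_diff_distrib)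
  ultimately show ?thesis by (simp add: nonunital u tilde_norm_def)
qed

text \<open>The adjoint of \<open>u\<close> maps \<open>x - u x\<close> isometrically to its own
  displacement of \<open>x\<close>, so \<open>u\<close> and its adjoint move \<open>x\<close>
  equally far.\<close>

lemma norm_tilde_act_star_diff:
  assumes "tilde_unitary u"
  shows "norm (tilde_act (tilde_star u) x - x) \<le> tilde_norm (u - tilde_one) * norm x"
proof -
  have u: "tilde_mult u (tilde_star u) = tilde_one" "tilde_mult (tilde_star u) u = tilde_one"
    using assms by (auto simp: tilde_unitary_def)
  have "tilde_act (tilde_star u) (x - tilde_act u x) = tilde_act (tilde_star u) x - x"
    by (simp add: tilde_act_diff u flip: tilde_act_mult)
  then have "norm (tilde_act (tilde_star u) x - x) = norm (x - tilde_act u x)"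
    using norm_tilde_act[of "tilde_star u"] u by (metis tilde_star_star)
  then show ?thesis
    using norm_tilde_act_diff[of u x] assms by (simp add: tilde_unitary_def norm_minus_commute)
qed

text \<open>The adjoint of \<open>u\<close> converts multiplication by the conjugate into
  multiplication by \<open>h\<close>. Equations for two different conjugates thus become equations
  for the same \<open>h\<close>.\<close>

lemma tilde_act_star_Ad:
  assumes "tilde_unitary u"
  shows "tilde_act (tilde_star u) (tilde_Ad u h * x) = h * tilde_act (tilde_star u) x"
proof -
  have "(tilde_act (tilde_star u) (tilde_Ad u h * x), 0)
    = tilde_mult (tilde_star u) (tilde_mult (tilde_mult (tilde_mult u (h, 0)) (tilde_star u)) (x, 0))"
    by (simp add: tilde_Ad tilde_mult_embed flip: tilde_act)
  also have "\<dots> = tilde_mult (tilde_mult (tilde_star u) u) (tilde_mult (h, 0) (tilde_mult (tilde_star u) (x, 0)))"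
    by (simp only: tilde_mult_assoc)
  also have "\<dots> = (h * tilde_act (tilde_star u) x, 0)"
    using assms by (simp add: tilde_unitary_def tilde_act tilde_mult_embed)
  finally show ?thesis by simp
qed

lemma star_hom_tilde_Ad:
  assumes "tilde_unitary (u :: 'b::cstar_algebra \<times> complex)"
  shows "star_hom (sub_alg UNIV) (sub_alg UNIV) (tilde_Ad u)"
proof -
  have add: "tilde_Ad u (x + y) = tilde_Ad u x + tilde_Ad u y" for x y
    by (cases u) (simp add: tilde_Ad_def tilde_mult_def tilde_star_def algebra_simps scaleC_add_right)
  have scale: "tilde_Ad u (c *\<^sub>C x) = c *\<^sub>C tilde_Ad u x" for c x
    by (cases u) (simp add: tilde_Ad_def tilde_mult_def tilde_star_def algebra_simps scaleC_simps scaleC_add_right)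
  have mult: "tilde_Ad u (x * y) = tilde_Ad u x * tilde_Ad u y" for x y
  proof -
    have "(tilde_Ad u x * tilde_Ad u y, 0)
      = tilde_mult (tilde_mult (tilde_mult u (x, 0)) (tilde_star u)) (tilde_mult (tilde_mult u (y, 0)) (tilde_star u))"
      by (simp add: tilde_Ad tilde_mult_embed)
    also have "\<dots> = tilde_mult (tilde_mult u (tilde_mult (x, 0) (tilde_mult (tilde_mult (tilde_star u) u) (y, 0)))) (tilde_star u)"
      by (simp only: tilde_mult_assoc)
    also have "\<dots> = (tilde_Ad u (x * y), 0)"
      using assms by (simp add: tilde_unitary_def tilde_one_mult tilde_mult_embed tilde_Ad)
    finally show ?thesis by simp
  qed
  have star: "tilde_Ad u (star x) = star (tilde_Ad u x)" for x
  proof -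
    have "(star (tilde_Ad u x), 0) = tilde_star (tilde_mult (tilde_mult u (x, 0)) (tilde_star u))"
      by (simp add: tilde_Ad) (simp add: tilde_star_def)
    also have "\<dots> = tilde_mult (tilde_mult u (tilde_star (x, 0))) (tilde_star u)"
      by (simp add: tilde_star_mult tilde_star_star tilde_mult_assoc)
    also have "\<dots> = (tilde_Ad u (star x), 0)"
      by (simp add: tilde_star_embed tilde_Ad)
    finally show ?thesis by simp
  qed
  show ?thesis by (simp add: star_hom_def sub_alg_def add scale mult star)
qed

lemma star_unit:
  fixes d :: "'b::cstar_algebra"
  assumes "\<And>x. d * x = x" "\<And>x. x * d = x"
  shows "star d = d"
proof -
  have "star (d * star d) = d * star d" by (simp add: star_mult star_star)
  then have "star (star d) = star d" by (simp only: assms(1))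
  then show ?thesis by (simp only: star_star)
qed

text \<open>These facts make the constant sequence \<open>tilde_one\<close> an admissible choice for
  a homomorphism that already respects the filtrations.\<close>

lemma tilde_unitary_one: "tilde_unitary tilde_one"
  and tilde_Ad_one: "tilde_Ad tilde_one x = x"
  and tilde_norm_zero: "tilde_norm (0 :: 'b::cstar_algebra \<times> complex) = 0"
proof -
  show "tilde_norm (0 :: 'b \<times> complex) = 0"
    by (simp add: tilde_norm_def zero_prod_def onorm_zero)
  show "tilde_unitary (tilde_one :: 'a \<times> complex)"
  proof (cases rule: tilde_one_cases[where 'b = 'a])
    case (unital d)
    then show ?thesis
      by (simp add: unital(1,2) tilde_unitary_def tilde_carrier_def tilde_mult_def tilde_star_def star_unit[OF unital(3,4)])
  next
    case nonunital
    then show ?thesis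
      by (simp add: nonunital tilde_unitary_def tilde_carrier_def tilde_mult_def tilde_star_def)
  qed
  show "tilde_Ad tilde_one x = x" for x :: 'c
  proof (cases rule: tilde_one_cases[where 'b = 'c])
    case (unital d)
    then show ?thesis
      by (simp add: unital(1,2) tilde_Ad_def tilde_mult_def tilde_star_def star_unit[OF unital(3,4)])
  next
    case nonunital
    then show ?thesis by (simp add: nonunital tilde_Ad_def tilde_mult_def tilde_star_def)
  qed
qed

section \<open>Comparison of two conjugates of one projection\<close>

lemma norm_projection_le: "projection h \<Longrightarrow> norm h \<le> 1"
  using norm_star_mult[of h] by (auto simp: projection_def power2_eq_square)

text \<open>Let \<open>a\<close> and \<open>b\<close> be the images of \<open>x\<close> under the
  adjoints of \<open>u\<close> and \<open>v\<close>. The assumptions become \<open>h a = a\<close>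
  and \<open>h b = 0\<close>, so \<open>a = h (a - b)\<close> and the norm of \<open>x\<close>,
  which is that of \<open>a\<close>, is at most the norm of \<open>a - b\<close>. Both
  \<open>a\<close> and \<open>b\<close> are closer to \<open>x\<close> than half its norm if
  \<open>x\<close> is nonzero, a contradiction.\<close>

lemma tilde_Ad_no_kernel:
  assumes u: "tilde_unitary u" "tilde_norm (u - tilde_one) < 1 / 2"
    and v: "tilde_unitary v" "tilde_norm (v - tilde_one) < 1 / 2"
    and h: "projection h" and x: "tilde_Ad u h * x = x" "tilde_Ad v h * x = 0"
  shows "x = 0"
proof (rule ccontr)
  assume "x \<noteq> 0"
  let ?u = "tilde_act (tilde_star u) x" and ?v = "tilde_act (tilde_star v) x"
  have "?u = h * ?u" using tilde_act_star_Ad[OF u(1), of h x] x by simp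
  moreover have "h * ?v = tilde_act (tilde_star v) 0" using tilde_act_star_Ad[OF v(1), of h x] x by simp
  moreover have "tilde_act (tilde_star v) 0 = 0" using tilde_act_diff[of "tilde_star v" 0 0] by simp
  ultimately have "?u = h * (?u - ?v)" by (simp add: algebra_simps)
  then have "norm ?u \<le> norm h * norm (?u - ?v)" by (metis norm_mult_ineq)
  also have "\<dots> \<le> 1 * norm (?u - ?v)" using h by (intro mult_right_mono norm_projection_le) auto
  also have "\<dots> \<le> norm (?u - x) + norm (?v - x)"
    using norm_triangle_ineq4[of "?u - x" "?v - x"] by simp
  also have "\<dots> \<le> tilde_norm (u - tilde_one) * norm x + tilde_norm (v - tilde_one) * norm x"
    using u v by (intro add_mono norm_tilde_act_star_diff)
  also have "\<dots> < 1 / 2 * norm x + 1 / 2 * norm x"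
    using u v \<open>x \<noteq> 0\<close> by (intro add_strict_mono mult_strict_right_mono) auto
  also have "\<dots> = norm ?u"
    using norm_tilde_act[of "tilde_star u" x] u by (simp add: tilde_unitary_def tilde_star_star)
  finally show False by simp
qed

context block_pair
begin

lemma mult_tilde_Ad_eq:
  assumes u: "tilde_unitary u" "tilde_norm (u - tilde_one) < 1 / 2"
    and v: "tilde_unitary v" "tilde_norm (v - tilde_one) < 1 / 2"
    and \<phi>: "star_hom (sub_alg S) (sub_alg UNIV) \<phi>"
    and uT: "(tilde_Ad u \<circ> \<phi>) ` S \<subseteq> T" and vT: "(tilde_Ad v \<circ> \<phi>) ` S \<subseteq> T"
  shows "homs (tilde_Ad u \<circ> \<phi>)" "mult (tilde_Ad u \<circ> \<phi>) = mult (tilde_Ad v \<circ> \<phi>)"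
proof -
  have hu: "homs (tilde_Ad u \<circ> \<phi>)" and hv: "homs (tilde_Ad v \<circ> \<phi>)"
    using star_hom_comp[OF \<phi> star_hom_tilde_Ad[OF u(1)]] star_hom_comp[OF \<phi> star_hom_tilde_Ad[OF v(1)]] uT vT
    by (auto simp: star_hom_def sub_alg_def)
  then show "homs (tilde_Ad u \<circ> \<phi>)" by simp
  interpret h: block_hom S ms \<kappa> \<phi> by unfold_locales (rule \<phi>)
  show "mult (tilde_Ad u \<circ> \<phi>) = mult (tilde_Ad v \<circ> \<phi>)"
  proof (rule mult_eqI[OF hu])
    show "mult (tilde_Ad v \<circ> \<phi>) \<in> carrier_mat (length ns) (length ms)" by (rule mult_props[OF hv])
    fix i j assume ij: "i < length ns" "j < length ms"
    have e: "projection (A.e j 0 0)"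
      using idx_0[OF ij(2)] by (simp add: projection_def A.e_mult A.star_e)
    interpret hu: block_hom S ms \<kappa> "tilde_Ad u \<circ> \<phi>" by (rule homs_block_hom[OF hu])
    interpret hv: block_hom S ms \<kappa> "tilde_Ad v \<circ> \<phi>" by (rule homs_block_hom[OF hv])
    let ?h = "\<phi> (A.e j 0 0)"
    have ph: "projection ?h" using e by (simp add: h.projection_hom)
    \<comment> \<open>Corresponding entries are traces of two conjugates of the same projection
      \<open>?h\<close>; the two kernel conditions differ by exchanging \<open>u\<close> and
      \<open>v\<close>.\<close>
    have "unit_tr (tilde_Ad u \<circ> \<phi>) i j = unit_tr (tilde_Ad v \<circ> \<phi>) i j"
      unfolding unit_tr_def
    proof (rule B.tr_eq_if_no_kernel)
      show "projection ((tilde_Ad u \<circ> \<phi>) (A.e j 0 0))" "projection ((tilde_Ad v \<circ> \<phi>) (A.e j 0 0))"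
        using e hu.projection_hom hv.projection_hom by simp_all
      show "(tilde_Ad u \<circ> \<phi>) (A.e j 0 0) \<in> T" "(tilde_Ad v \<circ> \<phi>) (A.e j 0 0) \<in> T"
        using homs_T[OF hu] homs_T[OF hv] by simp_all
      show "i < length ns" by (rule ij(1))
      show "x = 0" if "(tilde_Ad u \<circ> \<phi>) (A.e j 0 0) * x = x" "(tilde_Ad v \<circ> \<phi>) (A.e j 0 0) * x = 0" for x
        by (rule tilde_Ad_no_kernel[OF u v ph]) (use that in simp_all)
      show "x = 0" if "(tilde_Ad v \<circ> \<phi>) (A.e j 0 0) * x = x" "(tilde_Ad u \<circ> \<phi>) (A.e j 0 0) * x = 0" for x
        by (rule tilde_Ad_no_kernel[OF v u ph]) (use that in simp_all)
    qed
    then show "unit_tr (tilde_Ad u \<circ> \<phi>) i j = of_nat (mult (tilde_Ad v \<circ> \<phi>) $$ (i, j))"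
      using mult_props(2)[OF hv ij] by simp
  qed
qed

end

section \<open>Filtered algebras and their diagrams\<close>

definition nonzero_af :: "'a::cstar_algebra af_obj \<Rightarrow> bool" where
  "nonzero_af \<A> \<longleftrightarrow> af_object \<A> \<and> \<not> zero_algebra TYPE('a)"

definition af_tr :: "'a::cstar_algebra af_obj \<Rightarrow> nat \<Rightarrow> nat \<Rightarrow> 'a \<Rightarrow> complex" where
  "af_tr \<A> n i x = mat_tr (af_coord \<A> n x ! i)"

text \<open>The levels are arguments because one map has a different matrix at each pair of levels.
  For the identity map these are the connecting matrices of the diagram.\<close>

definition af_mult :: "'a::cstar_algebra af_obj \<Rightarrow> nat \<Rightarrow> 'b::cstar_algebra af_obj \<Rightarrow> nat \<Rightarrow> ('a \<Rightarrow> 'b) \<Rightarrow> nat mat" where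
  "af_mult \<A> n \<B> m \<alpha> = mult_matrix_of (af_sizes \<A> n) (af_sizes \<B> m)
     (af_coord \<B> m \<circ> \<alpha> \<circ> inv_into (af_filt \<A> n) (af_coord \<A> n))"

text \<open>The map is defined on the whole type but constrained only on level \<open>n\<close>, so
  maps agreeing there are interchangeable.\<close>

abbreviation step_hom :: "'a::cstar_algebra af_obj \<Rightarrow> nat \<Rightarrow> 'b::cstar_algebra af_obj \<Rightarrow> nat \<Rightarrow> ('a \<Rightarrow> 'b) \<Rightarrow> bool" where
  "step_hom \<A> n \<B> m \<alpha> \<equiv> star_hom (sub_alg (af_filt \<A> n)) (sub_alg (af_filt \<B> m)) \<alpha>"

lemma af_block_coord: "af_object \<A> \<Longrightarrow> block_coord (af_filt \<A> n) (af_sizes \<A> n) (af_coord \<A> n)"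
  by (simp add: af_object_def block_coord_def)

lemma af_filt_mono: "af_object \<A> \<Longrightarrow> n \<le> m \<Longrightarrow> af_filt \<A> n \<subseteq> af_filt \<A> m"
  by (simp add: af_object_def incseqD)

lemma af_sizes_pos: "nonzero_af \<A> \<Longrightarrow> j < length (af_sizes \<A> n) \<Longrightarrow> af_sizes \<A> n ! j \<ge> 1"
  using nth_mem[of j "af_sizes \<A> n"] unfolding nonzero_af_def af_object_def by blast

lemma af_block_pair:
  assumes "nonzero_af \<A>" "nonzero_af \<B>"
  shows "block_pair (af_filt \<A> n) (af_sizes \<A> n) (af_coord \<A> n) (af_filt \<B> m) (af_sizes \<B> m) (af_coord \<B> m)"
  using assms af_block_coord[of \<A> n] af_block_coord[of \<B> m] af_sizes_pos[OF assms(1), of _ n]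
  by (simp add: block_pair_def block_pair_axioms_def nonzero_af_def)

lemma step_homD: "step_hom \<A> n \<B> m \<alpha> \<Longrightarrow> x \<in> af_filt \<A> n \<Longrightarrow> \<alpha> x \<in> af_filt \<B> m"
  by (simp add: star_hom_def sub_alg_def)

lemma step_hom_comp: "step_hom \<A> n \<B> m \<alpha> \<Longrightarrow> step_hom \<B> m \<C> p \<beta> \<Longrightarrow> step_hom \<A> n \<C> p (\<beta> \<circ> \<alpha>)"
  by (rule star_hom_comp)

lemma step_hom_cong:
  assumes "af_object \<A>" "step_hom \<A> n \<B> m \<alpha>" "\<And>x. x \<in> af_filt \<A> n \<Longrightarrow> \<alpha> x = \<beta> x"
  shows "step_hom \<A> n \<B> m \<beta>"
proof -
  interpret block_coord "af_filt \<A> n" "af_sizes \<A> n" "af_coord \<A> n" by (rule af_block_coord[OF assms(1)])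
  show ?thesis by (rule star_hom_cong[OF assms(2)]) (use assms(3) in \<open>auto simp: sub_alg_def\<close>)
qed

lemma step_hom_id: "af_object \<A> \<Longrightarrow> n \<le> m \<Longrightarrow> step_hom \<A> n \<A> m id"
  using af_filt_mono[of \<A> n m] by (auto simp: star_hom_def sub_alg_def)

lemma step_hom_contractive:
  assumes "nonzero_af \<A>" "step_hom \<A> n \<B> m \<alpha>" "x \<in> af_filt \<A> n"
  shows "norm (\<alpha> x) \<le> norm x"
proof -
  interpret block_coord "af_filt \<A> n" "af_sizes \<A> n" "af_coord \<A> n"
    using assms by (intro af_block_coord) (simp add: nonzero_af_def)
  interpret block_hom "af_filt \<A> n" "af_sizes \<A> n" "af_coord \<A> n" \<alpha>
    using assms(2) by unfold_locales (simp add: star_hom_def sub_alg_def)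
  show ?thesis using assms by (intro hom_contractive)
qed

section \<open>Trace calculus between filtration levels\<close>

context
  fixes \<A> :: "'a::cstar_algebra af_obj" and \<B> :: "'b::cstar_algebra af_obj"
  assumes \<A>: "nonzero_af \<A>" and \<B>: "nonzero_af \<B>"
begin

interpretation P: block_pair "af_filt \<A> n" "af_sizes \<A> n" "af_coord \<A> n"
    "af_filt \<B> m" "af_sizes \<B> m" "af_coord \<B> m" for n m
  by (rule af_block_pair[OF \<A> \<B>])

lemma af_mult_multiplicity:
  "step_hom \<A> n \<B> m \<alpha> \<Longrightarrow>
    multiplicity_matrix (vec_of_list (af_sizes \<A> n)) (vec_of_list (af_sizes \<B> m)) (af_mult \<A> n \<B> m \<alpha>)"
  using P.mult_props(3) by (simp add: af_mult_def P.mult_def)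

lemma af_tr_hom:
  assumes "step_hom \<A> n \<B> m \<alpha>" "x \<in> af_filt \<A> n" "i < length (af_sizes \<B> m)"
  shows "af_tr \<B> m i (\<alpha> x) = (\<Sum>j<length (af_sizes \<A> n). of_nat (af_mult \<A> n \<B> m \<alpha> $$ (i, j)) * af_tr \<A> n j x)"
  using P.tr_mult[OF assms] step_homD[OF assms(1,2)] assms(2,3)
  by (simp add: P.A.tr_eq_mat_tr P.B.tr_eq_mat_tr af_tr_def af_mult_def P.mult_def)

lemma af_mult_eqI:
  assumes "step_hom \<A> n \<B> m \<alpha>" "a \<in> carrier_mat (length (af_sizes \<B> m)) (length (af_sizes \<A> n))"
    and "\<And>x i. x \<in> af_filt \<A> n \<Longrightarrow> i < length (af_sizes \<B> m) \<Longrightarrow>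
      af_tr \<B> m i (\<alpha> x) = (\<Sum>j<length (af_sizes \<A> n). of_nat (a $$ (i, j)) * af_tr \<A> n j x)"
  shows "af_mult \<A> n \<B> m \<alpha> = a"
proof -
  have "P.mult n m \<alpha> = a"
    using assms step_homD[OF assms(1)]
    by (intro P.mult_eqI') (simp_all add: P.A.tr_eq_mat_tr P.B.tr_eq_mat_tr af_tr_def)
  then show ?thesis by (simp add: af_mult_def P.mult_def)
qed

lemma ex_step_hom:
  assumes "multiplicity_matrix (vec_of_list (af_sizes \<A> n)) (vec_of_list (af_sizes \<B> m)) a"
  obtains \<alpha> where "step_hom \<A> n \<B> m \<alpha>" "af_mult \<A> n \<B> m \<alpha> = a"
  using P.ex_homs[OF assms] by (metis P.mult_def af_mult_def)

lemma af_mult_tilde_Ad_eq: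
  assumes "tilde_unitary u" "tilde_norm (u - tilde_one) < 1 / 2"
    and "tilde_unitary v" "tilde_norm (v - tilde_one) < 1 / 2"
    and \<phi>: "star_hom (sub_alg UNIV) (sub_alg UNIV) \<phi>"
    and "(tilde_Ad u \<circ> \<phi>) ` af_filt \<A> n \<subseteq> af_filt \<B> m" "(tilde_Ad v \<circ> \<phi>) ` af_filt \<A> n \<subseteq> af_filt \<B> m"
  shows "step_hom \<A> n \<B> m (tilde_Ad u \<circ> \<phi>)"
    "af_mult \<A> n \<B> m (tilde_Ad u \<circ> \<phi>) = af_mult \<A> n \<B> m (tilde_Ad v \<circ> \<phi>)"
proof -
  have "star_hom (sub_alg (af_filt \<A> n)) (sub_alg UNIV) \<phi>"
    using \<phi> by (simp add: star_hom_def sub_alg_def)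
  note P.mult_tilde_Ad_eq[OF assms(1-4) this assms(6,7)]
  then show "step_hom \<A> n \<B> m (tilde_Ad u \<circ> \<phi>)"
    "af_mult \<A> n \<B> m (tilde_Ad u \<circ> \<phi>) = af_mult \<A> n \<B> m (tilde_Ad v \<circ> \<phi>)"
    by (simp_all add: af_mult_def P.mult_def)
qed

lemma step_hom_conjugate:
  assumes "step_hom \<A> n \<B> m \<alpha>" "step_hom \<A> n \<B> m \<beta>" "af_mult \<A> n \<B> m \<alpha> = af_mult \<A> n \<B> m \<beta>"
  obtains \<gamma> where "step_hom \<B> m \<B> m \<gamma>"
    "\<And>y i. y \<in> af_filt \<B> m \<Longrightarrow> i < length (af_sizes \<B> m) \<Longrightarrow> af_tr \<B> m i (\<gamma> y) = af_tr \<B> m i y"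
    "\<And>x. x \<in> af_filt \<A> n \<Longrightarrow> \<gamma> (\<alpha> x) = \<beta> x"
proof -
  have "P.mult n m \<alpha> = P.mult n m \<beta>" using assms(3) by (simp add: af_mult_def P.mult_def)
  then obtain \<gamma> where \<gamma>: "step_hom \<B> m \<B> m \<gamma>"
    "\<And>y i. y \<in> af_filt \<B> m \<Longrightarrow> i < length (af_sizes \<B> m) \<Longrightarrow> P.B.tr m i (\<gamma> y) = P.B.tr m i y"
    "\<And>x. x \<in> af_filt \<A> n \<Longrightarrow> \<gamma> (\<alpha> x) = \<beta> x"
    using P.homs_conjugate[OF assms(1,2)] by metis
  moreover have "af_tr \<B> m i (\<gamma> y) = af_tr \<B> m i y" if "y \<in> af_filt \<B> m" "i < length (af_sizes \<B> m)" for y i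
    using \<gamma>(2)[OF that] that step_homD[OF \<gamma>(1) that(1)] by (simp add: P.B.tr_eq_mat_tr af_tr_def)
  ultimately show ?thesis using that by blast
qed

lemma af_mult_carrier:
  "step_hom \<A> n \<B> m \<alpha> \<Longrightarrow> af_mult \<A> n \<B> m \<alpha> \<in> carrier_mat (length (af_sizes \<B> m)) (length (af_sizes \<A> n))"
  using af_mult_multiplicity[of n m \<alpha>] by (simp add: multiplicity_matrix_def)

lemma af_mult_cong:
  assumes "step_hom \<A> n \<B> m \<alpha>" "\<And>x. x \<in> af_filt \<A> n \<Longrightarrow> \<alpha> x = \<beta> x"
  shows "af_mult \<A> n \<B> m \<beta> = af_mult \<A> n \<B> m \<alpha>"
proof (rule af_mult_eqI)
  show "step_hom \<A> n \<B> m \<beta>"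
    using step_hom_cong[OF _ assms] \<A> by (simp add: nonzero_af_def)
  show "af_mult \<A> n \<B> m \<alpha> \<in> carrier_mat (length (af_sizes \<B> m)) (length (af_sizes \<A> n))"
    by (rule af_mult_carrier[OF assms(1)])
qed (use af_tr_hom[OF assms(1)] assms(2) in simp)

end

text \<open>The trace formula is applied twice and the sums are exchanged; the entries of the matrix
  product appear as coefficients, without composing unitary equivalences.\<close>

lemma af_mult_comp:
  assumes \<A>: "nonzero_af \<A>" and \<B>: "nonzero_af \<B>" and \<C>: "nonzero_af \<C>"
    and \<alpha>: "step_hom \<A> n \<B> m \<alpha>" and \<beta>: "step_hom \<B> m \<C> p \<beta>"
  shows "af_mult \<A> n \<C> p (\<beta> \<circ> \<alpha>) = af_mult \<B> m \<C> p \<beta> * af_mult \<A> n \<B> m \<alpha>"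
proof (rule af_mult_eqI[OF \<A> \<C> step_hom_comp[OF \<alpha> \<beta>]])
  let ?a = "af_mult \<A> n \<B> m \<alpha>" and ?b = "af_mult \<B> m \<C> p \<beta>"
  note c = af_mult_carrier[OF \<A> \<B> \<alpha>] af_mult_carrier[OF \<B> \<C> \<beta>]
  show "?b * ?a \<in> carrier_mat (length (af_sizes \<C> p)) (length (af_sizes \<A> n))"
    using c by simp
  fix x i assume x: "x \<in> af_filt \<A> n" and i: "i < length (af_sizes \<C> p)"
  have "af_tr \<C> p i ((\<beta> \<circ> \<alpha>) x) = (\<Sum>k<length (af_sizes \<B> m). of_nat (?b $$ (i, k)) * af_tr \<B> m k (\<alpha> x))"
    using af_tr_hom[OF \<B> \<C> \<beta> step_homD[OF \<alpha> x] i] by simp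
  also have "\<dots> = (\<Sum>k<length (af_sizes \<B> m). \<Sum>j<length (af_sizes \<A> n).
      of_nat (?b $$ (i, k) * ?a $$ (k, j)) * af_tr \<A> n j x)"
    using af_tr_hom[OF \<A> \<B> \<alpha> x] by (simp add: sum_distrib_left mult.assoc)
  also have "\<dots> = (\<Sum>j<length (af_sizes \<A> n). of_nat (\<Sum>k<length (af_sizes \<B> m). ?b $$ (i, k) * ?a $$ (k, j)) * af_tr \<A> n j x)"
    by (subst sum.swap) (simp add: sum_distrib_right)
  also have "\<dots> = (\<Sum>j<length (af_sizes \<A> n). of_nat ((?b * ?a) $$ (i, j)) * af_tr \<A> n j x)"
    using c i by (intro sum.cong refl) (auto simp: scalar_prod_def atLeast0LessThan)
  finally show "af_tr \<C> p i ((\<beta> \<circ> \<alpha>) x) = (\<Sum>j<length (af_sizes \<A> n). of_nat ((?b * ?a) $$ (i, j)) * af_tr \<A> n j x)" .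
qed

lemma af_mult_id: "nonzero_af \<A> \<Longrightarrow> af_mult \<A> n \<A> n id = 1\<^sub>m (length (af_sizes \<A> n))"
  by (rule af_mult_eqI) (auto simp: step_hom_id nonzero_af_def of_bool_def if_distrib if_distribR cong: if_cong)

text \<open>Presents the edges as matrices of inclusions, so that identities between paths become
  instances of \<open>af_mult_comp\<close>.\<close>

lemma B_obj_nonzero:
  assumes "nonzero_af \<A>"
  shows "B_obj \<A> \<noteq> Zero_BD" "bd_V (B_obj \<A>) n = vec_of_list (af_sizes \<A> n)"
    "bd_E (B_obj \<A>) n = af_mult \<A> n \<A> (Suc n) id"
  using assms by (auto simp: B_obj_def nonzero_af_def af_mult_def)

lemma af_mult_id_comp:
  assumes "nonzero_af \<A>" "n \<le> m" "m \<le> p"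
  shows "af_mult \<A> n \<A> p id = af_mult \<A> m \<A> p id * af_mult \<A> n \<A> m id"
  using af_mult_comp[OF assms(1) assms(1) assms(1) step_hom_id step_hom_id, of n m p] assms
  by (simp add: nonzero_af_def)

lemma bd_path_B_obj:
  assumes "nonzero_af \<A>"
  shows "bd_path (B_obj \<A>) n k = af_mult \<A> n \<A> (n + k) id"
proof (induction k)
  case 0
  show ?case
    by (simp only: bd_path.simps B_obj_nonzero[OF assms] add_0_right af_mult_id[OF assms] dim_vec_of_list)
next
  case (Suc k)
  have "af_mult \<A> n \<A> (n + Suc k) id = af_mult \<A> (n + k) \<A> (n + Suc k) id * af_mult \<A> n \<A> (n + k) id"
    by (rule af_mult_id_comp[OF assms]) auto
  then show ?case
    by (simp only: bd_path.simps Suc B_obj_nonzero[OF assms] add_Suc_right)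
qed

lemma bd_conn_B_obj: "nonzero_af \<A> \<Longrightarrow> n \<le> m \<Longrightarrow> bd_conn (B_obj \<A>) n m = af_mult \<A> n \<A> m id"
  by (simp add: bd_conn_def bd_path_B_obj)

section \<open>Premorphisms between the diagrams of filtered algebras\<close>

text \<open>Nonnegative matrices preserve entrywise inequalities, so the two size constraints can be
  chained.\<close>

lemma multiplicity_matrix_mult:
  assumes "multiplicity_matrix V1 V2 E" "multiplicity_matrix V2 V3 E'"
  shows "multiplicity_matrix V1 V3 (E' * E)"
proof -
  have c: "E \<in> carrier_mat (dim_vec V2) (dim_vec V1)" "E' \<in> carrier_mat (dim_vec V3) (dim_vec V2)"
    and le: "E *\<^sub>v V1 \<le> V2" "E' *\<^sub>v V2 \<le> V3"
    using assms by (auto simp: multiplicity_matrix_def)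
  have "(E' * E) *\<^sub>v V1 = E' *\<^sub>v (E *\<^sub>v V1)"
    using c by (intro assoc_mult_mat_vec[of _ "dim_vec V3" "dim_vec V2" _ "dim_vec V1"]) auto
  moreover have "E' *\<^sub>v (E *\<^sub>v V1) \<le> E' *\<^sub>v V2"
    using le(1) c unfolding less_eq_vec_def by (auto simp: scalar_prod_def intro!: sum_mono mult_left_mono)
  ultimately show ?thesis
    using c le(2) unfolding multiplicity_matrix_def by auto
qed

context
  fixes \<A> :: "'a::cstar_algebra af_obj" and X
  assumes \<A>: "nonzero_af \<A>" and X: "X = B_obj \<A>"
begin

lemma conn_multiplicity: "n \<le> m \<Longrightarrow> multiplicity_matrix (bd_V X n) (bd_V X m) (bd_conn X n m)"
  using \<A> af_mult_multiplicity[OF \<A> \<A> step_hom_id, of n m]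
  by (simp add: X bd_conn_B_obj B_obj_nonzero nonzero_af_def)

lemma conn_carrier: "n \<le> m \<Longrightarrow> bd_conn X n m \<in> carrier_mat (dim_vec (bd_V X m)) (dim_vec (bd_V X n))"
  using conn_multiplicity by (simp add: multiplicity_matrix_def)

lemma conn_trans: "n \<le> m \<Longrightarrow> m \<le> p \<Longrightarrow> bd_conn X m p * bd_conn X n m = bd_conn X n p"
  using af_mult_comp[OF \<A> \<A> \<A> step_hom_id step_hom_id, of n m p] \<A>
  by (simp add: X bd_conn_B_obj nonzero_af_def)

lemma conn_refl: "bd_conn X n n = 1\<^sub>m (dim_vec (bd_V X n))"
  by (simp add: bd_conn_def)

lemma conn_Suc: "bd_conn X n (Suc n) = bd_E X n"
  using \<A> by (simp add: X bd_conn_B_obj B_obj_nonzero)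

end

context
  fixes \<A> :: "'a::cstar_algebra af_obj" and X and \<B> :: "'b::cstar_algebra af_obj" and Y
  assumes \<A>: "nonzero_af \<A>" and X: "X = B_obj \<A>" and \<B>: "nonzero_af \<B>" and Y: "Y = B_obj \<B>"
begin

text \<open>The defining squares join consecutive levels, while the intertwining skips levels. The
  last claim pastes the squares by induction on \<open>m\<close>.\<close>

lemma premorphismD:
  assumes "premorphism X Y (F, f)"
  shows "mono f" "\<exists>n. f n \<ge> N" "multiplicity_matrix (bd_V X n) (bd_V Y (f n)) (F n)"
    "F n \<in> carrier_mat (dim_vec (bd_V Y (f n))) (dim_vec (bd_V X n))"
    "n \<le> m \<Longrightarrow> F m * bd_conn X n m = bd_conn Y (f n) (f m) * F n"
proof -
  show f: "mono f" and mm: "\<And>n. multiplicity_matrix (bd_V X n) (bd_V Y (f n)) (F n)"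
    using assms by (auto simp: premorphism_def)
  show "\<exists>n. f n \<ge> N"
    using assms by (auto simp: premorphism_def bdd_above_def) (metis nat_le_linear)
  show c: "\<And>n. F n \<in> carrier_mat (dim_vec (bd_V Y (f n))) (dim_vec (bd_V X n))"
    using mm by (simp add: multiplicity_matrix_def)
  show "F m * bd_conn X n m = bd_conn Y (f n) (f m) * F n" if "n \<le> m"
    using that
  proof (induction m rule: dec_induct)
    case base
    show ?case
      by (simp only: conn_refl[OF \<A> X] conn_refl[OF \<B> Y] right_mult_one_mat[OF c] left_mult_one_mat[OF c])
  next
    case (step m)
    have le: "f n \<le> f m" "f m \<le> f (Suc m)" using f step(1) by (auto simp: mono_def)
    note cX = conn_carrier[OF \<A> X] and cY = conn_carrier[OF \<B> Y]
    have "F (Suc m) * bd_conn X n (Suc m) = F (Suc m) * (bd_conn X m (Suc m) * bd_conn X n m)"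
      using step(1) by (simp add: conn_trans[OF \<A> X])
    also have "\<dots> = F (Suc m) * bd_conn X m (Suc m) * bd_conn X n m"
      using step(1) by (intro assoc_mult_mat[symmetric, OF c cX cX]) auto
    also have "F (Suc m) * bd_conn X m (Suc m) = bd_conn Y (f m) (f (Suc m)) * F m"
      using assms by (simp add: conn_Suc[OF \<A> X] premorphism_def)
    also have "bd_conn Y (f m) (f (Suc m)) * F m * bd_conn X n m = bd_conn Y (f m) (f (Suc m)) * (F m * bd_conn X n m)"
      using step(1) le by (intro assoc_mult_mat[OF cY c cX])
    also have "\<dots> = bd_conn Y (f m) (f (Suc m)) * (bd_conn Y (f n) (f m) * F n)"
      by (simp only: step.IH)
    also have "\<dots> = bd_conn Y (f m) (f (Suc m)) * bd_conn Y (f n) (f m) * F n"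
      using le by (intro assoc_mult_mat[symmetric, OF cY cY c])
    also have "\<dots> = bd_conn Y (f n) (f (Suc m)) * F n"
      using le by (simp add: conn_trans[OF \<B> Y])
    finally show ?case .
  qed
qed

lemma premor_equiv_equiv: "equiv {P. premorphism X Y P} (premor_equiv X Y)"
proof (rule equivI)
  show "premor_equiv X Y \<subseteq> {P. premorphism X Y P} \<times> {P. premorphism X Y P}"
    by (auto simp: premor_equiv_def)
  show "refl_on {P. premorphism X Y P} (premor_equiv X Y)"
    by (auto simp: refl_on_def premor_equiv_def)
  show "sym (premor_equiv X Y)"
    unfolding sym_def premor_equiv_def by (auto, metis)
  show "trans (premor_equiv X Y)"
  proof (rule transI)
    fix P Q R assume "(P, Q) \<in> premor_equiv X Y" "(Q, R) \<in> premor_equiv X Y"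
    moreover obtain F f G g H h where eq: "P = (F, f)" "Q = (G, g)" "R = (H, h)"
      by (cases P, cases Q, cases R)
    ultimately have F: "premorphism X Y (F, f)" and G: "premorphism X Y (G, g)" and H: "premorphism X Y (H, h)"
      and FG: "\<And>n. \<exists>m. m \<ge> f n \<and> m \<ge> g n \<and> bd_conn Y (f n) m * F n = bd_conn Y (g n) m * G n"
      and GH: "\<And>n. \<exists>m. m \<ge> g n \<and> m \<ge> h n \<and> bd_conn Y (g n) m * G n = bd_conn Y (h n) m * H n"
      by (auto simp: premor_equiv_def)
    \<comment> \<open>An equality valid at level \<open>m\<close> persists at every later level.
      Both witnesses can therefore be moved to their maximum.\<close>
    have up: "bd_conn Y k m' * L = bd_conn Y m m' * (bd_conn Y k m * L)"
      if "k \<le> m" "m \<le> m'" "L \<in> carrier_mat (dim_vec (bd_V Y k)) d" for k m m' L d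
    proof -
      have "bd_conn Y m m' * bd_conn Y k m * L = bd_conn Y m m' * (bd_conn Y k m * L)"
        by (rule assoc_mult_mat[OF conn_carrier[OF \<B> Y] conn_carrier[OF \<B> Y] that(3)]) (use that in auto)
      then show ?thesis using that by (simp add: conn_trans[OF \<B> Y])
    qed
    have "\<exists>m. m \<ge> f n \<and> m \<ge> h n \<and> bd_conn Y (f n) m * F n = bd_conn Y (h n) m * H n" for n
    proof -
      obtain m1 m2 where m1: "m1 \<ge> f n" "m1 \<ge> g n" "bd_conn Y (f n) m1 * F n = bd_conn Y (g n) m1 * G n"
        and m2: "m2 \<ge> g n" "m2 \<ge> h n" "bd_conn Y (g n) m2 * G n = bd_conn Y (h n) m2 * H n"
        using FG[of n] GH[of n] by blast
      let ?m = "max m1 m2"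
      note c = premorphismD(4)[OF F, of n] premorphismD(4)[OF G, of n] premorphismD(4)[OF H, of n]
      have "bd_conn Y (f n) ?m * F n = bd_conn Y (h n) ?m * H n"
        using up[OF m1(1) _ c(1), of ?m] up[OF m1(2) _ c(2), of ?m] up[OF m2(1) _ c(2), of ?m]
          up[OF m2(2) _ c(3), of ?m] m1(3) m2(3) by simp
      then show ?thesis using m1 m2 by (intro exI[of _ ?m]) auto
    qed
    then show "(P, R) \<in> premor_equiv X Y"
      using F H by (simp add: eq premor_equiv_def)
  qed
qed

end

text \<open>The square of \<open>G\<close> is used between \<open>f n\<close> and
  \<open>f (Suc n)\<close>, which may be far apart, and is pasted to the square of
  \<open>F\<close>.\<close>

lemma premorphism_comp:
  assumes \<A>: "nonzero_af \<A>" and X: "X = B_obj \<A>" and \<B>: "nonzero_af \<B>" and Y: "Y = B_obj \<B>"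
    and \<C>: "nonzero_af \<C>" and Z: "Z = B_obj \<C>"
    and F: "premorphism X Y (F, f)" and G: "premorphism Y Z (G, g)"
  shows "premorphism X Z (premor_comp (G, g) (F, f))"
proof -
  note F' = premorphismD[OF \<A> X \<B> Y F] and G' = premorphismD[OF \<B> Y \<C> Z G]
  have mono: "mono (\<lambda>n. g (f n))" using F'(1) G'(1) by (simp add: mono_def)
  have "\<not> bdd_above (range (\<lambda>n. g (f n)))"
  proof
    assume "bdd_above (range (\<lambda>n. g (f n)))"
    then obtain M where M: "\<And>n. g (f n) \<le> M" by (auto simp: bdd_above_def)
    obtain m where m: "g m \<ge> Suc M" using G'(2)[of "Suc M"] by blast
    obtain n where n: "f n \<ge> m" using F'(2)[of m] by blast
    have "g m \<le> g (f n)" using G'(1) n by (simp add: mono_def)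
    then show False using M[of n] m by simp
  qed
  moreover have "G (f (Suc n)) * F (Suc n) * bd_E X n = bd_conn Z (g (f n)) (g (f (Suc n))) * (G (f n) * F n)" for n
  proof -
    have le: "f n \<le> f (Suc n)" "g (f n) \<le> g (f (Suc n))"
      using F'(1) mono by (auto simp: mono_def)
    have E: "bd_E X n \<in> carrier_mat (dim_vec (bd_V X (Suc n))) (dim_vec (bd_V X n))"
      using conn_carrier[OF \<A> X, of n "Suc n"] conn_Suc[OF \<A> X] by simp
    have "G (f (Suc n)) * F (Suc n) * bd_E X n = G (f (Suc n)) * (F (Suc n) * bd_E X n)"
      by (rule assoc_mult_mat[OF G'(4) F'(4) E])
    also have "\<dots> = G (f (Suc n)) * (bd_conn Y (f n) (f (Suc n)) * F n)"
      using F by (simp add: premorphism_def)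
    also have "\<dots> = G (f (Suc n)) * bd_conn Y (f n) (f (Suc n)) * F n"
      by (rule assoc_mult_mat[symmetric, OF G'(4) conn_carrier[OF \<B> Y le(1)] F'(4)])
    also have "\<dots> = bd_conn Z (g (f n)) (g (f (Suc n))) * G (f n) * F n"
      by (simp only: G'(5)[OF le(1)])
    also have "\<dots> = bd_conn Z (g (f n)) (g (f (Suc n))) * (G (f n) * F n)"
      by (rule assoc_mult_mat[OF conn_carrier[OF \<C> Z le(2)] G'(4) F'(4)])
    finally show ?thesis .
  qed
  ultimately show ?thesis
    using mono multiplicity_matrix_mult[OF F'(3) G'(3)] by (simp add: premorphism_def premor_comp_def)
qed

lemma premorphism_id:
  assumes \<A>: "nonzero_af \<A>" and X: "X = B_obj \<A>"
  shows "premorphism X X (premor_id X)"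
proof -
  have E: "bd_E X n \<in> carrier_mat (dim_vec (bd_V X (Suc n))) (dim_vec (bd_V X n))" for n
    using conn_carrier[OF assms, of n "Suc n"] conn_Suc[OF assms] by simp
  have "multiplicity_matrix (bd_V X n) (bd_V X n) (1\<^sub>m (dim_vec (bd_V X n)))" for n
    using conn_multiplicity[OF assms, of n n] by (simp add: conn_refl[OF assms])
  moreover have "\<not> bdd_above (range (\<lambda>n::nat. n))"
    by (auto simp: bdd_above_def) (metis Suc_n_not_le_n)
  ultimately show ?thesis
    by (simp add: premorphism_def premor_id_def conn_Suc[OF assms] mono_def
        left_mult_one_mat[OF E] right_mult_one_mat[OF E])
qed

lemma premor_class_self: "premorphism X Y P \<Longrightarrow> P \<in> premor_class X Y P"
  by (cases P) (auto simp: premor_equiv_def)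

text \<open>The composite morphism is a union of classes over all representatives. The composite of
  the given two lies in its own class, hence in this union, which is the class of the
  identity.\<close>

lemma bd_comp_eq_idD:
  assumes \<A>: "nonzero_af \<A>" and X: "X = B_obj \<A>" and \<B>: "nonzero_af \<B>" and Y: "Y = B_obj \<B>"
    and F: "premorphism X Y (F, f)" and G: "premorphism Y X (G, g)"
    and comp: "bd_comp X Y X (Mor (premor_class Y X (G, g))) (Mor (premor_class X Y (F, f))) = bd_id X"
  obtains m where "m \<ge> n" "m \<ge> g (f n)"
    "bd_conn X (g (f n)) m * (G (f n) * F n) = bd_conn X n m"
proof -
  have nz: "X \<noteq> Zero_BD" "Y \<noteq> Zero_BD" using assms B_obj_nonzero(1) by auto
  let ?GF = "premor_comp (G, g) (F, f)"
  have GF: "premorphism X X ?GF" by (rule premorphism_comp[OF \<A> X \<B> Y \<A> X F G])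
  have "(G, g) \<in> premor_class Y X (G, g)" "(F, f) \<in> premor_class X Y (F, f)" "?GF \<in> premor_class X X ?GF"
    by (rule premor_class_self[OF G] premor_class_self[OF F] premor_class_self[OF GF])+
  then have "?GF \<in> (\<Union>Q\<in>premor_class Y X (G, g). \<Union>P\<in>premor_class X Y (F, f). premor_class X X (premor_comp Q P))"
    by blast
  moreover have "(\<Union>Q\<in>premor_class Y X (G, g). \<Union>P\<in>premor_class X Y (F, f). premor_class X X (premor_comp Q P))
      = premor_class X X (premor_id X)"
    using comp nz by (simp add: bd_comp_def bd_id_def)
  ultimately have "(premor_id X, ?GF) \<in> premor_equiv X X" by simp
  then obtain m where "m \<ge> n" "m \<ge> g (f n)"
    "bd_conn X n m * 1\<^sub>m (dim_vec (bd_V X n)) = bd_conn X (g (f n)) m * (G (f n) * F n)"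
    unfolding premor_equiv_def premor_id_def premor_comp_def by auto
  then show ?thesis using that conn_carrier[OF \<A> X, of n m] by (simp add: right_mult_one_mat)
qed

section \<open>The intertwining\<close>

text \<open>One edge of the zigzag. A lift of \<open>G m\<close> to a late level composes with
  \<alpha> to a map with the matrix of the inclusion, and an inner correction makes the triangle
  exact. The conclusion has the shape of the assumptions on \<alpha>, so the step can be repeated
  with the two algebras exchanged.\<close>

lemma intertwining_step:
  assumes \<A>: "nonzero_af \<A>" and X: "X = B_obj \<A>" and \<B>: "nonzero_af \<B>" and Y: "Y = B_obj \<B>"
    and F: "premorphism X Y (F, f)" and G: "premorphism Y X (G, g)"
    and GF: "m0 \<ge> n" "m0 \<ge> g (f n)" "bd_conn X (g (f n)) m0 * (G (f n) * F n) = bd_conn X n m0"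
    and \<alpha>: "step_hom \<A> n \<B> m \<alpha>" and fm: "f n \<le> m" and mult: "af_mult \<A> n \<B> m \<alpha> = bd_conn Y (f n) m * F n"
  obtains n' \<beta> where "n' \<ge> N" "n' \<ge> n" "g m \<le> n'" "step_hom \<B> m \<A> n' \<beta>"
    "af_mult \<B> m \<A> n' \<beta> = bd_conn X (g m) n' * G m"
    "\<And>x. x \<in> af_filt \<A> n \<Longrightarrow> \<beta> (\<alpha> x) = x"
proof -
  have af: "af_object \<A>" using \<A> by (simp add: nonzero_af_def)
  \<comment> \<open>\<open>m0\<close> is where \<open>G F\<close> becomes a connecting matrix,
    \<open>g m\<close> is where \<open>G m\<close> lands, and \<open>N\<close> keeps the levels
    unbounded.\<close>
  define n' where "n' = max m0 (max (g m) N)"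
  note F' = premorphismD[OF \<A> X \<B> Y F] and G' = premorphismD[OF \<B> Y \<A> X G]
  have le: "n' \<ge> N" "n' \<ge> n" "g m \<le> n'" "m0 \<le> n'" "g (f n) \<le> g m" "g (f n) \<le> n'"
    using GF G'(1) fm by (auto simp: n'_def mono_def)
  note cX = conn_carrier[OF \<A> X] and cY = conn_carrier[OF \<B> Y]
  let ?M = "bd_conn X (g m) n' * G m"
  have "multiplicity_matrix (bd_V Y m) (bd_V X n') ?M"
    by (rule multiplicity_matrix_mult[OF G'(3) conn_multiplicity[OF \<A> X le(3)]])
  then obtain \<beta>' where \<beta>': "step_hom \<B> m \<A> n' \<beta>'" "af_mult \<B> m \<A> n' \<beta>' = ?M"
    using ex_step_hom[OF \<B> \<A>] \<A> \<B> by (metis X Y B_obj_nonzero(2))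
  \<comment> \<open>Naturality of \<open>G\<close> moves the product back to
    \<open>G (f n) * F n\<close>; factoring the connecting matrices through \<open>m0\<close> then
    brings \<open>GF\<close> into play.\<close>
  have "af_mult \<A> n \<A> n' (\<beta>' \<circ> \<alpha>) = ?M * (bd_conn Y (f n) m * F n)"
    using af_mult_comp[OF \<A> \<B> \<A> \<alpha> \<beta>'(1)] \<beta>'(2) mult by simp
  also have "\<dots> = bd_conn X (g m) n' * (G m * (bd_conn Y (f n) m * F n))"
    using F'(4) fm by (intro assoc_mult_mat[OF cX[OF le(3)] G'(4) mult_carrier_mat[OF cY]]) auto
  also have "G m * (bd_conn Y (f n) m * F n) = G m * bd_conn Y (f n) m * F n"
    by (rule assoc_mult_mat[symmetric, OF G'(4) cY[OF fm] F'(4)])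
  also have "G m * bd_conn Y (f n) m = bd_conn X (g (f n)) (g m) * G (f n)"
    by (rule G'(5)[OF fm])
  also have "bd_conn X (g (f n)) (g m) * G (f n) * F n = bd_conn X (g (f n)) (g m) * (G (f n) * F n)"
    by (rule assoc_mult_mat[OF cX[OF le(5)] G'(4) F'(4)])
  also have "bd_conn X (g m) n' * (bd_conn X (g (f n)) (g m) * (G (f n) * F n))
    = bd_conn X (g m) n' * bd_conn X (g (f n)) (g m) * (G (f n) * F n)"
    by (rule assoc_mult_mat[symmetric, OF cX[OF le(3)] cX[OF le(5)] mult_carrier_mat[OF G'(4) F'(4)]])
  also have "bd_conn X (g m) n' * bd_conn X (g (f n)) (g m) = bd_conn X m0 n' * bd_conn X (g (f n)) m0"
    using le GF by (simp add: conn_trans[OF \<A> X])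
  also have "bd_conn X m0 n' * bd_conn X (g (f n)) m0 * (G (f n) * F n)
    = bd_conn X m0 n' * (bd_conn X (g (f n)) m0 * (G (f n) * F n))"
    by (rule assoc_mult_mat[OF cX[OF le(4)] cX[OF GF(2)] mult_carrier_mat[OF G'(4) F'(4)]])
  also have "\<dots> = bd_conn X n n'"
    using le GF by (simp add: conn_trans[OF \<A> X])
  also have "\<dots> = af_mult \<A> n \<A> n' id"
    using bd_conn_B_obj[OF \<A> le(2)] X by simp
  finally obtain \<gamma> where \<gamma>: "step_hom \<A> n' \<A> n' \<gamma>"
    "\<And>y i. y \<in> af_filt \<A> n' \<Longrightarrow> i < length (af_sizes \<A> n') \<Longrightarrow> af_tr \<A> n' i (\<gamma> y) = af_tr \<A> n' i y"
    "\<And>x. x \<in> af_filt \<A> n \<Longrightarrow> \<gamma> ((\<beta>' \<circ> \<alpha>) x) = id x"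
    using step_hom_conjugate[OF \<A> \<A> step_hom_comp[OF \<alpha> \<beta>'(1)] step_hom_id[OF af le(2)]] by metis
  have hom: "step_hom \<B> m \<A> n' (\<gamma> \<circ> \<beta>')" by (rule step_hom_comp[OF \<beta>'(1) \<gamma>(1)])
  \<comment> \<open>The correction \<gamma> preserves traces, hence does not disturb the matrix
    prescribed by \<open>G\<close>.\<close>
  have "af_mult \<B> m \<A> n' (\<gamma> \<circ> \<beta>') = ?M"
  proof (rule af_mult_eqI[OF \<B> \<A> hom])
    show "?M \<in> carrier_mat (length (af_sizes \<A> n')) (length (af_sizes \<B> m))"
      using af_mult_carrier[OF \<B> \<A> \<beta>'(1)] \<beta>'(2) by simp
    fix x i assume "x \<in> af_filt \<B> m" "i < length (af_sizes \<A> n')"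
    then show "af_tr \<A> n' i ((\<gamma> \<circ> \<beta>') x) = (\<Sum>j<length (af_sizes \<B> m). of_nat (?M $$ (i, j)) * af_tr \<B> m j x)"
      using af_tr_hom[OF \<B> \<A> \<beta>'(1)] \<beta>'(2) \<gamma>(2) step_homD[OF \<beta>'(1)] by simp
  qed
  then show ?thesis using that[OF le(1-3) hom] \<gamma>(3) by simp
qed

section \<open>Limits of compatible chains of homomorphisms\<close>

lemma chain_extension:
  assumes "\<And>k. S k \<subseteq> S (Suc k)" "\<And>k x. x \<in> S k \<Longrightarrow> a (Suc k) x = a k x"
  shows "\<exists>\<phi>. \<forall>k. \<forall>x\<in>S k. \<phi> x = a k x"
proof -
  have mono: "S k \<subseteq> S m" if "k \<le> m" for k m using lift_Suc_mono_le[of S, OF assms(1) that] .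
  have eq: "a m x = a k x" if "k \<le> m" "x \<in> S k" for k m x
    using that(1)
  proof (induction m rule: dec_induct)
    case (step i)
    have "x \<in> S i" using mono[OF step(1)] that(2) by blast
    then show ?case using assms(2) step.IH by simp
  qed simp
  \<comment> \<open>The least level is only a canonical choice; compatibility gives the same value
    at every level containing \<open>x\<close>.\<close>
  have "a (LEAST k. x \<in> S k) x = a k x" if "x \<in> S k" for k x
    by (rule eq[symmetric]) (use that in \<open>auto intro: Least_le LeastI\<close>)
  then show ?thesis by (intro exI[of _ "\<lambda>x. a (LEAST k. x \<in> S k) x"]) blast
qed

lemma continuous_eq_on_dense:
  fixes f g :: "'a::topological_space \<Rightarrow> 'b::t2_space"
  assumes "continuous_on UNIV f" "continuous_on UNIV g" "closure D = UNIV" "\<And>x. x \<in> D \<Longrightarrow> f x = g x"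
  shows "f x = g x"
proof -
  have "closed {x. f x = g x}" using assms by (intro closed_Collect_eq)
  then have "closure D \<subseteq> {x. f x = g x}" using assms(4) by (intro closure_minimal) auto
  then show ?thesis using assms(3) by auto
qed

lemma star_hom_dense_extension:
  fixes \<phi> :: "'a::cstar_algebra \<Rightarrow> 'b::cstar_algebra"
  assumes hom: "star_hom (sub_alg D) (sub_alg UNIV) \<phi>"
    and contr: "\<And>x. x \<in> D \<Longrightarrow> norm (\<phi> x) \<le> norm x"
    and dense: "closure D = UNIV"
    and closed: "\<And>x y. x \<in> D \<Longrightarrow> y \<in> D \<Longrightarrow> x + y \<in> D" "\<And>x y. x \<in> D \<Longrightarrow> y \<in> D \<Longrightarrow> x * y \<in> D"
      "\<And>x c. x \<in> D \<Longrightarrow> c *\<^sub>C x \<in> D" "\<And>x. x \<in> D \<Longrightarrow> star x \<in> D"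
  obtains \<psi> where "star_hom (sub_alg UNIV) (sub_alg UNIV) \<psi>" "continuous_on UNIV \<psi>"
    "\<And>x. x \<in> D \<Longrightarrow> \<psi> x = \<phi> x"
proof -
  have \<phi>: "\<phi> (x + y) = \<phi> x + \<phi> y" "\<phi> (x * y) = \<phi> x * \<phi> y" "\<phi> (c *\<^sub>C x) = c *\<^sub>C \<phi> x" "\<phi> (star x) = star (\<phi> x)"
    if "x \<in> D" "y \<in> D" for x y c
    using hom that by (auto simp: star_hom_def sub_alg_def)
  have dist: "dist (\<phi> x) (\<phi> y) \<le> dist x y" if xy: "x \<in> D" "y \<in> D" for x y
  proof -
    \<comment> \<open>Differences are written with a scalar because the homomorphism laws speak of
      sums and multiples only.\<close>
    have "x + (-1) *\<^sub>C y \<in> D" using xy closed by blast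
    moreover have "\<phi> (x + (-1) *\<^sub>C y) = \<phi> x + (-1) *\<^sub>C \<phi> y" using \<phi> xy closed by metis
    ultimately show ?thesis using contr[of "x + (-1) *\<^sub>C y"] by (simp add: dist_norm)
  qed
  have "uniformly_continuous_on D \<phi>"
    unfolding uniformly_continuous_on_def using dist by (meson order_le_less_trans)
  from uniformly_continuous_on_extension_on_closure[OF this]
  obtain \<psi> where uc: "uniformly_continuous_on (closure D) \<psi>" and eq: "\<And>x. x \<in> D \<Longrightarrow> \<phi> x = \<psi> x"
    by metis
  have c: "continuous_on UNIV \<psi>" using uniformly_continuous_imp_continuous[OF uc] dense by simp
  have c' [continuous_intros]: "continuous_on UNIV (\<lambda>x. \<psi> (f x))" if "continuous_on UNIV f" for f :: "'a \<Rightarrow> 'a"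
    using continuous_on_compose2[OF c that] by simp
  have add: "\<psi> (x + y) = \<psi> x + \<psi> y" for x y
  proof -
    \<comment> \<open>Density is used in one variable at a time: here \<open>x\<close> is in
      \<open>D\<close> and \<open>y\<close> is arbitrary, afterwards \<open>x\<close> is freed
      too.\<close>
    have 1: "\<psi> (x + y) = \<psi> x + \<psi> y" if "x \<in> D" for x y
      by (rule continuous_eq_on_dense[where f = "\<lambda>y. \<psi> (x + y)", OF _ _ dense])
        (use that \<phi> closed in \<open>auto intro!: continuous_intros c simp flip: eq\<close>)
    show ?thesis
      by (rule continuous_eq_on_dense[where f = "\<lambda>x. \<psi> (x + y)", OF _ _ dense])
        (use 1 in \<open>auto intro!: continuous_intros c\<close>)
  qed
  have mult: "\<psi> (x * y) = \<psi> x * \<psi> y" for x y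
  proof -
    have 1: "\<psi> (x * y) = \<psi> x * \<psi> y" if "x \<in> D" for x y
      by (rule continuous_eq_on_dense[where f = "\<lambda>y. \<psi> (x * y)", OF _ _ dense])
        (use that \<phi> closed in \<open>auto intro!: continuous_intros c simp flip: eq\<close>)
    show ?thesis
      by (rule continuous_eq_on_dense[where f = "\<lambda>x. \<psi> (x * y)", OF _ _ dense])
        (use 1 in \<open>auto intro!: continuous_intros c\<close>)
  qed
  have scale: "\<psi> (a *\<^sub>C x) = a *\<^sub>C \<psi> x" for a x
    by (rule continuous_eq_on_dense[where f = "\<lambda>x. \<psi> (a *\<^sub>C x)", OF _ _ dense])
      (use \<phi> closed in \<open>auto intro!: continuous_intros c simp flip: eq\<close>)
  have star: "\<psi> (star x) = star (\<psi> x)" for x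
    by (rule continuous_eq_on_dense[where f = "\<lambda>x. \<psi> (star x)", OF _ _ dense])
      (use \<phi> closed in \<open>auto intro!: continuous_intros c simp flip: eq\<close>)
  show ?thesis
    by (rule that[of \<psi>]) (use add mult scale star c eq in \<open>auto simp: star_hom_def sub_alg_def\<close>)
qed

text \<open>Contractivity of each finite dimensional piece makes the glued map uniformly continuous,
  and \<open>k \<le> ns k\<close> makes the chosen levels exhaust the filtration, so that their
  union is dense.\<close>

lemma star_hom_chain_extension:
  fixes \<A> :: "'a::cstar_algebra af_obj" and \<B> :: "'b::cstar_algebra af_obj"
  assumes \<A>: "nonzero_af \<A>" and ns: "\<And>k. k \<le> ns k" "\<And>k. ns k \<le> ns (Suc k)"
    and \<alpha>: "\<And>k. step_hom \<A> (ns k) \<B> (ms k) (\<alpha> k)"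
    and ext: "\<And>k x. x \<in> af_filt \<A> (ns k) \<Longrightarrow> \<alpha> (Suc k) x = \<alpha> k x"
  obtains \<phi> where "star_hom (sub_alg UNIV) (sub_alg UNIV) \<phi>" "continuous_on UNIV \<phi>"
    "\<And>k x. x \<in> af_filt \<A> (ns k) \<Longrightarrow> \<phi> x = \<alpha> k x"
proof -
  have af: "af_object \<A>" using \<A> by (simp add: nonzero_af_def)
  let ?S = "\<lambda>k. af_filt \<A> (ns k)"
  let ?D = "\<Union>k. ?S k"
  obtain \<phi>0 where \<phi>0: "\<And>k x. x \<in> ?S k \<Longrightarrow> \<phi>0 x = \<alpha> k x"
    using chain_extension[of ?S \<alpha>] af_filt_mono[OF af ns(2)] ext by metis
  interpret block_coord "?S k" "af_sizes \<A> (ns k)" "af_coord \<A> (ns k)" for k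
    by (rule af_block_coord[OF af])
  have common: "\<exists>k. x \<in> ?S k \<and> y \<in> ?S k" if "x \<in> ?D" "y \<in> ?D" for x y
  proof -
    from that(1) obtain k where k: "x \<in> ?S k" by blast
    from that(2) obtain l where l: "y \<in> ?S l" by blast
    have le: "?S i \<subseteq> ?S (max k l)" if "i \<le> max k l" for i
      using af_filt_mono[OF af] lift_Suc_mono_le[of ns, OF ns(2) that] by blast
    show ?thesis using k l le[of k] le[of l] by (intro exI[of _ "max k l"]) auto
  qed
  have "(\<Union>n. af_filt \<A> n) \<subseteq> ?D" using af_filt_mono[OF af ns(1)] by blast
  then have dense: "closure ?D = UNIV"
    using af closure_mono[of "\<Union>n. af_filt \<A> n" ?D] by (auto simp: af_object_def)
  have h: "\<phi>0 (x + y) = \<phi>0 x + \<phi>0 y" "\<phi>0 (x * y) = \<phi>0 x * \<phi>0 y" "\<phi>0 (c *\<^sub>C x) = c *\<^sub>C \<phi>0 x"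
      "\<phi>0 (star x) = star (\<phi>0 x)" "norm (\<phi>0 x) \<le> norm x"
    if "x \<in> ?S k" "y \<in> ?S k" for x y c k
    using \<alpha>[of k] that step_hom_contractive[OF \<A> \<alpha>]
    by (auto simp: \<phi>0[of _ k] star_hom_def sub_alg_def)
  have hom: "star_hom (sub_alg ?D) (sub_alg UNIV) \<phi>0"
    unfolding star_hom_def sub_alg_def using common h by simp metis
  have contr: "norm (\<phi>0 x) \<le> norm x" if "x \<in> ?D" for x using that h(5) by blast
  have cl: "x + y \<in> ?D" "x * y \<in> ?D" if xy: "x \<in> ?D" "y \<in> ?D" for x y
  proof -
    obtain k where k: "x \<in> ?S k" "y \<in> ?S k" using common[OF xy] by blast
    show "x + y \<in> ?D" by (rule UN_I[of k]) (use S_add[OF k] in simp_all)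
    show "x * y \<in> ?D" by (rule UN_I[of k]) (use S_mult[OF k] in simp_all)
  qed
  have cl': "c *\<^sub>C x \<in> ?D" "star x \<in> ?D" if x: "x \<in> ?D" for x c
  proof -
    obtain k where k: "x \<in> ?S k" using x by blast
    show "c *\<^sub>C x \<in> ?D" by (rule UN_I[of k]) (use S_scale[OF k] in simp_all)
    show "star x \<in> ?D" by (rule UN_I[of k]) (use S_star[OF k] in simp_all)
  qed
  obtain \<phi> where \<phi>: "star_hom (sub_alg UNIV) (sub_alg UNIV) \<phi>" "continuous_on UNIV \<phi>"
    "\<And>x. x \<in> ?D \<Longrightarrow> \<phi> x = \<phi>0 x"
    using star_hom_dense_extension[OF hom contr dense cl cl'] by blast
  show ?thesis
  proof (rule that[OF \<phi>(1,2)])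
    fix k x assume "x \<in> ?S k"
    then show "\<phi> x = \<alpha> k x" using \<phi>(3)[of x] \<phi>0 by auto
  qed
qed

text \<open>Dependent choice over triples \<open>(n, m, \<alpha>)\<close>: \<open>P\<close> carries
  the matrix condition for the next step, while \<open>Q\<close> hides the return map \<beta> and
  records both triangles.\<close>

lemma exact_intertwining:
  fixes \<A> :: "'a::cstar_algebra af_obj" and \<B> :: "'b::cstar_algebra af_obj"
  assumes \<A>: "nonzero_af \<A>" and X: "X = B_obj \<A>" and \<B>: "nonzero_af \<B>" and Y: "Y = B_obj \<B>"
    and F: "premorphism X Y (F, f)" and G: "premorphism Y X (G, g)"
    and GF: "\<And>n. \<exists>m\<ge>n. g (f n) \<le> m \<and> bd_conn X (g (f n)) m * (G (f n) * F n) = bd_conn X n m"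
    and FG: "\<And>n. \<exists>m\<ge>n. f (g n) \<le> m \<and> bd_conn Y (f (g n)) m * (F (g n) * G n) = bd_conn Y n m"
  obtains \<phi> \<psi> ns ms where "star_hom (sub_alg UNIV) (sub_alg UNIV) \<phi>" "star_hom (sub_alg UNIV) (sub_alg UNIV) \<psi>"
    "\<psi> \<circ> \<phi> = id" "\<phi> \<circ> \<psi> = id" "mono ns" "mono ms" "\<And>k. k \<le> ns k" "\<And>k. k \<le> ms k" "\<And>k. f (ns k) \<le> ms k"
    "\<And>k. step_hom \<A> (ns k) \<B> (ms k) \<phi>"
    "\<And>k. af_mult \<A> (ns k) \<B> (ms k) \<phi> = bd_conn Y (f (ns k)) (ms k) * F (ns k)"
proof -
  have af: "af_object \<A>" "af_object \<B>" using \<A> \<B> by (simp_all add: nonzero_af_def)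
  define P :: "nat \<Rightarrow> nat \<times> nat \<times> ('a \<Rightarrow> 'b) \<Rightarrow> bool" where
    "P = (\<lambda>k (n, m, \<alpha>). k \<le> n \<and> k \<le> m \<and> f n \<le> m \<and> step_hom \<A> n \<B> m \<alpha> \<and>
       af_mult \<A> n \<B> m \<alpha> = bd_conn Y (f n) m * F n)"
  define Q :: "nat \<times> nat \<times> ('a \<Rightarrow> 'b) \<Rightarrow> nat \<times> nat \<times> ('a \<Rightarrow> 'b) \<Rightarrow> bool" where
    "Q = (\<lambda>(n, m, \<alpha>) (n', m', \<alpha>'). n \<le> n' \<and> m \<le> m' \<and> (\<exists>\<beta>. step_hom \<B> m \<A> n' \<beta> \<and>
       (\<forall>x\<in>af_filt \<A> n. \<beta> (\<alpha> x) = x) \<and> (\<forall>y\<in>af_filt \<B> m. \<alpha>' (\<beta> y) = y)))"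
  have "\<exists>s. \<forall>k. P k (s k) \<and> Q (s k) (s (Suc k))"
  proof (rule dependent_nat_choice[where Q = "\<lambda>_. Q"])
    \<comment> \<open>The zigzag starts with a lift of \<open>F 0\<close> between levels
      \<open>0\<close> and \<open>f 0\<close>, where the connecting matrix is the identity.\<close>
    have mm: "multiplicity_matrix (vec_of_list (af_sizes \<A> 0)) (vec_of_list (af_sizes \<B> (f 0))) (F 0)"
      using premorphismD(3)[OF \<A> X \<B> Y F, of 0] by (simp add: X Y B_obj_nonzero(2)[OF \<A>] B_obj_nonzero(2)[OF \<B>])
    obtain \<alpha> where "step_hom \<A> 0 \<B> (f 0) \<alpha>" "af_mult \<A> 0 \<B> (f 0) \<alpha> = F 0"
      by (rule ex_step_hom[OF \<A> \<B> mm])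
    then have "P 0 (0, f 0, \<alpha>)"
      by (simp add: P_def conn_refl[OF \<B> Y] left_mult_one_mat[OF premorphismD(4)[OF \<A> X \<B> Y F]])
    then show "\<exists>s. P 0 s" by blast
  next
    fix s k assume "P k s"
    moreover obtain n m \<alpha> where s: "s = (n, m, \<alpha>)" by (cases s)
    ultimately have nm: "k \<le> n" "k \<le> m" "f n \<le> m" "step_hom \<A> n \<B> m \<alpha>"
       "af_mult \<A> n \<B> m \<alpha> = bd_conn Y (f n) m * F n" by (simp_all add: P_def)
    obtain m0 where m0: "n \<le> m0" "g (f n) \<le> m0" "bd_conn X (g (f n)) m0 * (G (f n) * F n) = bd_conn X n m0"
      using GF by blast
    obtain n' \<beta> where n': "Suc k \<le> n'" "n \<le> n'" "g m \<le> n'" "step_hom \<B> m \<A> n' \<beta>"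
      "af_mult \<B> m \<A> n' \<beta> = bd_conn X (g m) n' * G m" "\<And>x. x \<in> af_filt \<A> n \<Longrightarrow> \<beta> (\<alpha> x) = x"
      by (rule intertwining_step[OF \<A> X \<B> Y F G m0 nm(4,3,5), of "Suc k"]) blast
    obtain m1 where m1: "m \<le> m1" "f (g m) \<le> m1" "bd_conn Y (f (g m)) m1 * (F (g m) * G m) = bd_conn Y m m1"
      using FG by blast
    obtain m' \<alpha>' where m': "Suc k \<le> m'" "m \<le> m'" "f n' \<le> m'" "step_hom \<A> n' \<B> m' \<alpha>'"
      "af_mult \<A> n' \<B> m' \<alpha>' = bd_conn Y (f n') m' * F n'" "\<And>y. y \<in> af_filt \<B> m \<Longrightarrow> \<alpha>' (\<beta> y) = y"
      by (rule intertwining_step[OF \<B> Y \<A> X G F m1 n'(4,3,5), of "Suc k"]) blast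
    have "P (Suc k) (n', m', \<alpha>')" using n'(1) m' by (simp add: P_def)
    moreover have "Q s (n', m', \<alpha>')" using n' m'(2,6) by (auto simp: Q_def s)
    ultimately show "\<exists>t. P (Suc k) t \<and> Q s t" by blast
  qed
  then obtain s where s: "\<And>k. P k (s k)" "\<And>k. Q (s k) (s (Suc k))" by blast
  define ns ms \<alpha> where "ns = (\<lambda>k. fst (s k))" and "ms = (\<lambda>k. fst (snd (s k)))" and "\<alpha> = (\<lambda>k. snd (snd (s k)))"
  have P: "k \<le> ns k" "k \<le> ms k" "f (ns k) \<le> ms k" "step_hom \<A> (ns k) \<B> (ms k) (\<alpha> k)"
    "af_mult \<A> (ns k) \<B> (ms k) (\<alpha> k) = bd_conn Y (f (ns k)) (ms k) * F (ns k)" for k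
    using s(1)[of k] by (auto simp: P_def ns_def ms_def \<alpha>_def split: prod.splits)
  have Q: "ns k \<le> ns (Suc k)" "ms k \<le> ms (Suc k)" "\<exists>\<beta>. step_hom \<B> (ms k) \<A> (ns (Suc k)) \<beta> \<and>
      (\<forall>x\<in>af_filt \<A> (ns k). \<beta> (\<alpha> k x) = x) \<and> (\<forall>y\<in>af_filt \<B> (ms k). \<alpha> (Suc k) (\<beta> y) = y)" for k
    using s(2)[of k] by (auto simp: Q_def ns_def ms_def \<alpha>_def split: prod.splits)
  obtain \<beta> where \<beta>: "\<And>k. step_hom \<B> (ms k) \<A> (ns (Suc k)) (\<beta> k)"
      "\<And>k x. x \<in> af_filt \<A> (ns k) \<Longrightarrow> \<beta> k (\<alpha> k x) = x"
      "\<And>k y. y \<in> af_filt \<B> (ms k) \<Longrightarrow> \<alpha> (Suc k) (\<beta> k y) = y"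
    using Q(3) by metis
  \<comment> \<open>The lower triangle rewrites \<open>x\<close> as \<beta> of \<alpha> of
    \<open>x\<close>, and the next triangle cancels this \<beta>. So two exact triangles force each
    map to extend the previous one.\<close>
  have \<alpha>_ext: "\<alpha> (Suc k) x = \<alpha> k x" if "x \<in> af_filt \<A> (ns k)" for k x
    using \<beta>(3)[of "\<alpha> k x" k] \<beta>(2)[OF that] step_homD[OF P(4) that] by simp
  have \<beta>_ext: "\<beta> (Suc k) y = \<beta> k y" if "y \<in> af_filt \<B> (ms k)" for k y
    using \<beta>(2)[of "\<beta> k y" "Suc k"] \<beta>(3)[OF that] step_homD[OF \<beta>(1) that] by simp
  obtain \<phi> where \<phi>: "star_hom (sub_alg UNIV) (sub_alg UNIV) \<phi>" "continuous_on UNIV \<phi>"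
    "\<And>k x. x \<in> af_filt \<A> (ns k) \<Longrightarrow> \<phi> x = \<alpha> k x"
    using star_hom_chain_extension[where ?\<A> = \<A> and ?\<B> = \<B> and ?ns = ns and ?ms = ms and ?\<alpha> = \<alpha>, OF \<A> P(1) Q(1) P(4) \<alpha>_ext]
    by metis
  obtain \<psi> where \<psi>: "star_hom (sub_alg UNIV) (sub_alg UNIV) \<psi>" "continuous_on UNIV \<psi>"
    "\<And>k y. y \<in> af_filt \<B> (ms k) \<Longrightarrow> \<psi> y = \<beta> k y"
    using star_hom_chain_extension[where ?\<A> = \<B> and ?\<B> = \<A> and ?ns = ms and ?ms = "\<lambda>k. ns (Suc k)" and ?\<alpha> = \<beta>, OF \<B> P(2) Q(2) \<beta>(1) \<beta>_ext]
    by metis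
  have denseA: "closure (\<Union>n. af_filt \<A> n) = UNIV" and denseB: "closure (\<Union>n. af_filt \<B> n) = UNIV"
    using af by (simp_all add: af_object_def)
  have "\<psi> (\<phi> x) = x" for x
  proof (rule continuous_eq_on_dense[where f = "\<lambda>x. \<psi> (\<phi> x)", OF _ _ denseA])
    show "continuous_on UNIV (\<lambda>x. \<psi> (\<phi> x))"
      by (rule continuous_on_compose2[OF \<psi>(2) \<phi>(2)]) simp
    fix x assume "x \<in> (\<Union>n. af_filt \<A> n)"
    then obtain k where "x \<in> af_filt \<A> k" by blast
    then have x: "x \<in> af_filt \<A> (ns k)" using af_filt_mono[OF af(1) P(1)] by blast
    show "\<psi> (\<phi> x) = x"
      using \<phi>(3)[OF x] \<psi>(3)[OF step_homD[OF P(4) x]] \<beta>(2)[OF x] by simp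
  qed simp
  then have \<psi>\<phi>: "\<psi> \<circ> \<phi> = id" by auto
  have "\<phi> (\<psi> y) = y" for y
  proof (rule continuous_eq_on_dense[where f = "\<lambda>x. \<phi> (\<psi> x)", OF _ _ denseB])
    show "continuous_on UNIV (\<lambda>x. \<phi> (\<psi> x))"
      by (rule continuous_on_compose2[OF \<phi>(2) \<psi>(2)]) simp
    fix y assume "y \<in> (\<Union>n. af_filt \<B> n)"
    then obtain k where "y \<in> af_filt \<B> k" by blast
    then have y: "y \<in> af_filt \<B> (ms k)" using af_filt_mono[OF af(2) P(2)] by blast
    show "\<phi> (\<psi> y) = y"
      using \<psi>(3)[OF y] \<phi>(3)[OF step_homD[OF \<beta>(1) y]] \<beta>(3)[OF y] by simp
  qed simp
  then have \<phi>\<psi>: "\<phi> \<circ> \<psi> = id" by auto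
  have mono: "mono ns" "mono ms" using Q by (simp_all add: mono_iff_le_Suc)
  have step: "step_hom \<A> (ns k) \<B> (ms k) \<phi>" for k
    by (rule step_hom_cong[OF af(1) P(4)]) (simp add: \<phi>(3))
  have "af_mult \<A> (ns k) \<B> (ms k) \<phi> = bd_conn Y (f (ns k)) (ms k) * F (ns k)" for k
    using af_mult_cong[OF \<A> \<B> P(4), of k \<phi>] \<phi>(3) P(5) by simp
  then show ?thesis
    using that[OF \<phi>(1) \<psi>(1) \<psi>\<phi> \<phi>\<psi> mono P(1-3) step] by blast
qed

section \<open>The class assigned to the constructed isomorphism\<close>

lemma not_bdd_above_ge_id: "(\<And>n. n \<le> h n) \<Longrightarrow> \<not> bdd_above (range (h :: nat \<Rightarrow> nat))"
  by (auto simp: bdd_above_def) (meson Suc_n_not_le_n order_trans)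

text \<open>\<open>B_mor\<close> works with unknown data picked by \<open>SOME\<close>. Their
  matrices are compared at a late level with those of \<phi> itself, which realizes \<open>F\<close>
  there.\<close>

lemma B_mor_eq_class:
  fixes \<A> :: "'a::cstar_algebra af_obj" and \<B> :: "'b::cstar_algebra af_obj"
  assumes \<A>: "nonzero_af \<A>" and X: "X = B_obj \<A>" and \<B>: "nonzero_af \<B>" and Y: "Y = B_obj \<B>"
    and F: "premorphism X Y (F, f)" and \<phi>: "star_hom (sub_alg UNIV) (sub_alg UNIV) \<phi>"
    and idx: "mono ns" "mono ms" "\<And>k. k \<le> ns k" "\<And>k. k \<le> ms k" "\<And>k. f (ns k) \<le> ms k"
    and step: "\<And>k. step_hom \<A> (ns k) \<B> (ms k) \<phi>"
    and mult: "\<And>k. af_mult \<A> (ns k) \<B> (ms k) \<phi> = bd_conn Y (f (ns k)) (ms k) * F (ns k)"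
  shows "B_mor \<A> \<B> \<phi> = Mor (premor_class X Y (F, f))"
proof -
  have af: "af_object \<A>" "af_object \<B>" using \<A> \<B> by (simp_all add: nonzero_af_def)
  note F' = premorphismD[OF \<A> X \<B> Y F]
  have Ad_one: "tilde_Ad tilde_one \<circ> \<phi> = \<phi>" by (simp add: tilde_Ad_one fun_eq_iff)
  have sub: "\<phi> ` af_filt \<A> n \<subseteq> af_filt \<B> m" if "n \<le> ns k" "ms k \<le> m" for n k m
    using af_filt_mono[OF af(1) that(1)] step_homD[OF step[of k]] af_filt_mono[OF af(2) that(2)] by blast
  \<comment> \<open>One admissible pair ensures that the picked pair is admissible. Here trivial
    unitaries suffice, since \<phi> maps level \<open>n\<close>, contained in level
    \<open>ns n\<close>, into level \<open>ms n\<close>.\<close>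
  have "B_admissible \<A> \<B> \<phi> (\<lambda>_. tilde_one, ms)"
    unfolding B_admissible_def
    using sub[OF idx(3) order_refl] idx(2) not_bdd_above_ge_id[OF idx(4)]
    by (simp add: tilde_Ad_one tilde_unitary_one tilde_norm_zero)
  then have adm: "B_admissible \<A> \<B> \<phi> (SOME uf. B_admissible \<A> \<B> \<phi> uf)" by (rule someI)
  obtain u h where uh: "(SOME uf. B_admissible \<A> \<B> \<phi> uf) = (u, h)" by (cases "SOME uf. B_admissible \<A> \<B> \<phi> uf")
  have adm': "B_admissible \<A> \<B> \<phi> (u, h)" using adm by (simp only: uh)
  note adm' = adm'[unfolded B_admissible_def prod.case]
  have u: "tilde_unitary (u n)" "tilde_norm (u n - tilde_one) < 1 / 2"
    and img: "(tilde_Ad (u n) \<circ> \<phi>) ` af_filt \<A> n \<subseteq> af_filt \<B> (h n)" for n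
    using adm' by metis+
  have h: "mono h" "\<not> bdd_above (range h)"
    using adm' by metis+
  define R where "R = (\<lambda>n. af_mult \<A> n \<B> (h n) (tilde_Ad (u n) \<circ> \<phi>))"
  have prem: "B_premor \<A> \<B> \<phi> (u, h) = (R, h)"
    by (simp add: B_premor_def R_def af_mult_def)
  have homs: "step_hom \<A> n \<B> (h n) (tilde_Ad (u n) \<circ> \<phi>)" for n
    by (rule af_mult_tilde_Ad_eq(1)[OF \<A> \<B> u u \<phi> img img])
  have up: "step_hom \<B> (h n) \<B> m id" if "h n \<le> m" for n m
    by (rule step_hom_id[OF af(2) that])
  have conn_R: "bd_conn Y (h n) m * R n = af_mult \<A> n \<B> m (tilde_Ad (u n) \<circ> \<phi>)" if "h n \<le> m" for n m
    using af_mult_comp[OF \<A> \<B> \<B> homs up[OF that]] bd_conn_B_obj[OF \<B> that] by (simp add: R_def Y)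
  have img': "(tilde_Ad (u n) \<circ> \<phi>) ` af_filt \<A> n \<subseteq> af_filt \<B> m" if "h n \<le> m" for n m
    using img[of n] af_filt_mono[OF af(2) that] by blast
  have "premorphism X Y (R, h)"
    unfolding premorphism_def
  proof (simp, intro conjI allI)
    show "mono h" "\<not> bdd_above (range h)" by (rule h)+
    show "multiplicity_matrix (bd_V X n) (bd_V Y (h n)) (R n)" for n
      using af_mult_multiplicity[OF \<A> \<B> homs] by (simp add: R_def X Y B_obj_nonzero(2)[OF \<A>] B_obj_nonzero(2)[OF \<B>])
    fix n
    have le: "h n \<le> h (Suc n)" using h(1) by (simp add: mono_def)
    have inc: "step_hom \<A> n \<A> (Suc n) id" by (rule step_hom_id[OF af(1)]) simp
    have "R (Suc n) * bd_E X n = af_mult \<A> n \<B> (h (Suc n)) (tilde_Ad (u (Suc n)) \<circ> \<phi>)"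
      using af_mult_comp[OF \<A> \<A> \<B> inc homs] by (simp add: R_def X B_obj_nonzero(3)[OF \<A>])
    \<comment> \<open>The unitaries at consecutive levels are unrelated, but both are close to the
      identity and give the same matrix on level \<open>n\<close>.\<close>
    also have "\<dots> = af_mult \<A> n \<B> (h (Suc n)) (tilde_Ad (u n) \<circ> \<phi>)"
      using img[of "Suc n"] af_filt_mono[OF af(1), of n "Suc n"]
      by (intro af_mult_tilde_Ad_eq(2)[OF \<A> \<B> u u \<phi> _ img'[OF le]]) auto
    finally show "R (Suc n) * bd_E X n = bd_conn Y (h n) (h (Suc n)) * R n"
      using conn_R[OF le] by simp
  qed
  moreover have "\<exists>m. m \<ge> f n \<and> m \<ge> h n \<and> bd_conn Y (f n) m * F n = bd_conn Y (h n) m * R n" for n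
  proof -
    \<comment> \<open>At this level both the conjugated and the plain image of level
      \<open>n\<close> are available.\<close>
    define m where "m = max (h n) (ms n)"
    note cX = conn_carrier[OF \<A> X] and cY = conn_carrier[OF \<B> Y]
    have le: "h n \<le> m" "ms n \<le> m" "f n \<le> f (ns n)" "f n \<le> m" "f (ns n) \<le> m"
      using monoD[OF F'(1) idx(3)[of n]] idx(5)[of n] by (auto simp: m_def)
    have img1: "(tilde_Ad tilde_one \<circ> \<phi>) ` af_filt \<A> n \<subseteq> af_filt \<B> m"
      unfolding Ad_one using le(2) idx(3) by (intro sub)
    have "bd_conn Y (h n) m * R n = af_mult \<A> n \<B> m (tilde_Ad (u n) \<circ> \<phi>)" by (rule conn_R[OF le(1)])
    also have "\<dots> = af_mult \<A> n \<B> m (tilde_Ad tilde_one \<circ> \<phi>)"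
      by (rule af_mult_tilde_Ad_eq(2)[OF \<A> \<B> u tilde_unitary_one _ \<phi> img'[OF le(1)] img1])
        (simp add: tilde_norm_zero)
    \<comment> \<open>The identities stand for inclusions: level \<open>n\<close> into
      \<open>ns n\<close>, then \<phi> into \<open>ms n\<close>, then into \<open>m\<close>. This
      inserts the known matrix of \<phi>.\<close>
    also have "\<dots> = af_mult \<A> n \<B> m (id \<circ> (\<phi> \<circ> id))" by (simp add: Ad_one)
    also have "\<dots> = bd_conn Y (ms n) m * (af_mult \<A> (ns n) \<B> (ms n) \<phi> * bd_conn X n (ns n))"
      using af_mult_comp[OF \<A> \<B> \<B> step_hom_comp[OF step_hom_id[OF af(1) idx(3)] step] step_hom_id[OF af(2) le(2)]]
        af_mult_comp[OF \<A> \<A> \<B> step_hom_id[OF af(1) idx(3)] step]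
        bd_conn_B_obj[OF \<B> le(2)] bd_conn_B_obj[OF \<A> idx(3)] by (simp add: X Y)
    also have "af_mult \<A> (ns n) \<B> (ms n) \<phi> * bd_conn X n (ns n) = bd_conn Y (f (ns n)) (ms n) * (F (ns n) * bd_conn X n (ns n))"
      unfolding mult by (rule assoc_mult_mat[OF cY[OF idx(5)] F'(4) cX[OF idx(3)]])
    also have "F (ns n) * bd_conn X n (ns n) = bd_conn Y (f n) (f (ns n)) * F n"
      by (rule F'(5)[OF idx(3)])
    also have "bd_conn Y (f (ns n)) (ms n) * (bd_conn Y (f n) (f (ns n)) * F n) = bd_conn Y (f n) (ms n) * F n"
      using assoc_mult_mat[OF cY[OF idx(5)] cY[OF le(3)] F'(4)] conn_trans[OF \<B> Y le(3) idx(5)] by simp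
    also have "bd_conn Y (ms n) m * (bd_conn Y (f n) (ms n) * F n) = bd_conn Y (f n) m * F n"
      using assoc_mult_mat[OF cY[OF le(2)] cY[OF order_trans[OF le(3) idx(5)]] F'(4)]
        conn_trans[OF \<B> Y order_trans[OF le(3) idx(5)] le(2)] by simp
    finally show ?thesis using le by (intro exI[of _ m]) simp
  qed
  ultimately have "((F, f), (R, h)) \<in> premor_equiv X Y"
    using F unfolding premor_equiv_def by simp
  then have "premor_class X Y (R, h) = premor_class X Y (F, f)"
    using equiv_class_eq[OF premor_equiv_equiv[OF \<A> X \<B> Y]] by metis
  then show ?thesis
    using \<A> \<B> unfolding B_mor_def uh prem by (simp add: nonzero_af_def X Y)
qed

text \<open>Equivalence would make some connecting matrix from level 0 vanish. The unit of that
  level would have trace 0 in every later block, so this projection would be 0, against its entry 1.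
  This excludes isomorphisms between zero and nonzero diagrams.\<close>

lemma premor_zero_not_equiv_id:
  assumes \<A>: "nonzero_af \<A>" and X: "X = B_obj \<A>"
  shows "Mor (premor_class X X (premor_zero X X)) \<noteq> bd_id X"
proof
  have af: "af_object \<A>" using \<A> by (simp add: nonzero_af_def)
  assume "Mor (premor_class X X (premor_zero X X)) = bd_id X"
  then have "premor_class X X (premor_zero X X) = premor_class X X (premor_id X)"
    using B_obj_nonzero(1)[OF \<A>] by (simp add: bd_id_def X)
  then have "(premor_zero X X, premor_id X) \<in> premor_equiv X X"
    using premor_class_self[OF premorphism_id[OF assms]] by blast
  then obtain m where "bd_conn X 0 m * 0\<^sub>m (dim_vec (bd_V X 0)) (dim_vec (bd_V X 0)) = bd_conn X 0 m * 1\<^sub>m (dim_vec (bd_V X 0))"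
    unfolding premor_equiv_def premor_zero_def premor_id_def by auto
  then have zero: "bd_conn X 0 m = 0\<^sub>m (dim_vec (bd_V X m)) (dim_vec (bd_V X 0))"
    using conn_carrier[OF assms, of 0 m] by (simp add: right_mult_one_mat right_mult_zero_mat)
  have step: "step_hom \<A> 0 \<A> m id" by (rule step_hom_id[OF af]) simp
  interpret block_coord "af_filt \<A> k" "af_sizes \<A> k" "af_coord \<A> k" for k by (rule af_block_coord[OF af])
  let ?p = "one 0"
  have p: "?p \<in> af_filt \<A> m" using step_homD[OF step, of ?p] by simp
  have "af_tr \<A> m i ?p = 0" if "i < length (af_sizes \<A> m)" for i
    using af_tr_hom[OF \<A> \<A> step, of ?p i] that zero bd_conn_B_obj[OF \<A>, of 0 m]
    by (simp add: X B_obj_nonzero(2)[OF \<A>])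
  then have "?p = 0"
    using projection_tr_zero[OF p projection_one] p by (simp add: tr_eq_mat_tr af_tr_def)
  moreover have j: "0 < length (af_sizes \<A> 0)" using \<A> by (simp add: nonzero_af_def af_object_def)
  moreover have "0 < af_sizes \<A> 0 ! 0" using af_sizes_pos[OF \<A> j] by simp
  ultimately show False using ent_one[of 0 0 0 0] ent_zero[of 0 0 0 0] by simp
qed

theorem theorem3p11:
  fixes \<A>1 :: "'a::cstar_algebra af_obj" and \<A>2 :: "'b::cstar_algebra af_obj"
    and \<theta> :: bd_mor
  assumes "af_object \<A>1" and "af_object \<A>2"
    and "bd_iso (B_obj \<A>1) (B_obj \<A>2) \<theta>"
  shows "\<exists>\<phi>. af_iso \<A>1 \<A>2 \<phi> \<and> \<theta> = B_mor \<A>1 \<A>2 \<phi>"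
proof -
  let ?X = "B_obj \<A>1" and ?Y = "B_obj \<A>2"
  obtain \<eta> where \<theta>: "\<theta> \<in> bd_hom ?X ?Y" and \<eta>: "\<eta> \<in> bd_hom ?Y ?X"
    and id1: "bd_comp ?X ?Y ?X \<eta> \<theta> = bd_id ?X" and id2: "bd_comp ?Y ?X ?Y \<theta> \<eta> = bd_id ?Y"
    using assms(3) by (auto simp: bd_iso_def)
  consider (zero) "zero_algebra TYPE('a)" "zero_algebra TYPE('b)"
    | (left) "nonzero_af \<A>1" "zero_algebra TYPE('b)"
    | (right) "zero_algebra TYPE('a)" "nonzero_af \<A>2"
    | (nonzero) "nonzero_af \<A>1" "nonzero_af \<A>2"
    using assms by (auto simp: nonzero_af_def)
  then show ?thesis
  proof cases
    case zero
    then have "?X = Zero_BD" "?Y = Zero_BD" by (simp_all add: B_obj_def)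
    then have "\<theta> = Zero_mor" using \<theta> by (simp add: bd_hom_def split: if_splits)
    \<comment> \<open>Both algebras are single points, so the constant maps are mutually
      inverse.\<close>
    moreover have "af_iso \<A>1 \<A>2 (\<lambda>_. 0)"
      unfolding af_iso_def af_hom_def
    proof (intro conjI bexI[of _ "\<lambda>_. 0"] CollectI)
      have z: "x = 0" "y = 0" for x :: 'a and y :: 'b using zero by auto
      show "(\<lambda>_. 0) \<circ> (\<lambda>_::'a. 0::'b) = id" by (rule ext) (rule trans[OF z(1) z(1)[symmetric]])
      show "(\<lambda>_::'a. 0::'b) \<circ> (\<lambda>_. 0) = id" by (rule ext) (rule trans[OF z(2) z(2)[symmetric]])
    qed (use assms in \<open>simp_all add: star_hom_def sub_alg_def\<close>)
    ultimately show ?thesis using zero by (intro exI[of _ "\<lambda>_. 0"]) (simp add: B_mor_def)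
  next
    case left
    then have "?Y = Zero_BD" "?X \<noteq> Zero_BD" by (simp_all add: B_obj_def nonzero_af_def)
    \<comment> \<open>A composite through the zero diagram is the class of the zero premorphism, so
      it cannot be the identity of the nonzero side.\<close>
    then show ?thesis using premor_zero_not_equiv_id[OF left(1) refl] id1 by (simp add: bd_comp_def)
  next
    case right
    then have "?X = Zero_BD" "?Y \<noteq> Zero_BD" by (simp_all add: B_obj_def nonzero_af_def)
    then show ?thesis using premor_zero_not_equiv_id[OF right(2) refl] id2 by (simp add: bd_comp_def)
  next
    case nonzero
    note A = nonzero(1) and B = nonzero(2)
    have nz: "?X \<noteq> Zero_BD" "?Y \<noteq> Zero_BD" using A B by (auto dest: B_obj_nonzero(1))
    have "\<theta> \<in> Mor ` ({P. premorphism ?X ?Y P} // premor_equiv ?X ?Y)"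
      and "\<eta> \<in> Mor ` ({P. premorphism ?Y ?X P} // premor_equiv ?Y ?X)"
      using \<theta> \<eta> nz by (simp_all add: bd_hom_def split: if_splits)
    then obtain F f G g where F: "premorphism ?X ?Y (F, f)" "\<theta> = Mor (premor_class ?X ?Y (F, f))"
      and G: "premorphism ?Y ?X (G, g)" "\<eta> = Mor (premor_class ?Y ?X (G, g))"
      by (auto elim!: quotientE)
    \<comment> \<open>Both composites are needed: this one supplies the triangles over the first
      algebra, \<open>FG\<close> those over the second.\<close>
    have GF: "\<exists>m\<ge>n. g (f n) \<le> m \<and> bd_conn ?X (g (f n)) m * (G (f n) * F n) = bd_conn ?X n m" for n
      using bd_comp_eq_idD[OF A refl B refl F(1) G(1), of n] id1 F(2) G(2) by blast
    have FG: "\<exists>m\<ge>n. f (g n) \<le> m \<and> bd_conn ?Y (f (g n)) m * (F (g n) * G n) = bd_conn ?Y n m" for n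
      using bd_comp_eq_idD[OF B refl A refl G(1) F(1), of n] id2 F(2) G(2) by blast
    show ?thesis
    proof (rule exact_intertwining[OF A refl B refl F(1) G(1) GF FG])
      fix \<phi> :: "'a \<Rightarrow> 'b" and \<psi> :: "'b \<Rightarrow> 'a" and ns ms :: "nat \<Rightarrow> nat"
      assume hom: "star_hom (sub_alg UNIV) (sub_alg UNIV) \<phi>" "star_hom (sub_alg UNIV) (sub_alg UNIV) \<psi>"
        and inv: "\<psi> \<circ> \<phi> = id" "\<phi> \<circ> \<psi> = id"
        and real: "mono ns" "mono ms" "\<And>k. k \<le> ns k" "\<And>k. k \<le> ms k" "\<And>k. f (ns k) \<le> ms k"
          "\<And>k. step_hom \<A>1 (ns k) \<A>2 (ms k) \<phi>"
          "\<And>k. af_mult \<A>1 (ns k) \<A>2 (ms k) \<phi> = bd_conn ?Y (f (ns k)) (ms k) * F (ns k)"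
      have "\<theta> = B_mor \<A>1 \<A>2 \<phi>"
        using B_mor_eq_class[OF A refl B refl F(1) hom(1) real] F(2) by simp
      moreover have "af_iso \<A>1 \<A>2 \<phi>"
        using hom inv assms by (auto simp: af_iso_def af_hom_def)
      ultimately show ?thesis by blast
    qed
  qed
qed

end
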